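(* Let $G$ be a locally compact Hausdorff second countable groupoid with a left Haar system. There exists a bounded left approximate identity $\{F_n\}$, with each $F_n\ge0$, in the normed algebra $(C_c(G),\|\cdot\|_{I,r})$ such that $L_{F_n}\to I$ in the strong operator topology of $\mathfrak B(E^2)$.
   Context: $G$ has unit space $G^0$, range map $r$, $G^u=r^{-1}(\{u\})$, left Haar system $\{\lambda^u\}$ with $\lambda^u$ on $G^u$. $C_c(G)$ is an algebra under $(f*g)(x)=\int f(t)g(t^{-1}x)\,d\lambda^{r(x)}(t)$, and $\|f\|_{I,r}=\sup_{u}\int_{G^u}|f|\,d\lambda^u$ is a submultiplicative norm on it. $L^2(G)=\{L^2(G^u,\lambda^u)\}_{u}$ is the continuous field of Hilbert spaces over $G^0$ whose continuous sections are determined by $C_c(G)$ via $f\mapsto(u\mapsto f|_{G^u})$; $E^2$ is the Banach space of its continuous sections vanishing at infinity, with norm $\sup_u\|\xi^u\|$; $C_c(G)$ is dense in $E^2$. For $F\in C_c(G)$, $L_F$ is the bounded operator on $E^2$ extending $f\mapsto F*f$ ($f\in C_c(G)$). $\mathfrak B(E^2)$ is the algebra of bounded linear operators on the Banach space $E^2$. *)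

theory Defs
  imports "HOL-Analysis.Analysis"
begin

section \<open>The Hilbert space \<open>L\<^sup>2(M)\<close> as a quotient\<close>

definition L2_fun :: "'a measure \<Rightarrow> ('a \<Rightarrow> complex) set" where
  "L2_fun M = {f \<in> borel_measurable M. integrable M (\<lambda>x. (cmod (f x))\<^sup>2)}"

definition L2_eq :: "'a measure \<Rightarrow> (('a \<Rightarrow> complex) \<times> ('a \<Rightarrow> complex)) set" where
  "L2_eq M = {(f, g). f \<in> L2_fun M \<and> g \<in> L2_fun M \<and> (AE x in M. f x = g x)}"

definition L2_class :: "'a measure \<Rightarrow> ('a \<Rightarrow> complex) \<Rightarrow> ('a \<Rightarrow> complex) set" where
  "L2_class M f = L2_eq M `` {f}"

definition L2_space :: "'a measure \<Rightarrow> ('a \<Rightarrow> complex) set set" where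
  "L2_space M = L2_fun M // L2_eq M"

definition L2_add ::
    "'a measure \<Rightarrow> ('a \<Rightarrow> complex) set \<Rightarrow> ('a \<Rightarrow> complex) set \<Rightarrow> ('a \<Rightarrow> complex) set" where
  "L2_add M A B = (\<Union>f\<in>A. \<Union>g\<in>B. L2_class M (\<lambda>x. f x + g x))"

definition L2_scale :: "'a measure \<Rightarrow> complex \<Rightarrow> ('a \<Rightarrow> complex) set \<Rightarrow> ('a \<Rightarrow> complex) set" where
  "L2_scale M c A = (\<Union>f\<in>A. L2_class M (\<lambda>x. c * f x))"

definition L2_norm :: "'a measure \<Rightarrow> ('a \<Rightarrow> complex) set \<Rightarrow> real" where
  "L2_norm M A = the_elem ((\<lambda>f. sqrt (\<integral>x. (cmod (f x))\<^sup>2 \<partial>M)) ` A)"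

lemma equiv_L2_eq: "equiv (L2_fun M) (L2_eq M)"
proof (rule equivI)
  show "L2_eq M \<subseteq> L2_fun M \<times> L2_fun M"
    unfolding L2_eq_def by blast
  show "refl_on (L2_fun M) (L2_eq M)"
    by (rule refl_onI) (simp add: L2_eq_def)
  show "sym (L2_eq M)"
  proof (rule symI)
    fix f g assume *: "(f, g) \<in> L2_eq M"
    then have "AE x in M. f x = g x" unfolding L2_eq_def by blast
    then have "AE x in M. g x = f x" by (rule AE_mp) simp
    with * show "(g, f) \<in> L2_eq M" unfolding L2_eq_def by blast
  qed
  show "trans (L2_eq M)"
  proof (rule transI)
    fix f g h assume *: "(f, g) \<in> L2_eq M" "(g, h) \<in> L2_eq M"
    then have "AE x in M. f x = g x" "AE x in M. g x = h x" unfolding L2_eq_def by blast+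
    then have "AE x in M. f x = h x" by eventually_elim (rule trans)
    with * show "(f, h) \<in> L2_eq M" unfolding L2_eq_def by blast
  qed
qed

lemma L2_norm_class:
  assumes "f \<in> L2_fun M"
  shows "L2_norm M (L2_class M f) = sqrt (\<integral>x. (cmod (f x))\<^sup>2 \<partial>M)"
proof -
  have eq: "(\<integral>x. (cmod (g x))\<^sup>2 \<partial>M) = (\<integral>x. (cmod (f x))\<^sup>2 \<partial>M)" if "g \<in> L2_class M f" for g
  proof (rule integral_cong_AE)
    have "(f, g) \<in> L2_eq M" using that unfolding L2_class_def by blast
    then have AE: "AE x in M. f x = g x"
      and [measurable]: "f \<in> borel_measurable M" "g \<in> borel_measurable M"
      unfolding L2_eq_def L2_fun_def by blast+
    from AE show "AE x in M. (cmod (g x))\<^sup>2 = (cmod (f x))\<^sup>2" by (rule AE_mp) simp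
    show "(\<lambda>x. (cmod (g x))\<^sup>2) \<in> borel_measurable M" by measurable
    show "(\<lambda>x. (cmod (f x))\<^sup>2) \<in> borel_measurable M" by measurable
  qed
  have "f \<in> L2_class M f"
    using assms by (simp add: L2_class_def L2_eq_def)
  then have "(\<lambda>g. sqrt (\<integral>x. (cmod (g x))\<^sup>2 \<partial>M)) ` L2_class M f
      = (\<lambda>g. sqrt (\<integral>x. (cmod (f x))\<^sup>2 \<partial>M)) ` L2_class M f"
    by (intro image_cong refl arg_cong[where f = sqrt] eq)
  also have "\<dots> = {sqrt (\<integral>x. (cmod (f x))\<^sup>2 \<partial>M)}"
    using \<open>f \<in> L2_class M f\<close> by (rule image_constant)
  finally show ?thesis by (simp only: L2_norm_def the_elem_eq)
qed


section \<open>Locally compact groupoids and left Haar systems\<close>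

text \<open>The groupoid is the whole type; multiplication is only meaningful on composable pairs.\<close>

record 'g groupoid =
  composable :: "('g \<times> 'g) set"
  gmult :: "'g \<Rightarrow> 'g \<Rightarrow> 'g"
  ginv :: "'g \<Rightarrow> 'g"

definition rng :: "'g groupoid \<Rightarrow> 'g \<Rightarrow> 'g" where
  "rng G x = gmult G x (ginv G x)"

definition src :: "'g groupoid \<Rightarrow> 'g \<Rightarrow> 'g" where
  "src G x = gmult G (ginv G x) x"

definition units :: "'g groupoid \<Rightarrow> 'g set" where
  "units G = range (rng G)"

definition fibre :: "'g groupoid \<Rightarrow> 'g \<Rightarrow> 'g set" where
  "fibre G u = {x. rng G x = u}"

locale groupoid =
  fixes G :: "'g groupoid"
  assumes assoc_composable:
      "(x, y) \<in> composable G \<Longrightarrow> (y, z) \<in> composable G \<Longrightarrow>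
        (gmult G x y, z) \<in> composable G \<and> (x, gmult G y z) \<in> composable G"
    and assoc:
      "(x, y) \<in> composable G \<Longrightarrow> (y, z) \<in> composable G \<Longrightarrow>
        gmult G (gmult G x y) z = gmult G x (gmult G y z)"
    and inv_inv: "ginv G (ginv G x) = x"
    and inv_composable: "(x, ginv G x) \<in> composable G"
    and cancel_left: "(x, y) \<in> composable G \<Longrightarrow> gmult G (ginv G x) (gmult G x y) = y"
    and cancel_right: "(x, y) \<in> composable G \<Longrightarrow> gmult G (gmult G x y) (ginv G y) = x"

text \<open>Hausdorffness and second countability are the sort constraints on the type.\<close>

locale lc_groupoid = groupoid G
  for G :: "'g::{t2_space, second_countable_topology} groupoid" +
  assumes locally_compact: "locally_compact_space (euclidean :: 'g topology)"
    and continuous_mult: "continuous_on (composable G) (\<lambda>(x, y). gmult G x y)"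
    and continuous_inv: "continuous_on UNIV (ginv G)"

definition Cc :: "('g::topological_space \<Rightarrow> complex) set" where
  "Cc = {f. continuous_on UNIV f \<and> compact (closure {x. f x \<noteq> 0})}"

text \<open>
  Each \<open>\<nu> u\<close> is a Borel measure on the closed subspace \<open>fibre G u\<close>. It is only required to be
  finite on compact sets: \<open>fibre G u\<close> is locally compact, Hausdorff and second countable, so
  such a measure is automatically regular. Compactness of the support of
  \<open>u \<mapsto> \<integral>f d\<nu> u\<close> is also automatic. Only the values \<open>\<nu> u\<close> for \<open>u \<in> units G\<close> matter.
\<close>

locale left_haar_system = lc_groupoid G
  for G :: "'g::{t2_space, second_countable_topology} groupoid" +
  fixes \<nu> :: "'g \<Rightarrow> 'g measure"
  assumes sets_haar: "u \<in> units G \<Longrightarrow> sets (\<nu> u) = sets (restrict_space borel (fibre G u))"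
    and finite_on_compact:
      "u \<in> units G \<Longrightarrow> compact K \<Longrightarrow> K \<subseteq> fibre G u \<Longrightarrow> emeasure (\<nu> u) K < \<infinity>"
    and full_support:
      "u \<in> units G \<Longrightarrow> open U \<Longrightarrow> U \<inter> fibre G u \<noteq> {} \<Longrightarrow> emeasure (\<nu> u) (U \<inter> fibre G u) > 0"
    and continuous_integral:
      "f \<in> Cc \<Longrightarrow> continuous_on (units G) (\<lambda>u. \<integral>t. f t \<partial>\<nu> u)"
    and left_invariant:
      "f \<in> Cc \<Longrightarrow> (\<integral>t. f (gmult G x t) \<partial>\<nu> (src G x)) = (\<integral>t. f t \<partial>\<nu> (rng G x))"


section \<open>The normed convolution algebra\<close>

definition conv ::
    "'g groupoid \<Rightarrow> ('g \<Rightarrow> 'g measure) \<Rightarrow> ('g \<Rightarrow> complex) \<Rightarrow> ('g \<Rightarrow> complex) \<Rightarrow> 'g \<Rightarrow> complex" where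
  "conv G \<nu> f g x = (\<integral>t. f t * g (gmult G (ginv G t) x) \<partial>\<nu> (rng G x))"

definition norm_Ir :: "'g groupoid \<Rightarrow> ('g \<Rightarrow> 'g measure) \<Rightarrow> ('g \<Rightarrow> complex) \<Rightarrow> real" where
  "norm_Ir G \<nu> f = (SUP u\<in>units G. \<integral>t. cmod (f t) \<partial>\<nu> u)"

definition bounded_left_approximate_identity ::
    "'g::topological_space groupoid \<Rightarrow> ('g \<Rightarrow> 'g measure) \<Rightarrow> (nat \<Rightarrow> 'g \<Rightarrow> complex) \<Rightarrow> bool" where
  "bounded_left_approximate_identity G \<nu> F \<longleftrightarrow>
     (\<forall>n. F n \<in> Cc) \<and>
     (\<exists>C. \<forall>n. norm_Ir G \<nu> (F n) \<le> C) \<and>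
     (\<forall>f\<in>Cc. (\<lambda>n. norm_Ir G \<nu> (\<lambda>x. conv G \<nu> (F n) f x - f x)) \<longlonglongrightarrow> 0)"


section \<open>The continuous field \<open>L\<^sup>2(G)\<close> and the Banach space \<open>E\<^sup>2\<close>\<close>

type_synonym 'g L2_section = "'g \<Rightarrow> ('g \<Rightarrow> complex) set"

definition sections :: "'g groupoid \<Rightarrow> ('g \<Rightarrow> 'g measure) \<Rightarrow> 'g L2_section set" where
  "sections G \<nu> = (\<Pi>\<^sub>E u\<in>units G. L2_space (\<nu> u))"

definition section_of ::
    "'g groupoid \<Rightarrow> ('g \<Rightarrow> 'g measure) \<Rightarrow> ('g \<Rightarrow> complex) \<Rightarrow> 'g L2_section" where
  "section_of G \<nu> f = (\<lambda>u\<in>units G. L2_class (\<nu> u) f)"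

definition section_add ::
    "'g groupoid \<Rightarrow> ('g \<Rightarrow> 'g measure) \<Rightarrow> 'g L2_section \<Rightarrow> 'g L2_section \<Rightarrow> 'g L2_section" where
  "section_add G \<nu> \<xi> \<eta> = (\<lambda>u\<in>units G. L2_add (\<nu> u) (\<xi> u) (\<eta> u))"

definition section_scale ::
    "'g groupoid \<Rightarrow> ('g \<Rightarrow> 'g measure) \<Rightarrow> complex \<Rightarrow> 'g L2_section \<Rightarrow> 'g L2_section" where
  "section_scale G \<nu> c \<xi> = (\<lambda>u\<in>units G. L2_scale (\<nu> u) c (\<xi> u))"

definition section_diff ::
    "'g groupoid \<Rightarrow> ('g \<Rightarrow> 'g measure) \<Rightarrow> 'g L2_section \<Rightarrow> 'g L2_section \<Rightarrow> 'g L2_section" where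
  "section_diff G \<nu> \<xi> \<eta> = section_add G \<nu> \<xi> (section_scale G \<nu> (-1) \<eta>)"

definition section_norm :: "'g groupoid \<Rightarrow> ('g \<Rightarrow> 'g measure) \<Rightarrow> 'g L2_section \<Rightarrow> real" where
  "section_norm G \<nu> \<xi> = (SUP u\<in>units G. L2_norm (\<nu> u) (\<xi> u))"

text \<open>
  The continuous sections of the field determined by \<open>Cc\<close> are those which are, locally on the
  unit space, uniform limits of sections coming from \<open>Cc\<close>.
\<close>

definition continuous_section ::
    "'g::topological_space groupoid \<Rightarrow> ('g \<Rightarrow> 'g measure) \<Rightarrow> 'g L2_section \<Rightarrow> bool" where
  "continuous_section G \<nu> \<xi> \<longleftrightarrow>
     \<xi> \<in> sections G \<nu> \<and>
     (\<forall>v\<in>units G. \<forall>\<epsilon>>0. \<exists>f\<in>Cc. \<exists>U. open U \<and> v \<in> U \<and>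
        (\<forall>u\<in>U \<inter> units G. L2_norm (\<nu> u) (section_diff G \<nu> \<xi> (section_of G \<nu> f) u) < \<epsilon>))"

definition vanishes_at_infinity ::
    "'g::topological_space groupoid \<Rightarrow> ('g \<Rightarrow> 'g measure) \<Rightarrow> 'g L2_section \<Rightarrow> bool" where
  "vanishes_at_infinity G \<nu> \<xi> \<longleftrightarrow>
     (\<forall>\<epsilon>>0. \<exists>K. compact K \<and> K \<subseteq> units G \<and> (\<forall>u\<in>units G - K. L2_norm (\<nu> u) (\<xi> u) < \<epsilon>))"

definition E2 :: "'g::topological_space groupoid \<Rightarrow> ('g \<Rightarrow> 'g measure) \<Rightarrow> 'g L2_section set" where
  "E2 G \<nu> = {\<xi>. continuous_section G \<nu> \<xi> \<and> vanishes_at_infinity G \<nu> \<xi>}"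


section \<open>Bounded operators on \<open>E\<^sup>2\<close>\<close>

definition bounded_operators ::
    "'g::topological_space groupoid \<Rightarrow> ('g \<Rightarrow> 'g measure) \<Rightarrow> ('g L2_section \<Rightarrow> 'g L2_section) set" where
  "bounded_operators G \<nu> =
     {T \<in> E2 G \<nu> \<rightarrow>\<^sub>E E2 G \<nu>.
        (\<forall>\<xi>\<in>E2 G \<nu>. \<forall>\<eta>\<in>E2 G \<nu>. T (section_add G \<nu> \<xi> \<eta>) = section_add G \<nu> (T \<xi>) (T \<eta>)) \<and>
        (\<forall>c. \<forall>\<xi>\<in>E2 G \<nu>. T (section_scale G \<nu> c \<xi>) = section_scale G \<nu> c (T \<xi>)) \<and>
        (\<exists>C. \<forall>\<xi>\<in>E2 G \<nu>. section_norm G \<nu> (T \<xi>) \<le> C * section_norm G \<nu> \<xi>)}"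

definition strong_operator_topology_E2 ::
    "'g::topological_space groupoid \<Rightarrow> ('g \<Rightarrow> 'g measure) \<Rightarrow> ('g L2_section \<Rightarrow> 'g L2_section) topology" where
  "strong_operator_topology_E2 G \<nu> = topology_generated_by
     {{T \<in> bounded_operators G \<nu>. section_norm G \<nu> (section_diff G \<nu> (T \<xi>) (S \<xi>)) < \<epsilon>} | S \<xi> \<epsilon>.
        S \<in> bounded_operators G \<nu> \<and> \<xi> \<in> E2 G \<nu> \<and> \<epsilon> > 0}"

text \<open>
  The operator below is well defined for \<open>F \<in> Cc\<close>: it exists because
  \<open>f \<mapsto> F * f\<close> is bounded by \<open>norm_Ir G \<nu> F\<close> for the norm of \<open>E\<^sup>2\<close>, and it is unique because
  \<open>Cc\<close> is dense in \<open>E\<^sup>2\<close>.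
\<close>

definition left_conv_op ::
    "'g::topological_space groupoid \<Rightarrow> ('g \<Rightarrow> 'g measure) \<Rightarrow> ('g \<Rightarrow> complex) \<Rightarrow>
      'g L2_section \<Rightarrow> 'g L2_section" where
  "left_conv_op G \<nu> F =
     (THE T. T \<in> bounded_operators G \<nu> \<and>
        (\<forall>f\<in>Cc. T (section_of G \<nu> f) = section_of G \<nu> (conv G \<nu> F f)))"

definition id_op ::
    "'g::topological_space groupoid \<Rightarrow> ('g \<Rightarrow> 'g measure) \<Rightarrow> 'g L2_section \<Rightarrow> 'g L2_section" where
  "id_op G \<nu> = (\<lambda>\<xi>\<in>E2 G \<nu>. \<xi>)"

end

theory Submission
  imports Defs
begin

text \<open>
  The functions \<open>F n\<close> are bump functions supported in neighbourhoods of the unit space that shrink over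
  compact sets, divided by \<open>max \<delta> (H \<circ> rng G)\<close>, where \<open>H u\<close> is the fibre integral of the bump and \<open>\<delta>\<close>
  its minimum over a large compact set of units. Every fibre integral of \<open>F n\<close> is then at most \<open>1\<close>, and
  it is \<open>1\<close> over that set. Near the units \<open>f (t\<^sup>-\<^sup>1 x)\<close> is uniformly close to \<open>f x\<close>, so \<open>F n * f\<close> tends to
  \<open>f\<close> uniformly with supports in a fixed compact set, hence in both norms on \<open>Cc\<close>. Convolution by
  \<open>F n\<close> contracts the norm of \<open>E\<^sup>2\<close>, by the Cauchy--Schwarz inequality, Fubini and left invariance, so the
  convergence passes from \<open>Cc\<close> to its closure \<open>E\<^sup>2\<close>.
\<close>

section \<open>Locally compact Hausdorff spaces\<close>

text \<open>When the unit space is not compact, no function in \<open>Cc\<close> has fibre mass 1 at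
  every unit. Mass 1 is therefore demanded only over compact sets that eventually contain any given
  one, and second countability lets one sequence serve all \<open>f\<close> at once. The supports of
  the \<open>F n\<close> may then outgrow every compact set, but the arrows that contribute to
  \<open>F n * f\<close> end up in a compact set depending on \<open>f\<close> alone; fixing that
  set before epsilon is what turns uniform convergence into convergence of fibre integrals. Two
  further obstacles shape the proof. The continuity axiom of a Haar system concerns one fixed
  integrand, while the integrand of a convolution varies with \<open>x\<close>; Tietze extension
  freezes it. And \<open>left_conv_op\<close> is a definite description, so nothing can be said
  about it until an operator has been built by completion on every fibre and shown to be determined
  by its values on \<open>Cc\<close>.\<close>

lemma Hausdorff_space_t2: "Hausdorff_space (euclidean :: 'a::t2_space topology)"
  unfolding Hausdorff_space_def disjnt_def by simp (meson hausdorff)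

lemma closure_finite_Union:
  assumes "finite F"
  shows "closure (\<Union>F) = \<Union> (closure ` F)"
  using assms by induction (auto simp: closure_Un)

text \<open>Finitely many relatively compact open sets with closure inside \<open>W\<close> cover
  \<open>K\<close>, and closure commutes with finite unions.\<close>

lemma compact_nbhd_between:
  fixes K W :: "'a::t2_space set"
  assumes lc: "locally_compact_space (euclidean :: 'a topology)"
    and "compact K" "open W" "K \<subseteq> W"
  obtains V where "open V" "K \<subseteq> V" "compact (closure V)" "closure V \<subseteq> W"
proof -
  have nb: "neighbourhood_base_of (\<lambda>C. compactin euclidean C \<and> closedin euclidean C) (euclidean :: 'a topology)"
    using locally_compact_space_neighbourhood_base_closedin[of "euclidean :: 'a topology"] lc
    by (simp add: Hausdorff_space_t2)
  have "\<exists>U. open U \<and> x \<in> U \<and> compact (closure U) \<and> closure U \<subseteq> W" if "x \<in> K" for x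
  proof -
    have "x \<in> W" using that assms by blast
    then obtain U C where UC: "open U" "compact C" "closed C" "x \<in> U" "U \<subseteq> C" "C \<subseteq> W"
      using nb \<open>open W\<close> unfolding neighbourhood_base_of by simp meson
    then have "closure U \<subseteq> C" by (simp add: closure_minimal)
    moreover have "compact (closure U)"
      using UC(2) \<open>closure U \<subseteq> C\<close> compact_Int_closed[of C "closure U"] by (simp add: Int_absorb1)
    ultimately show ?thesis using UC by blast
  qed
  then obtain U where U: "\<And>x. x \<in> K \<Longrightarrow> open (U x) \<and> x \<in> U x \<and> compact (closure (U x)) \<and> closure (U x) \<subseteq> W"
    by metis
  have "K \<subseteq> (\<Union>x\<in>K. U x)" using U by blast
  then obtain F where F: "F \<subseteq> K" "finite F" "K \<subseteq> (\<Union>x\<in>F. U x)"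
    by (rule compactE_image[OF \<open>compact K\<close>, rotated]) (use U in blast)+
  have cl: "closure (\<Union>x\<in>F. U x) = (\<Union>x\<in>F. closure (U x))"
    using F(2) by (simp add: closure_finite_Union)
  show thesis
  proof
    show "open (\<Union>x\<in>F. U x)" using F U by blast
    show "K \<subseteq> (\<Union>x\<in>F. U x)" by fact
    show "compact (closure (\<Union>x\<in>F. U x))"
      unfolding cl using F U by (intro compact_UN) auto
    show "closure (\<Union>x\<in>F. U x) \<subseteq> W" unfolding cl using F U by blast
  qed
qed

lemma locally_compact_t2_completely_regular:
  assumes "locally_compact_space (euclidean :: 'a::t2_space topology)"
  shows "completely_regular_space (euclidean :: 'a topology)"
  using assms locally_compact_Hausdorff_imp_regular_space locally_compact_regular_imp_completely_regular_space
    Hausdorff_space_t2 by blast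

text \<open>Urysohn separates \<open>K\<close> from the complement of a relatively compact
  \<open>V\<close> instead of that of \<open>W\<close>; the support then sits in the compact closure
  of \<open>V\<close>.\<close>

lemma bump_function:
  fixes K W :: "'a::t2_space set"
  assumes lc: "locally_compact_space (euclidean :: 'a topology)"
    and "compact K" "open W" "K \<subseteq> W"
  obtains h :: "'a \<Rightarrow> real" where "continuous_on UNIV h" "\<And>x. 0 \<le> h x" "\<And>x. h x \<le> 1"
    "\<And>x. x \<in> K \<Longrightarrow> h x = 1" "{x. h x \<noteq> 0} \<subseteq> W" "compact (closure {x. h x \<noteq> 0})"
proof -
  obtain V where V: "open V" "K \<subseteq> V" "compact (closure V)" "closure V \<subseteq> W"
    using compact_nbhd_between[OF assms] .
  have "disjnt K (- V)" using V by (auto simp: disjnt_def)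
  obtain h where h: "continuous_map euclidean (subtopology euclidean {0..1::real}) h"
      "h ` (- V) \<subseteq> {0}" "h ` K \<subseteq> {1}"
    by (rule Urysohn_completely_regular_compact_closed[of 0 1 euclidean K "- V"])
      (use \<open>disjnt K (- V)\<close> locally_compact_t2_completely_regular[OF lc] \<open>compact K\<close>
        closed_Compl[OF \<open>open V\<close>] in simp_all)
  have sub: "{x. h x \<noteq> 0} \<subseteq> V" using h(2) by auto
  then have cl: "closure {x. h x \<noteq> 0} \<subseteq> closure V" by (rule closure_mono)
  show thesis
  proof
    show "continuous_on UNIV h"
      using h(1) by (simp add: continuous_map_in_subtopology)
    show "0 \<le> h x" "h x \<le> 1" for x
      using h(1) by (auto simp: continuous_map_in_subtopology)
    show "h x = 1" if "x \<in> K" for x using h(3) that by auto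
    show "{x. h x \<noteq> 0} \<subseteq> W" using sub V(4) closure_subset by blast
    show "compact (closure {x. h x \<noteq> 0})"
      using V(3) cl compact_Int_closed[of "closure V" "closure {x. h x \<noteq> 0}"] by (simp add: Int_absorb1)
  qed
qed

text \<open>Serves \<open>continuous_conv\<close>, where an integrand known on a compact part of one
  fibre has to become a function on the whole groupoid. Real and imaginary parts are extended
  separately.\<close>

lemma Tietze_compact_complex:
  fixes K :: "'a::t2_space set" and f :: "'a \<Rightarrow> complex"
  assumes lc: "locally_compact_space (euclidean :: 'a topology)"
    and "compact K" "continuous_on K f"
  obtains g where "continuous_on UNIV g" "\<And>x. x \<in> K \<Longrightarrow> g x = f x"
proof -
  have *: "\<exists>g. continuous_on UNIV g \<and> (\<forall>x\<in>K. g x = h x)" if "continuous_on K h" for h :: "'a \<Rightarrow> real"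
  proof -
    obtain g where "continuous_map euclidean euclideanreal g" "g ` topspace euclidean \<subseteq> UNIV"
        "\<And>x. x \<in> K \<Longrightarrow> g x = h x"
      by (rule Tietze_extension_completely_regular[of euclidean K UNIV h])
        (use locally_compact_t2_completely_regular[OF lc] assms(2) \<open>continuous_on K h\<close> in simp_all)
    then show ?thesis by auto
  qed
  obtain a where a: "continuous_on UNIV a" "\<forall>x\<in>K. a x = Re (f x)"
    using *[of "\<lambda>x. Re (f x)"] assms(3) continuous_on_Re by blast
  obtain b where b: "continuous_on UNIV b" "\<forall>x\<in>K. b x = Im (f x)"
    using *[of "\<lambda>x. Im (f x)"] assms(3) continuous_on_Im by blast
  show thesis
  proof
    show "continuous_on UNIV (\<lambda>x. Complex (a x) (b x))"
      using a(1) b(1) by (rule continuous_on_Complex)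
    show "Complex (a x) (b x) = f x" if "x \<in> K" for x
      using a(2) b(2) that by simp
  qed
qed

text \<open>Finite unions of relatively compact members of a countable basis fit between any compact
  set and any open set around it. This countable family is what permits sequences in place of
  nets.\<close>

lemma relatively_compact_base:
  assumes lc: "locally_compact_space (euclidean :: 'a::{t2_space, second_countable_topology} topology)"
  obtains B :: "nat \<Rightarrow> 'a::{t2_space, second_countable_topology} set" where "\<And>j. open (B j)" "\<And>j. compact (closure (B j))"
    "\<And>K W. compact K \<Longrightarrow> open W \<Longrightarrow> K \<subseteq> W \<Longrightarrow> \<exists>j. K \<subseteq> B j \<and> B j \<subseteq> W"
proof -
  obtain \<B> :: "'a set set" where \<B>: "countable \<B>" "topological_basis \<B>"
    using ex_countable_basis by blast
  define \<D> where "\<D> = Union ` {F. finite F \<and> F \<subseteq> {b \<in> \<B>. compact (closure b)}}"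
  have "countable {F. finite F \<and> F \<subseteq> {b \<in> \<B>. compact (closure b)}}"
    using \<B>(1) by (intro countable_Collect_finite_subset) auto
  then have cD: "countable \<D>" unfolding \<D>_def by (rule countable_image)
  \<comment> \<open>The union of the empty family belongs to \<open>\<D>\<close>, so
    \<open>from_nat_into\<close> really enumerates it.\<close>
  have ne: "\<D> \<noteq> {}" unfolding \<D>_def by blast
  have D: "open D \<and> compact (closure D)" if "D \<in> \<D>" for D
  proof -
    obtain F where F: "finite F" "F \<subseteq> {b \<in> \<B>. compact (closure b)}" "D = \<Union>F"
      using \<open>D \<in> \<D>\<close> unfolding \<D>_def by blast
    have "closure D = \<Union> (closure ` F)" using F(1,3) by (simp add: closure_finite_Union)
    moreover have "compact (\<Union> (closure ` F))" using F by (intro compact_Union) auto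
    moreover have "open D" using F \<B>(2) topological_basis_open by (auto intro!: open_Union)
    ultimately show ?thesis by simp
  qed
  have approx: "\<exists>D\<in>\<D>. K \<subseteq> D \<and> D \<subseteq> W" if "compact K" "open W" "K \<subseteq> W" for K W
  proof -
    obtain V where V: "open V" "K \<subseteq> V" "compact (closure V)" "closure V \<subseteq> W"
      using compact_nbhd_between[OF lc \<open>compact K\<close> \<open>open W\<close> \<open>K \<subseteq> W\<close>] .
    \<comment> \<open>Basis sets inside \<open>V\<close> have compact closure, hence are admissible
      in \<open>\<D>\<close>.\<close>
    have "\<exists>b\<in>\<B>. x \<in> b \<and> b \<subseteq> V" if "x \<in> K" for x
      by (rule topological_basisE[OF \<B>(2) V(1) subsetD[OF V(2) that]]) blast
    then obtain b where b: "\<And>x. x \<in> K \<Longrightarrow> b x \<in> \<B> \<and> x \<in> b x \<and> b x \<subseteq> V" by metis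
    have "K \<subseteq> (\<Union>x\<in>K. b x)" using b by blast
    then obtain F where F: "F \<subseteq> K" "finite F" "K \<subseteq> (\<Union>x\<in>F. b x)"
      by (rule compactE_image[OF \<open>compact K\<close>, rotated])
        (use b topological_basis_open[OF \<B>(2)] in blast)+
    have "compact (closure (b x))" if "x \<in> F" for x
    proof -
      have "closure (b x) \<subseteq> closure V" using b F(1) that by (intro closure_mono) auto
      then show ?thesis
        using V(3) compact_Int_closed[of "closure V" "closure (b x)"] by (simp add: Int_absorb1)
    qed
    then have "\<Union> (b ` F) \<in> \<D>" unfolding \<D>_def using F(1,2) b by blast
    moreover have "\<Union> (b ` F) \<subseteq> W" using b F(1) V(4) closure_subset[of V] by blast
    ultimately show ?thesis using F(3) by blast
  qed
  show thesis
  proof (rule that[of "from_nat_into \<D>"])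
    show "open (from_nat_into \<D> j)" "compact (closure (from_nat_into \<D> j))" for j
      using D[OF from_nat_into[OF ne]] by auto
    fix K W :: "'a set" assume "compact K" "open W" "K \<subseteq> W"
    then obtain D where "D \<in> \<D>" "K \<subseteq> D" "D \<subseteq> W" using approx by blast
    then show "\<exists>j. K \<subseteq> from_nat_into \<D> j \<and> from_nat_into \<D> j \<subseteq> W"
      using from_nat_into_surj[OF cD] by metis
  qed
qed

text \<open>The sets that contain \<open>f x\<close> eventually are stable under finite
  intersections and under enlargement, so a subbase suffices. The point \<open>l\<close> must lie in
  the union of the subbase because that union is the whole topspace.\<close>

lemma limitin_topology_generated_by:
  assumes "l \<in> \<Union>\<S>" "\<And>U. U \<in> \<S> \<Longrightarrow> l \<in> U \<Longrightarrow> eventually (\<lambda>x. f x \<in> U) F"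
  shows "limitin (topology_generated_by \<S>) f l F"
proof -
  have "l \<in> U \<Longrightarrow> eventually (\<lambda>x. f x \<in> U) F" if "generate_topology_on \<S> U" for U
    using that
  proof (induction rule: generate_topology_on.induct)
    case (Int a b)
    then show ?case by (auto intro: eventually_conj)
  next
    case (UN K)
    then obtain k where k: "k \<in> K" "l \<in> k" by blast
    then have "eventually (\<lambda>x. f x \<in> k) F" using UN.IH by blast
    then show ?case by (rule eventually_mono) (use k in blast)
  qed (use assms in auto)
  then show ?thesis
    using assms(1) unfolding limitin_def by (auto simp: openin_topology_generated_by_iff)
qed

section \<open>The seminorm of \<open>L\<^sup>2\<close>\<close>

text \<open>Lives on functions, so that estimates are made on representatives and reach the classes
  through \<open>L2_norm_L2_class\<close> and \<open>L2_dist_class\<close>.\<close>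

definition L2n :: "'a measure \<Rightarrow> ('a \<Rightarrow> complex) \<Rightarrow> real" where
  "L2n M f = sqrt (\<integral>x. (cmod (f x))\<^sup>2 \<partial>M)"

lemma L2_fun_measurable [measurable_dest]: "f \<in> L2_fun M \<Longrightarrow> f \<in> borel_measurable M"
  by (simp add: L2_fun_def)

lemma L2_fun_integrable: "f \<in> L2_fun M \<Longrightarrow> integrable M (\<lambda>x. (cmod (f x))\<^sup>2)"
  by (simp add: L2_fun_def)

lemma L2n_nonneg [simp]: "0 \<le> L2n M f"
  by (simp add: L2n_def)

lemma L2n_square: "(L2n M f)\<^sup>2 = (\<integral>x. (cmod (f x))\<^sup>2 \<partial>M)"
  by (simp add: L2n_def)

lemma L2_fun_zero [simp]: "(\<lambda>x. 0) \<in> L2_fun M"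
  by (simp add: L2_fun_def)

lemma cmod_add_square_le: "(cmod (a + b))\<^sup>2 \<le> 2 * (cmod a)\<^sup>2 + 2 * (cmod b)\<^sup>2"
proof -
  have "(cmod (a + b))\<^sup>2 \<le> (cmod a + cmod b)\<^sup>2"
    by (intro power_mono norm_triangle_ineq) simp
  also have "\<dots> \<le> 2 * (cmod a)\<^sup>2 + 2 * (cmod b)\<^sup>2"
    using sum_squares_bound[of "cmod a" "cmod b"] by (simp add: power2_sum)
  finally show ?thesis .
qed

lemma L2_fun_add:
  assumes f: "f \<in> L2_fun M" and g: "g \<in> L2_fun M"
  shows "(\<lambda>x. f x + g x) \<in> L2_fun M"
proof -
  note [measurable] = L2_fun_measurable[OF f] L2_fun_measurable[OF g]
  have "integrable M (\<lambda>x. 2 * (cmod (f x))\<^sup>2 + 2 * (cmod (g x))\<^sup>2)"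
    by (intro Bochner_Integration.integrable_add integrable_mult_right L2_fun_integrable assms)
  then have "integrable M (\<lambda>x. (cmod (f x + g x))\<^sup>2)"
    by (rule Bochner_Integration.integrable_bound) (auto simp: cmod_add_square_le abs_of_nonneg)
  then show ?thesis by (simp add: L2_fun_def)
qed

lemma L2_fun_scale: "f \<in> L2_fun M \<Longrightarrow> (\<lambda>x. c * f x) \<in> L2_fun M"
  by (auto simp: L2_fun_def norm_mult power_mult_distrib)

lemma L2_fun_diff: "f \<in> L2_fun M \<Longrightarrow> g \<in> L2_fun M \<Longrightarrow> (\<lambda>x. f x - g x) \<in> L2_fun M"
  using L2_fun_add[of f M "\<lambda>x. (-1) * g x"] L2_fun_scale[of g M "-1"] by simp

lemma L2n_scale: "L2n M (\<lambda>x. c * f x) = cmod c * L2n M f"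
  by (simp add: L2n_def norm_mult power_mult_distrib real_sqrt_mult)

lemma integrable_L2_mult:
  assumes f: "f \<in> L2_fun M" and g: "g \<in> L2_fun M"
  shows "integrable M (\<lambda>x. cmod (f x) * cmod (g x))"
proof -
  note [measurable] = L2_fun_measurable[OF f] L2_fun_measurable[OF g]
  have "integrable M (\<lambda>x. (cmod (f x))\<^sup>2 + (cmod (g x))\<^sup>2)"
    by (intro Bochner_Integration.integrable_add integrable_mult_right L2_fun_integrable assms)
  then show ?thesis
  proof (rule Bochner_Integration.integrable_bound)
    have "cmod a * cmod b \<le> (cmod a)\<^sup>2 + (cmod b)\<^sup>2" for a b
      using sum_squares_bound[of "cmod a" "cmod b"] mult_nonneg_nonneg[OF norm_ge_zero[of a] norm_ge_zero[of b]] by linarith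
    then show "AE x in M. norm (cmod (f x) * cmod (g x)) \<le> norm ((cmod (f x))\<^sup>2 + (cmod (g x))\<^sup>2)"
      by (simp add: abs_of_nonneg)
  qed simp
qed

text \<open>The inequality is taken in its extended nonnegative form; square integrability makes
  each of the three integrals a finite real one.\<close>

lemma L2_Cauchy_Schwarz:
  assumes f: "f \<in> L2_fun M" and g: "g \<in> L2_fun M"
  shows "(\<integral>x. cmod (f x) * cmod (g x) \<partial>M) \<le> L2n M f * L2n M g"
proof -
  note [measurable] = L2_fun_measurable[OF f] L2_fun_measurable[OF g]
  let ?I = "\<integral>x. cmod (f x) * cmod (g x) \<partial>M"
  have I: "0 \<le> ?I" by (simp add: integral_nonneg_AE)
  have "(\<integral>\<^sup>+x. ennreal (cmod (f x)) * ennreal (cmod (g x)) \<partial>M)\<^sup>2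
      \<le> (\<integral>\<^sup>+x. ennreal (cmod (f x)) ^ 2 \<partial>M) * (\<integral>\<^sup>+x. ennreal (cmod (g x)) ^ 2 \<partial>M)"
    by (intro Cauchy_Schwarz_nn_integral) auto
  moreover have "(\<integral>\<^sup>+x. ennreal (cmod (f x)) * ennreal (cmod (g x)) \<partial>M) = ennreal ?I"
    using nn_integral_eq_integral[OF integrable_L2_mult[OF assms]] by (simp add: ennreal_mult)
  moreover have "(\<integral>\<^sup>+x. ennreal (cmod (h x)) ^ 2 \<partial>M) = ennreal ((L2n M h)\<^sup>2)" if "h \<in> L2_fun M" for h
    using nn_integral_eq_integral[OF L2_fun_integrable[OF that]] by (simp add: ennreal_power L2n_square)
  ultimately have "ennreal (?I\<^sup>2) \<le> ennreal ((L2n M f)\<^sup>2 * (L2n M g)\<^sup>2)"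
    using assms I by (simp add: ennreal_power ennreal_mult)
  then have "?I\<^sup>2 \<le> (L2n M f * L2n M g)\<^sup>2"
    by (simp add: power_mult_distrib)
  then show ?thesis by (rule power2_le_imp_le) simp
qed

lemma L2n_triangle:
  assumes f: "f \<in> L2_fun M" and g: "g \<in> L2_fun M"
  shows "L2n M (\<lambda>x. f x + g x) \<le> L2n M f + L2n M g"
proof (rule power2_le_imp_le)
  note int = L2_fun_integrable[OF f] L2_fun_integrable[OF g] integrable_L2_mult[OF f g]
  have "(L2n M (\<lambda>x. f x + g x))\<^sup>2 \<le> (\<integral>x. (cmod (f x))\<^sup>2 + (cmod (g x))\<^sup>2 + 2 * (cmod (f x) * cmod (g x)) \<partial>M)"
    unfolding L2n_square
  proof (rule integral_mono)
    fix x
    have "(cmod (f x + g x))\<^sup>2 \<le> (cmod (f x) + cmod (g x))\<^sup>2"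
      by (intro power_mono norm_triangle_ineq) simp
    then show "(cmod (f x + g x))\<^sup>2 \<le> (cmod (f x))\<^sup>2 + (cmod (g x))\<^sup>2 + 2 * (cmod (f x) * cmod (g x))"
      by (simp add: power2_sum)
  qed (use int L2_fun_integrable[OF L2_fun_add[OF f g]] in auto)
  also have "\<dots> = (L2n M f)\<^sup>2 + (L2n M g)\<^sup>2 + 2 * (\<integral>x. cmod (f x) * cmod (g x) \<partial>M)"
    using int by (simp add: L2n_square)
  also have "\<dots> \<le> (L2n M f + L2n M g)\<^sup>2"
    using L2_Cauchy_Schwarz[OF f g] by (simp add: power2_sum)
  finally show "(L2n M (\<lambda>x. f x + g x))\<^sup>2 \<le> (L2n M f + L2n M g)\<^sup>2" .
qed simp

lemma L2n_eq_0:
  assumes "f \<in> L2_fun M" "L2n M f = 0"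
  shows "AE x in M. f x = 0"
proof -
  have "(\<integral>x. (cmod (f x))\<^sup>2 \<partial>M) = 0" using assms(2) by (simp add: L2n_def)
  then have "AE x in M. (cmod (f x))\<^sup>2 = 0"
    using integral_nonneg_eq_0_iff_AE[OF L2_fun_integrable[OF assms(1)]] by simp
  then show ?thesis by simp
qed

text \<open>
  Riesz--Fischer. The weights \<open>4 ^ k\<close> make \<open>\<Sum>k. 4 ^ k * (cmod (f (Suc k) x - f k x))\<^sup>2\<close> integrable,
  which forces geometric decay of the increments at almost every point.
\<close>

lemma L2_complete:
  assumes f: "\<And>k. f k \<in> L2_fun M"
    and step: "\<And>k. L2n M (\<lambda>x. f (Suc k) x - f k x) \<le> (1/4) ^ k"
  shows "\<exists>g\<in>L2_fun M. \<forall>k. L2n M (\<lambda>x. f k x - g x) \<le> 2 * (1/4) ^ k"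
proof -
  note [measurable] = L2_fun_measurable[OF f]
  define d where "d k x = f (Suc k) x - f k x" for k x
  have d_L2: "d k \<in> L2_fun M" for k
    unfolding d_def by (rule L2_fun_diff[OF f f])
  note [measurable] = L2_fun_measurable[OF d_L2]
  have step2: "(\<integral>\<^sup>+x. ennreal ((cmod (d k x))\<^sup>2) \<partial>M) \<le> ennreal ((1/16) ^ k)" for k
  proof -
    have "(\<integral>\<^sup>+x. ennreal ((cmod (d k x))\<^sup>2) \<partial>M) = ennreal ((L2n M (d k))\<^sup>2)"
      using nn_integral_eq_integral[OF L2_fun_integrable[OF d_L2]] by (simp add: L2n_square)
    also have "(L2n M (d k))\<^sup>2 \<le> ((1/4) ^ k)\<^sup>2"
      using step[of k] unfolding d_def by (intro power_mono) auto
    also have "((1/4::real) ^ k)\<^sup>2 = (1/16) ^ k"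
      by (simp add: power2_eq_square flip: power_mult_distrib)
    finally show ?thesis by (simp add: ennreal_leI)
  qed
  have "(\<integral>\<^sup>+x. (\<Sum>k. ennreal (4 ^ k * (cmod (d k x))\<^sup>2)) \<partial>M)
      = (\<Sum>k. \<integral>\<^sup>+x. ennreal (4 ^ k * (cmod (d k x))\<^sup>2) \<partial>M)"
    by (rule nn_integral_suminf) simp
  also have "\<dots> = (\<Sum>k. ennreal (4 ^ k) * \<integral>\<^sup>+x. ennreal ((cmod (d k x))\<^sup>2) \<partial>M)"
    by (simp add: ennreal_mult nn_integral_cmult)
  \<comment> \<open>The weight \<open>4 ^ k\<close> against a squared step of at most
    \<open>(1/16) ^ k\<close> leaves a geometric series.\<close>
  also have "\<dots> \<le> (\<Sum>k. ennreal ((1/4) ^ k))"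
  proof (intro suminf_le)
    fix k
    have "ennreal (4 ^ k) * (\<integral>\<^sup>+x. ennreal ((cmod (d k x))\<^sup>2) \<partial>M) \<le> ennreal (4 ^ k) * ennreal ((1/16) ^ k)"
      by (intro mult_left_mono step2) simp
    also have "\<dots> = ennreal ((1/4) ^ k)"
      by (simp flip: ennreal_mult power_mult_distrib)
    finally show "ennreal (4 ^ k) * (\<integral>\<^sup>+x. ennreal ((cmod (d k x))\<^sup>2) \<partial>M) \<le> ennreal ((1/4) ^ k)" .
  qed auto
  also have "\<dots> < \<infinity>"
    by (subst suminf_ennreal2) (auto simp: summable_geometric)
  finally have "AE x in M. (\<Sum>k. ennreal (4 ^ k * (cmod (d k x))\<^sup>2)) \<noteq> \<infinity>"
    by (rule nn_integral_PInf_AE[OF _ less_imp_neq, rotated]) measurable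
  then have conv: "AE x in M. convergent (\<lambda>k. f k x)"
  proof eventually_elim
    case (elim x)
    then have "summable (\<lambda>k. 4 ^ k * (cmod (d k x))\<^sup>2)"
      unfolding infinity_ennreal_def by (rule summable_suminf_not_top[rotated]) simp
    then have "(\<lambda>k. 4 ^ k * (cmod (d k x))\<^sup>2) \<longlonglongrightarrow> 0"
      by (rule summable_LIMSEQ_zero)
    then have "eventually (\<lambda>k. 4 ^ k * (cmod (d k x))\<^sup>2 < 1) sequentially"
      by (rule order_tendstoD) simp
    then have "eventually (\<lambda>k. cmod (d k x) \<le> (1/2) ^ k) sequentially"
    proof eventually_elim
      case (elim k)
      have four: "(2 ^ k)\<^sup>2 = (4::real) ^ k"
        by (simp add: power2_eq_square flip: power_mult_distrib)
      from elim have "(2 ^ k * cmod (d k x))\<^sup>2 \<le> 1\<^sup>2"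
        using four by (simp add: power_mult_distrib)
      then have "2 ^ k * cmod (d k x) \<le> 1" by (rule power2_le_imp_le) simp
      then show ?case by (simp add: field_simps)
    qed
    then have "summable (\<lambda>k. d k x)"
      by (rule summable_comparison_test_ev) (simp add: summable_geometric)
    then have "convergent (\<lambda>n. \<Sum>k<n. d k x)" by (simp add: summable_iff_convergent)
    moreover have "(\<Sum>k<n. d k x) = f n x - f 0 x" for n
      unfolding d_def by (rule sum_lessThan_telescope)
    ultimately have "convergent (\<lambda>n. f n x - f 0 x)" by simp
    then show ?case using convergent_diff_const_right_iff by blast
  qed
  \<comment> \<open>\<open>lim\<close> yields a measurable function on the whole space, whatever its
    value where the sequence diverges.\<close>
  define g where "g x = lim (\<lambda>k. f k x)" for x
  have g_meas [measurable]: "g \<in> borel_measurable M"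
    unfolding g_def by measurable
  have lim: "AE x in M. (\<lambda>k. f k x) \<longlonglongrightarrow> g x"
    using conv by eventually_elim (simp add: g_def convergent_LIMSEQ_iff)
  \<comment> \<open>The steps from \<open>k\<close> on add up to at most 4/3 of
    \<open>(1/4) ^ k\<close>; the factor is rounded up to 2.\<close>
  have tail: "L2n M (\<lambda>x. f k x - f (k + m) x) \<le> 2 * (1/4) ^ k" for k m
  proof -
    have "L2n M (\<lambda>x. f (k + m) x - f k x) \<le> (\<Sum>j<m. (1/4) ^ (k + j))"
    proof (induction m)
      case 0
      then show ?case by (simp add: L2n_def)
    next
      case (Suc m)
      have "L2n M (\<lambda>x. (f (k + m) x - f k x) + d (k + m) x) \<le> L2n M (\<lambda>x. f (k + m) x - f k x) + L2n M (d (k + m))"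
        by (intro L2n_triangle L2_fun_diff f d_L2)
      moreover have "L2n M (d (k + m)) \<le> (1/4) ^ (k + m)"
        using step[of "k + m"] by (simp add: d_def[abs_def])
      ultimately show ?case using Suc by (simp add: d_def)
    qed
    also have "\<dots> = (1/4) ^ k * (\<Sum>j<m. (1/4) ^ j)"
      by (simp add: power_add sum_distrib_left)
    also have "\<dots> \<le> (1/4) ^ k * 2"
    proof (intro mult_left_mono)
      show "(\<Sum>j<m. (1/4::real) ^ j) \<le> 2"
      proof -
        have "(\<Sum>j<m. (1/4::real) ^ j) = (1 - (1/4) ^ m) / (1 - 1/4)"
          by (simp add: sum_gp_strict)
        also have "\<dots> \<le> 1 / (1 - 1/4)"
          by (intro divide_right_mono) auto
        also have "\<dots> \<le> (2::real)" by simp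
        finally show ?thesis .
      qed
    qed simp
    finally show ?thesis
      by (simp add: L2n_def norm_minus_commute)
  qed
  \<comment> \<open>Fatou lets \<open>m\<close> tend to infinity in \<open>tail\<close>. The result
    gives both the square integrability of the difference and the rate.\<close>
  have bound: "(\<integral>\<^sup>+x. ennreal ((cmod (f k x - g x))\<^sup>2) \<partial>M) \<le> ennreal ((2 * (1/4) ^ k)\<^sup>2)" for k
  proof -
    have "(\<integral>\<^sup>+x. ennreal ((cmod (f k x - g x))\<^sup>2) \<partial>M)
        = (\<integral>\<^sup>+x. liminf (\<lambda>m. ennreal ((cmod (f k x - f (k + m) x))\<^sup>2)) \<partial>M)"
    proof (rule nn_integral_cong_AE)
      show "AE x in M. ennreal ((cmod (f k x - g x))\<^sup>2) = liminf (\<lambda>m. ennreal ((cmod (f k x - f (k + m) x))\<^sup>2))"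
        using lim
      proof eventually_elim
        case (elim x)
        then have "(\<lambda>m. f (k + m) x) \<longlonglongrightarrow> g x"
          using LIMSEQ_ignore_initial_segment[of "\<lambda>k. f k x" "g x" k] by (simp add: add.commute)
        then have "(\<lambda>m. ennreal ((cmod (f k x - f (k + m) x))\<^sup>2)) \<longlonglongrightarrow> ennreal ((cmod (f k x - g x))\<^sup>2)"
          by (intro tendsto_intros)
        then show ?case by (rule lim_imp_Liminf[OF trivial_limit_sequentially, symmetric])
      qed
    qed
    also have "\<dots> \<le> liminf (\<lambda>m. \<integral>\<^sup>+x. ennreal ((cmod (f k x - f (k + m) x))\<^sup>2) \<partial>M)"
      by (rule nn_integral_liminf) simp
    also have "\<dots> \<le> ennreal ((2 * (1/4) ^ k)\<^sup>2)"
    proof (rule Liminf_le[OF sequentially_bot], rule always_eventually, rule allI)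
      fix m
      have "(\<integral>\<^sup>+x. ennreal ((cmod (f k x - f (k + m) x))\<^sup>2) \<partial>M) = ennreal ((L2n M (\<lambda>x. f k x - f (k + m) x))\<^sup>2)"
        using nn_integral_eq_integral[OF L2_fun_integrable[OF L2_fun_diff[OF f f]]] by (simp add: L2n_square)
      also have "\<dots> \<le> ennreal ((2 * (1/4) ^ k)\<^sup>2)"
        using tail[of k m] by (intro ennreal_leI power_mono) auto
      finally show "(\<integral>\<^sup>+x. ennreal ((cmod (f k x - f (k + m) x))\<^sup>2) \<partial>M) \<le> ennreal ((2 * (1/4) ^ k)\<^sup>2)" .
    qed
    finally show ?thesis .
  qed
  have diff: "(\<lambda>x. f k x - g x) \<in> L2_fun M" for k
    unfolding L2_fun_def using bound[of k]
    by (auto simp: integrable_iff_bounded intro: le_less_trans)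
  show ?thesis
  proof (intro bexI allI)
    show "g \<in> L2_fun M"
      using L2_fun_diff[OF f[of 0] diff[of 0]] by simp
    fix k
    have "ennreal ((L2n M (\<lambda>x. f k x - g x))\<^sup>2) \<le> ennreal ((2 * (1/4) ^ k)\<^sup>2)"
      using bound[of k] nn_integral_eq_integral[OF L2_fun_integrable[OF diff[of k]]] by (simp add: L2n_square)
    then have "(L2n M (\<lambda>x. f k x - g x))\<^sup>2 \<le> (2 * (1/4) ^ k)\<^sup>2" by (simp add: ennreal_le_iff)
    then show "L2n M (\<lambda>x. f k x - g x) \<le> 2 * (1/4) ^ k" by (rule power2_le_imp_le) simp
  qed
qed

section \<open>The quotient space \<open>L\<^sup>2\<close>\<close>

text \<open>Has the shape to which \<open>section_diff\<close> unfolds at a unit;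
  \<open>L2_norm_section_diff\<close> passes between the two.\<close>

definition L2_dist :: "'a measure \<Rightarrow> ('a \<Rightarrow> complex) set \<Rightarrow> ('a \<Rightarrow> complex) set \<Rightarrow> real" where
  "L2_dist M A B = L2_norm M (L2_add M A (L2_scale M (-1) B))"

lemma L2_class_eqI:
  assumes "f \<in> L2_fun M" "g \<in> L2_fun M" "AE x in M. f x = g x"
  shows "L2_class M f = L2_class M g"
  unfolding L2_class_def by (rule equiv_class_eq[OF equiv_L2_eq]) (use assms in \<open>simp add: L2_eq_def\<close>)

lemma L2_class_self: "f \<in> L2_fun M \<Longrightarrow> f \<in> L2_class M f"
  by (simp add: L2_class_def L2_eq_def)

lemma L2_class_in_space: "f \<in> L2_fun M \<Longrightarrow> L2_class M f \<in> L2_space M"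
  unfolding L2_class_def L2_space_def by (rule quotientI)

lemma L2_spaceE:
  assumes "A \<in> L2_space M"
  obtains f where "f \<in> L2_fun M" "A = L2_class M f"
  using assms unfolding L2_class_def L2_space_def by (rule quotientE)

text \<open>The operation is a union over all representatives. Besides independence of the choice,
  this requires that classes be nonempty, or the union would collapse.\<close>

lemma L2_add_class:
  assumes "f \<in> L2_fun M" "g \<in> L2_fun M"
  shows "L2_add M (L2_class M f) (L2_class M g) = L2_class M (\<lambda>x. f x + g x)"
proof -
  have eq: "L2_class M (\<lambda>x. f' x + g' x) = L2_class M (\<lambda>x. f x + g x)"
    if "f' \<in> L2_class M f" "g' \<in> L2_class M g" for f' g'
  proof -
    have *: "f' \<in> L2_fun M" "g' \<in> L2_fun M" "AE x in M. f x = f' x" "AE x in M. g x = g' x"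
      using that by (simp_all add: L2_class_def L2_eq_def)
    have "AE x in M. f' x + g' x = f x + g x" using *(3,4) by eventually_elim simp
    then show ?thesis by (intro L2_class_eqI L2_fun_add * assms)
  qed
  have "L2_add M (L2_class M f) (L2_class M g)
      = (\<Union>f'\<in>L2_class M f. \<Union>g'\<in>L2_class M g. L2_class M (\<lambda>x. f x + g x))"
    unfolding L2_add_def by (intro SUP_cong refl eq)
  also have "\<dots> = L2_class M (\<lambda>x. f x + g x)"
    using L2_class_self[OF assms(1)] L2_class_self[OF assms(2)] by auto
  finally show ?thesis .
qed

lemma L2_scale_class:
  assumes "f \<in> L2_fun M"
  shows "L2_scale M c (L2_class M f) = L2_class M (\<lambda>x. c * f x)"
proof -
  have "L2_class M (\<lambda>x. c * f' x) = L2_class M (\<lambda>x. c * f x)" if "f' \<in> L2_class M f" for f'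
  proof -
    have *: "f' \<in> L2_fun M" "AE x in M. f x = f' x"
      using that by (simp_all add: L2_class_def L2_eq_def)
    have "AE x in M. c * f' x = c * f x" using *(2) by eventually_elim simp
    then show ?thesis by (intro L2_class_eqI L2_fun_scale * assms)
  qed
  then show ?thesis unfolding L2_scale_def using L2_class_self assms by blast
qed

lemma L2_norm_L2_class: "f \<in> L2_fun M \<Longrightarrow> L2_norm M (L2_class M f) = L2n M f"
  by (simp add: L2_norm_class L2n_def)

lemma L2_dist_class:
  assumes "f \<in> L2_fun M" "g \<in> L2_fun M"
  shows "L2_dist M (L2_class M f) (L2_class M g) = L2n M (\<lambda>x. f x - g x)"
  using assms L2_fun_scale[OF assms(2), of "-1"] L2_fun_diff[OF assms]
  by (simp add: L2_dist_def L2_scale_class L2_add_class L2_norm_L2_class)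

lemma L2_add_in_space: "A \<in> L2_space M \<Longrightarrow> B \<in> L2_space M \<Longrightarrow> L2_add M A B \<in> L2_space M"
  by (elim L2_spaceE) (simp add: L2_add_class L2_class_in_space L2_fun_add)

lemma L2_scale_in_space: "A \<in> L2_space M \<Longrightarrow> L2_scale M c A \<in> L2_space M"
  by (elim L2_spaceE) (simp add: L2_scale_class L2_class_in_space L2_fun_scale)

lemma L2_dist_nonneg: "A \<in> L2_space M \<Longrightarrow> B \<in> L2_space M \<Longrightarrow> 0 \<le> L2_dist M A B"
  by (elim L2_spaceE) (simp add: L2_dist_class)

lemma L2_norm_nonneg: "A \<in> L2_space M \<Longrightarrow> 0 \<le> L2_norm M A"
  by (elim L2_spaceE) (simp add: L2_norm_L2_class)

lemma L2_dist_self: "A \<in> L2_space M \<Longrightarrow> L2_dist M A A = 0"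
  by (elim L2_spaceE) (simp add: L2_dist_class L2n_def)

lemma L2_dist_commute: "A \<in> L2_space M \<Longrightarrow> B \<in> L2_space M \<Longrightarrow> L2_dist M A B = L2_dist M B A"
  by (elim L2_spaceE) (simp add: L2_dist_class L2n_def norm_minus_commute)

lemma L2_dist_triangle:
  assumes "A \<in> L2_space M" "B \<in> L2_space M" "C \<in> L2_space M"
  shows "L2_dist M A C \<le> L2_dist M A B + L2_dist M B C"
proof -
  obtain f g h where *: "f \<in> L2_fun M" "g \<in> L2_fun M" "h \<in> L2_fun M"
      "A = L2_class M f" "B = L2_class M g" "C = L2_class M h"
    by (rule L2_spaceE[OF assms(1)], rule L2_spaceE[OF assms(2)], rule L2_spaceE[OF assms(3)]) blast
  then show ?thesis
    using L2n_triangle[OF L2_fun_diff[OF *(1,2)] L2_fun_diff[OF *(2,3)]] by (simp add: L2_dist_class)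
qed

lemma L2_dist_eq_0:
  assumes "A \<in> L2_space M" "B \<in> L2_space M" "L2_dist M A B = 0"
  shows "A = B"
proof -
  obtain f g where *: "f \<in> L2_fun M" "g \<in> L2_fun M" "A = L2_class M f" "B = L2_class M g"
    by (rule L2_spaceE[OF assms(1)], rule L2_spaceE[OF assms(2)]) blast
  then have "AE x in M. f x - g x = 0"
    using assms(3) by (intro L2n_eq_0 L2_fun_diff) (simp_all add: L2_dist_class)
  then have "AE x in M. f x = g x" by simp
  then show ?thesis using * L2_class_eqI by simp
qed

lemma L2_dist_add:
  assumes "A \<in> L2_space M" "B \<in> L2_space M" "A' \<in> L2_space M" "B' \<in> L2_space M"
  shows "L2_dist M (L2_add M A A') (L2_add M B B') \<le> L2_dist M A B + L2_dist M A' B'"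
proof -
  obtain f g f' g' where *: "f \<in> L2_fun M" "g \<in> L2_fun M" "f' \<in> L2_fun M" "g' \<in> L2_fun M"
      "A = L2_class M f" "B = L2_class M g" "A' = L2_class M f'" "B' = L2_class M g'"
    by (rule L2_spaceE[OF assms(1)], rule L2_spaceE[OF assms(2)], rule L2_spaceE[OF assms(3)], rule L2_spaceE[OF assms(4)]) blast
  show ?thesis
    using L2n_triangle[OF L2_fun_diff[OF *(1,2)] L2_fun_diff[OF *(3,4)]] *
    by (simp add: L2_dist_class L2_add_class L2_fun_add add_diff_add)
qed

lemma L2_dist_scale:
  assumes "A \<in> L2_space M" "B \<in> L2_space M"
  shows "L2_dist M (L2_scale M c A) (L2_scale M c B) = cmod c * L2_dist M A B"
proof -
  obtain f g where *: "f \<in> L2_fun M" "g \<in> L2_fun M" "A = L2_class M f" "B = L2_class M g"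
    by (rule L2_spaceE[OF assms(1)], rule L2_spaceE[OF assms(2)]) blast
  show ?thesis
    using L2n_scale[of M c "\<lambda>x. f x - g x"] *
    by (simp add: L2_dist_class L2_scale_class L2_fun_scale right_diff_distrib)
qed

lemma L2_norm_le_dist:
  assumes "A \<in> L2_space M" "B \<in> L2_space M"
  shows "L2_norm M A \<le> L2_norm M B + L2_dist M A B"
proof -
  obtain f g where *: "f \<in> L2_fun M" "g \<in> L2_fun M" "A = L2_class M f" "B = L2_class M g"
    by (rule L2_spaceE[OF assms(1)], rule L2_spaceE[OF assms(2)]) blast
  show ?thesis
    using L2n_triangle[OF *(2) L2_fun_diff[OF *(1,2)]] *
    by (simp add: L2_dist_class L2_norm_L2_class)
qed

text \<open>The explicit rate matters because it does not depend on the measure: limits chosen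
  separately in each fibre are then approached uniformly over the units.\<close>

lemma L2_space_complete:
  assumes A: "\<And>k. A k \<in> L2_space M" and step: "\<And>k. L2_dist M (A (Suc k)) (A k) \<le> (1/4) ^ k"
  obtains B where "B \<in> L2_space M" "\<And>k. L2_dist M (A k) B \<le> 2 * (1/4) ^ k"
proof -
  obtain f where f: "\<And>k. f k \<in> L2_fun M" "\<And>k. A k = L2_class M (f k)"
  proof -
    have "\<exists>f. f \<in> L2_fun M \<and> A k = L2_class M f" for k
      by (rule L2_spaceE[OF A[of k]]) blast
    then show ?thesis using that by metis
  qed
  have f_step: "L2n M (\<lambda>x. f (Suc k) x - f k x) \<le> (1/4) ^ k" for k
    using step[of k] unfolding f(2) L2_dist_class[OF f(1) f(1)] .
  have "\<exists>g\<in>L2_fun M. \<forall>k. L2n M (\<lambda>x. f k x - g x) \<le> 2 * (1/4) ^ k"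
    by (rule L2_complete; rule f(1) f_step)
  then obtain g where g: "g \<in> L2_fun M" "\<forall>k. L2n M (\<lambda>x. f k x - g x) \<le> 2 * (1/4) ^ k"
    by blast
  show thesis
  proof (rule that[OF L2_class_in_space[OF g(1)]])
    show "L2_dist M (A k) (L2_class M g) \<le> 2 * (1/4) ^ k" for k
      using g(2) unfolding f(2) L2_dist_class[OF f(1) g(1)] by blast
  qed
qed

text \<open>Estimates the glued section of \<open>E2_approx\<close>, whose coefficients are constant
  on each fibre.\<close>

lemma L2_sum:
  assumes "finite I" "\<And>i. i \<in> I \<Longrightarrow> h i \<in> L2_fun M"
  shows "(\<lambda>x. \<Sum>i\<in>I. c i * h i x) \<in> L2_fun M"
    and "L2n M (\<lambda>x. \<Sum>i\<in>I. c i * h i x) \<le> (\<Sum>i\<in>I. cmod (c i) * L2n M (h i))"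
proof -
  have "(\<lambda>x. \<Sum>i\<in>I. c i * h i x) \<in> L2_fun M \<and>
      L2n M (\<lambda>x. \<Sum>i\<in>I. c i * h i x) \<le> (\<Sum>i\<in>I. cmod (c i) * L2n M (h i))"
    using assms
  proof (induction I)
    case empty
    then show ?case by (simp add: L2n_def)
  next
    case (insert i I)
    have "L2n M (\<lambda>x. c i * h i x + (\<Sum>i\<in>I. c i * h i x))
        \<le> L2n M (\<lambda>x. c i * h i x) + L2n M (\<lambda>x. \<Sum>i\<in>I. c i * h i x)"
      using insert by (intro L2n_triangle L2_fun_scale) auto
    then show ?case
      using insert L2_fun_add[OF L2_fun_scale[of "h i" M "c i"], of "\<lambda>x. \<Sum>i\<in>I. c i * h i x"]
      by (simp add: L2n_scale)
  qed
  then show "(\<lambda>x. \<Sum>i\<in>I. c i * h i x) \<in> L2_fun M"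
    and "L2n M (\<lambda>x. \<Sum>i\<in>I. c i * h i x) \<le> (\<Sum>i\<in>I. cmod (c i) * L2n M (h i))"
    by auto
qed

lemma L2_dist_le_norms:
  assumes "A \<in> L2_space M" "B \<in> L2_space M"
  shows "L2_dist M A B \<le> L2_norm M A + L2_norm M B"
proof -
  obtain f g where *: "f \<in> L2_fun M" "g \<in> L2_fun M" "A = L2_class M f" "B = L2_class M g"
    by (rule L2_spaceE[OF assms(1)], rule L2_spaceE[OF assms(2)]) blast
  show ?thesis
    using L2n_triangle[OF *(1) L2_fun_scale[OF *(2), of "-1"]] L2n_scale[of M "-1" g] *
    by (simp add: L2_dist_class L2_norm_L2_class)
qed

text \<open>Writes a section as another one plus their difference, which is how additivity of an
  operator gives control of differences.\<close>

lemma L2_add_diff_cancel: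
  assumes "A \<in> L2_space M" "B \<in> L2_space M"
  shows "L2_add M B (L2_add M A (L2_scale M (-1) B)) = A"
proof -
  obtain f g where *: "f \<in> L2_fun M" "g \<in> L2_fun M" "A = L2_class M f" "B = L2_class M g"
    by (rule L2_spaceE[OF assms(1)], rule L2_spaceE[OF assms(2)]) blast
  then show ?thesis
    using L2_fun_scale[OF *(2), of "-1"] L2_fun_diff[OF *(1,2)] by (simp add: L2_scale_class L2_add_class)
qed

lemma L2_dist_eq_0I:
  assumes "A \<in> L2_space M" "B \<in> L2_space M" "\<And>\<epsilon>. 0 < \<epsilon> \<Longrightarrow> L2_dist M A B \<le> \<epsilon>"
  shows "A = B"
proof (rule L2_dist_eq_0[OF assms(1,2)])
  have "L2_dist M A B \<le> 0" by (rule field_le_epsilon) (simp add: assms(3))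
  then show "L2_dist M A B = 0" using L2_dist_nonneg[OF assms(1,2)] by simp
qed

section \<open>Compactly supported functions\<close>

lemma CcI:
  fixes f :: "'a::t2_space \<Rightarrow> complex"
  assumes "continuous_on UNIV f" "compact K" "\<And>x. x \<notin> K \<Longrightarrow> f x = 0"
  shows "f \<in> Cc"
proof -
  have "closure {x. f x \<noteq> 0} \<subseteq> K"
    using assms(2,3) by (intro closure_minimal compact_imp_closed) auto
  then have "compact (closure {x. f x \<noteq> 0})"
    using assms(2) compact_Int_closed[of K "closure {x. f x \<noteq> 0}"] by (simp add: Int_absorb1)
  then show ?thesis using assms(1) by (simp add: Cc_def)
qed

lemma CcE:
  fixes f :: "'a::t2_space \<Rightarrow> complex"
  assumes "f \<in> Cc"
  obtains K where "continuous_on UNIV f" "compact K" "\<And>x. x \<notin> K \<Longrightarrow> f x = 0"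
  using assms closure_subset[of "{x. f x \<noteq> 0}"] by (intro that[of "closure {x. f x \<noteq> 0}"]) (auto simp: Cc_def)

lemma Cc_mult:
  fixes f g :: "'a::t2_space \<Rightarrow> complex"
  assumes "f \<in> Cc" "continuous_on UNIV g"
  shows "(\<lambda>x. f x * g x) \<in> Cc"
proof -
  obtain K where "continuous_on UNIV f" "compact K" "\<And>x. x \<notin> K \<Longrightarrow> f x = 0"
    using CcE[OF assms(1)] by blast
  then show ?thesis using assms(2) by (intro CcI[of _ K] continuous_intros) auto
qed

lemma Cc_add:
  fixes f g :: "'a::t2_space \<Rightarrow> complex"
  assumes "f \<in> Cc" "g \<in> Cc"
  shows "(\<lambda>x. f x + g x) \<in> Cc"
proof -
  obtain K where "continuous_on UNIV f" "compact K" "\<And>x. x \<notin> K \<Longrightarrow> f x = 0"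
    using CcE[OF assms(1)] by blast
  moreover obtain L where "continuous_on UNIV g" "compact L" "\<And>x. x \<notin> L \<Longrightarrow> g x = 0"
    using CcE[OF assms(2)] by blast
  ultimately show ?thesis by (intro CcI[of _ "K \<union> L"] continuous_intros) auto
qed

lemma Cc_scale:
  fixes f :: "'a::t2_space \<Rightarrow> complex"
  shows "f \<in> Cc \<Longrightarrow> (\<lambda>x. c * f x) \<in> Cc"
  using Cc_mult[of f "\<lambda>x. c"] by (simp add: mult.commute)

lemma Cc_diff:
  fixes f g :: "'a::t2_space \<Rightarrow> complex"
  shows "f \<in> Cc \<Longrightarrow> g \<in> Cc \<Longrightarrow> (\<lambda>x. f x - g x) \<in> Cc"
  using Cc_add[of f "\<lambda>x. (-1) * g x"] Cc_scale[of g "-1"] by simp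

lemma Cc_zero: "(\<lambda>x. 0) \<in> (Cc :: ('a::t2_space \<Rightarrow> complex) set)"
  by (rule CcI[of _ "{}"]) auto

lemma Cc_sum:
  fixes f :: "'i \<Rightarrow> 'a::t2_space \<Rightarrow> complex"
  shows "(\<And>i. i \<in> I \<Longrightarrow> f i \<in> Cc) \<Longrightarrow> (\<lambda>x. \<Sum>i\<in>I. f i x) \<in> Cc"
  by (induction I rule: infinite_finite_induct) (simp_all add: Cc_zero Cc_add)

text \<open>The Haar axioms speak of complex integrands in \<open>Cc\<close>, so powers of the
  modulus are embedded back into the complex numbers. A positive exponent keeps them 0 off the
  support.\<close>

lemma Cc_norm_power:
  fixes f :: "'a::t2_space \<Rightarrow> complex"
  assumes "f \<in> Cc" "0 < n"
  shows "(\<lambda>x. complex_of_real (cmod (f x) ^ n)) \<in> Cc"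
proof -
  obtain K where "continuous_on UNIV f" "compact K" "\<And>x. x \<notin> K \<Longrightarrow> f x = 0"
    using CcE[OF assms(1)] by blast
  then show ?thesis using assms(2) by (intro CcI[of _ K] continuous_intros) auto
qed

lemma Cc_bounded:
  fixes f :: "'a::t2_space \<Rightarrow> complex"
  assumes "f \<in> Cc"
  obtains C where "0 \<le> C" "\<And>x. cmod (f x) \<le> C"
proof -
  obtain K where K: "continuous_on UNIV f" "compact K" "\<And>x. x \<notin> K \<Longrightarrow> f x = 0"
    using CcE[OF assms(1)] by blast
  have "bounded (f ` K)"
    using K(1,2) by (intro compact_imp_bounded compact_continuous_image) (auto intro: continuous_on_subset)
  then obtain C where "\<forall>x\<in>f ` K. cmod x \<le> C" unfolding bounded_iff by blast
  then have "cmod (f x) \<le> max 0 C" for x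
    using K(3)[of x] by (cases "x \<in> K") (auto intro: max.coboundedI2)
  then show thesis by (intro that[of "max 0 C"]) auto
qed

section \<open>Groupoids\<close>

context groupoid
begin

lemma inv_composable': "(ginv G x, x) \<in> composable G"
  using inv_composable[of "ginv G x"] by (simp add: inv_inv)

lemma mult_src: "gmult G x (src G x) = x"
  using assoc[OF inv_composable inv_composable', of x] cancel_right[OF inv_composable, of x]
  by (simp add: src_def inv_inv)

lemma rng_mult: "gmult G (rng G x) x = x"
  using cancel_right[OF inv_composable, of x] by (simp add: rng_def inv_inv)

text \<open>If \<open>x\<close> composes with \<open>y\<close>, then \<open>x\<close> absorbs
  \<open>rng G y\<close>, and cancelling \<open>x\<close> on the left leaves the equality of units.
  Conversely \<open>x\<close> composes with \<open>src G x\<close>, and \<open>rng G y\<close> with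
  \<open>y\<close>; the two pairs are glued along the common unit.\<close>

lemma composable_iff: "(x, y) \<in> composable G \<longleftrightarrow> src G x = rng G y"
proof
  assume xy: "(x, y) \<in> composable G"
  have "gmult G x (rng G y) = x"
    using assoc[OF xy inv_composable] cancel_right[OF xy] by (simp add: rng_def)
  moreover have "(x, rng G y) \<in> composable G"
    using assoc_composable[OF xy inv_composable] by (simp add: rng_def)
  ultimately show "src G x = rng G y"
    using cancel_left[of x "rng G y"] by (simp add: src_def)
next
  assume eq: "src G x = rng G y"
  have "(x, src G x) \<in> composable G"
    using assoc_composable[OF inv_composable inv_composable'] by (simp add: src_def)
  moreover have "(rng G y, y) \<in> composable G"
    using assoc_composable[OF inv_composable inv_composable'] by (simp add: rng_def)
  ultimately show "(x, y) \<in> composable G"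
    using assoc_composable[of x "src G x" y] eq mult_src[of x] by simp
qed

lemma rng_inv [simp]: "rng G (ginv G x) = src G x"
  by (simp add: rng_def src_def inv_inv)

lemma src_inv [simp]: "src G (ginv G x) = rng G x"
  by (simp add: rng_def src_def inv_inv)

lemma rng_mult_eq: "src G x = rng G y \<Longrightarrow> rng G (gmult G x y) = rng G x"
  using assoc_composable[OF inv_composable', of x y] composable_iff by simp

lemma src_mult_eq: "src G x = rng G y \<Longrightarrow> src G (gmult G x y) = src G y"
  using assoc_composable[OF _ inv_composable, of x y] composable_iff by simp

lemma rng_rng [simp]: "rng G (rng G x) = rng G x"
  using rng_mult_eq[of x "ginv G x"] by (simp add: rng_def[of G x])

lemma src_rng [simp]: "src G (rng G x) = rng G x"
  using src_mult_eq[of x "ginv G x"] by (simp add: rng_def[of G x])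

lemma rng_in_units [simp]: "rng G x \<in> units G"
  by (simp add: units_def)

lemma src_in_units [simp]: "src G x \<in> units G"
  using rng_in_units[of "ginv G x"] by simp

lemma rng_unit: "u \<in> units G \<Longrightarrow> rng G u = u"
  by (auto simp: units_def)

lemma src_unit: "u \<in> units G \<Longrightarrow> src G u = u"
  by (auto simp: units_def)

lemma units_iff: "u \<in> units G \<longleftrightarrow> rng G u = u"
  using rng_unit rng_in_units by metis

lemma inv_unit: "u \<in> units G \<Longrightarrow> ginv G u = u"
  using rng_mult[of "ginv G u"] by (simp add: src_unit rng_def[symmetric] rng_unit)

lemma unit_mult: "rng G x = u \<Longrightarrow> gmult G u x = x"
  using rng_mult by blast

lemma inv_mult_mult: "rng G t = rng G x \<Longrightarrow> gmult G t (gmult G (ginv G t) x) = x"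
  using cancel_left[of "ginv G t" x] by (simp add: composable_iff inv_inv)

lemma mem_fibre [simp]: "x \<in> fibre G u \<longleftrightarrow> rng G x = u"
  by (simp add: fibre_def)

lemma units_nonempty: "units G \<noteq> {}"
  by (simp add: units_def)

end

text \<open>\<open>\<phi>\<close> will be an expression in \<open>gmult\<close>, continuous on the
  closed set of pairs where the product makes sense. The pairs with a large value are then closed in
  the full product, as \<open>open_tube\<close> requires.\<close>

lemma closed_norm_ge_on:
  fixes \<phi> :: "'a::topological_space \<Rightarrow> 'b::real_normed_vector"
  assumes "closed R" "continuous_on R \<phi>"
  shows "closed {p \<in> R. \<delta> \<le> norm (\<phi> p)}"
proof -
  have "closed (R \<inter> (\<lambda>p. norm (\<phi> p)) -` {\<delta>..})"
    using assms by (intro continuous_closed_preimage continuous_intros) auto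
  also have "R \<inter> (\<lambda>p. norm (\<phi> p)) -` {\<delta>..} = {p \<in> R. \<delta> \<le> norm (\<phi> p)}" by auto
  finally show ?thesis .
qed

text \<open>This is how continuity becomes uniform over a compact support: \<open>B\<close> collects
  the bad pairs, and the tube lemma opens up around each point whose slice over \<open>K\<close>
  avoids them.\<close>

lemma open_tube:
  assumes "compact K" "closed B"
  shows "open {t. \<forall>x\<in>K. (t, x) \<notin> B}"
proof (subst open_subopen, intro ballI)
  fix t assume "t \<in> {t. \<forall>x\<in>K. (t, x) \<notin> B}"
  then have "{t} \<times> K \<subseteq> - B" by auto
  then obtain X where "t \<in> X" "open X" "X \<times> K \<subseteq> - B"
    using Elementary_Topology.tube_lemma[of K "- B" t] assms by (auto simp: open_Compl)
  then have "X \<subseteq> {t. \<forall>x\<in>K. (t, x) \<notin> B}" by fastforce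
  with \<open>open X\<close> \<open>t \<in> X\<close> show "\<exists>T. open T \<and> t \<in> T \<and> T \<subseteq> {t. \<forall>x\<in>K. (t, x) \<notin> B}"
    by (intro exI conjI)
qed

section \<open>Continuity and compactness of the groupoid operations\<close>

context lc_groupoid
begin

lemma continuous_rng: "continuous_on UNIV (rng G)"
proof -
  have "continuous_on UNIV (\<lambda>x. (x, ginv G x))"
    by (intro continuous_intros continuous_inv)
  then have "continuous_on UNIV (\<lambda>x. (\<lambda>(x, y). gmult G x y) (x, ginv G x))"
    by (rule continuous_on_compose2[OF continuous_mult]) (auto simp: inv_composable)
  then show ?thesis by (simp add: rng_def[abs_def])
qed

lemma continuous_src: "continuous_on UNIV (src G)"
  using continuous_on_compose2[OF continuous_rng continuous_inv subset_UNIV] by simp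

lemma closed_units: "closed (units G)"
proof -
  have "units G = {x. rng G x = x}" by (auto simp: units_iff)
  then show ?thesis using continuous_rng by (simp add: closed_Collect_eq continuous_on_id)
qed

lemma closed_fibre: "closed (fibre G u)"
  unfolding fibre_def using continuous_rng by (simp add: closed_Collect_eq)

lemma closed_composable: "closed (composable G)"
proof -
  have "composable G = {p. src G (fst p) = rng G (snd p)}" by (auto simp: composable_iff)
  then show ?thesis
    using continuous_rng continuous_src
    by (auto intro!: closed_Collect_eq continuous_on_compose2[OF continuous_src]
        continuous_on_compose2[OF continuous_rng] continuous_intros)
qed

lemma closed_same_rng: "closed {(t, x). rng G t = rng G x}"
proof -
  have "{(t, x). rng G t = rng G x} = {p. rng G (fst p) = rng G (snd p)}" by auto
  then show ?thesis
    by (auto intro!: closed_Collect_eq continuous_on_compose2[OF continuous_rng] continuous_intros)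
qed

lemma continuous_inv_mult: "continuous_on {(t, x). rng G t = rng G x} (\<lambda>p. gmult G (ginv G (fst p)) (snd p))"
proof -
  have "continuous_on {(t, x). rng G t = rng G x} (\<lambda>p. (ginv G (fst p), snd p))"
    by (auto intro!: continuous_on_compose2[OF continuous_inv] continuous_intros)
  then have "continuous_on {(t, x). rng G t = rng G x} (\<lambda>p. (\<lambda>(x, y). gmult G x y) (ginv G (fst p), snd p))"
    by (rule continuous_on_compose2[OF continuous_mult]) (auto simp: composable_iff)
  then show ?thesis by simp
qed

lemma continuous_inv_mult_fibre: "continuous_on (fibre G (rng G x)) (\<lambda>t. gmult G (ginv G t) x)"
  using continuous_on_compose2[OF continuous_inv_mult, of "fibre G (rng G x)" "\<lambda>t. (t, x)"]
  by (simp add: continuous_intros image_subset_iff)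

text \<open>The composable pairs in \<open>K \<times> L\<close> form a compact set because
  \<open>composable G\<close> is closed. Products of this kind contain the supports of
  convolutions.\<close>

lemma compact_mult:
  assumes "compact K" "compact L"
  shows "compact {gmult G x y | x y. x \<in> K \<and> y \<in> L \<and> src G x = rng G y}"
proof -
  have "compact ((K \<times> L) \<inter> composable G)"
    using assms closed_composable by (intro compact_Int_closed compact_Times)
  then have "compact ((\<lambda>(x, y). gmult G x y) ` ((K \<times> L) \<inter> composable G))"
    by (intro compact_continuous_image continuous_on_subset[OF continuous_mult]) auto
  also have "(\<lambda>(x, y). gmult G x y) ` ((K \<times> L) \<inter> composable G)
      = {gmult G x y | x y. x \<in> K \<and> y \<in> L \<and> src G x = rng G y}"
    by (auto simp: composable_iff) blast
  finally show ?thesis .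
qed

text \<open>At a unit \<open>u\<close> the translation is trivial, as \<open>gmult G u x = x\<close>
  on the fibre over \<open>u\<close>. The tube lemma spreads this to nearby \<open>t\<close>,
  uniformly for \<open>x\<close> in the support of \<open>f\<close>.\<close>

lemma nearly_invariant_nbhd:
  assumes f: "f \<in> Cc" and "0 < \<epsilon>"
  obtains W where "open W" "units G \<subseteq> W"
    "\<And>t x. t \<in> W \<Longrightarrow> rng G t = rng G x \<Longrightarrow> cmod (f (gmult G (ginv G t) x) - f x) < \<epsilon>"
proof -
  obtain K where K: "continuous_on UNIV f" "compact K" "\<And>x. x \<notin> K \<Longrightarrow> f x = 0"
    using CcE[OF f] by blast
  define R where "R = {(t, x). rng G t = rng G x}"
  define B where "B = {p \<in> R. \<epsilon> \<le> cmod (f (gmult G (ginv G (fst p)) (snd p)) - f (snd p))}"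
  have "continuous_on R (\<lambda>p. f (gmult G (ginv G (fst p)) (snd p)) - f (snd p))"
    unfolding R_def using K(1)
    by (intro continuous_on_diff continuous_on_compose2[OF K(1)] continuous_inv_mult continuous_intros) auto
  then have "closed B"
    unfolding B_def using closed_same_rng by (intro closed_norm_ge_on) (simp_all add: R_def)
  define W0 where "W0 = {t. \<forall>x\<in>K. (t, x) \<notin> B}"
  have "open W0" unfolding W0_def by (rule open_tube[OF K(2) \<open>closed B\<close>])
  \<comment> \<open>Having \<open>ginv G t\<close> in \<open>W0\<close> as well covers an
    \<open>x\<close> outside \<open>K\<close> whose translate \<open>y\<close> lies in
    \<open>K\<close>: the two points exchange roles, with \<open>ginv G t\<close> in place of
    \<open>t\<close>.\<close>
  define W where "W = W0 \<inter> ginv G -` W0"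
  show thesis
  proof
    have "open (ginv G -` W0)"
      using \<open>open W0\<close> continuous_inv by (simp add: continuous_on_open_vimage)
    then show "open W" unfolding W_def using \<open>open W0\<close> by blast
    have "u \<in> W0" if "u \<in> units G" for u
      using that \<open>0 < \<epsilon>\<close> by (auto simp: W0_def B_def R_def inv_unit unit_mult rng_unit)
    then show "units G \<subseteq> W" by (auto simp: W_def inv_unit)
    fix t x assume t: "t \<in> W" and eq: "rng G t = rng G x"
    define y where "y = gmult G (ginv G t) x"
    have y: "rng G y = src G t" "gmult G t y = x"
      using eq by (simp_all add: y_def rng_mult_eq inv_mult_mult)
    consider "x \<in> K" | "y \<in> K" | "x \<notin> K" "y \<notin> K" by blast
    then show "cmod (f (gmult G (ginv G t) x) - f x) < \<epsilon>"
    proof cases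
      case 1
      then show ?thesis using t eq by (auto simp: W_def W0_def B_def R_def)
    next
      case 2
      then have "\<not> \<epsilon> \<le> cmod (f (gmult G (ginv G (ginv G t)) y) - f y)"
        using t y by (auto simp: W_def W0_def B_def R_def)
      then show ?thesis using y by (simp add: inv_inv norm_minus_commute y_def)
    next
      case 3
      then show ?thesis using K(3) \<open>0 < \<epsilon>\<close> by (simp add: y_def)
    qed
  qed
qed

end

context left_haar_system
begin

section \<open>Integration against a Haar system\<close>

lemma space_haar: "u \<in> units G \<Longrightarrow> space (\<nu> u) = fibre G u"
  using sets_eq_imp_space_eq[OF sets_haar, of u] by (simp add: space_restrict_space)

lemma measurable_haar:
  assumes "u \<in> units G" "f \<in> measurable borel N"
  shows "f \<in> measurable (\<nu> u) N"
  by (subst measurable_cong_sets[OF sets_haar[OF assms(1)] refl])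
    (rule measurable_restrict_space1[OF assms(2)])

text \<open>Meant for integrands such as \<open>f (gmult G (ginv G t) x)\<close> in the variable
  \<open>t\<close>, whose continuity is available on the fibre.\<close>

lemma measurable_haar_fibre:
  fixes f :: "'g \<Rightarrow> 'b::topological_space"
  assumes "u \<in> units G" "continuous_on (fibre G u) f"
  shows "f \<in> borel_measurable (\<nu> u)"
  by (subst measurable_cong_sets[OF sets_haar[OF assms(1)] refl])
    (rule borel_measurable_continuous_on_restrict[OF assms(2)])

lemma compact_Int_fibre: "compact K \<Longrightarrow> compact (K \<inter> fibre G u)"
  by (rule compact_Int_closed[OF _ closed_fibre])

lemma sets_compact_Int_fibre:
  assumes "u \<in> units G" "compact K"
  shows "K \<inter> fibre G u \<in> sets (\<nu> u)"
proof -
  have "K \<in> sets borel" using assms(2) by (intro borel_closed compact_imp_closed)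
  then show ?thesis
    by (auto simp: sets_haar[OF assms(1)] sets_restrict_space Int_commute)
qed

lemma emeasure_compact_Int_fibre: "u \<in> units G \<Longrightarrow> compact K \<Longrightarrow> emeasure (\<nu> u) (K \<inter> fibre G u) < \<infinity>"
  by (intro finite_on_compact compact_Int_fibre) auto

lemma integrable_haar:
  fixes f :: "'g \<Rightarrow> 'b::{banach, second_countable_topology}"
  assumes u: "u \<in> units G" and "f \<in> borel_measurable (\<nu> u)" and K: "compact K"
    and "\<And>t. rng G t = u \<Longrightarrow> norm (f t) \<le> C"
    and "\<And>t. rng G t = u \<Longrightarrow> t \<notin> K \<Longrightarrow> f t = 0"
  shows "integrable (\<nu> u) f"
proof (rule integrableI_bounded_set[OF sets_compact_Int_fibre[OF u K]])
  show "emeasure (\<nu> u) (K \<inter> fibre G u) < \<infinity>" by (rule emeasure_compact_Int_fibre[OF u K])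
  show "AE x in \<nu> u. x \<in> K \<inter> fibre G u \<longrightarrow> norm (f x) \<le> C"
    by (rule AE_I2) (simp add: assms(4))
  show "AE x in \<nu> u. x \<notin> K \<inter> fibre G u \<longrightarrow> f x = 0"
    by (rule AE_I2) (use assms(5) in \<open>auto simp: space_haar u\<close>)
qed (rule assms(2))

lemma integrable_indicator_haar:
  assumes "u \<in> units G" "compact K"
  shows "integrable (\<nu> u) (indicat_real (K \<inter> fibre G u))"
  using sets_compact_Int_fibre[OF assms] emeasure_compact_Int_fibre[OF assms] by simp

text \<open>Together with \<open>bounded_measure_compact\<close> this controls integrals over all
  fibres at once by a sup bound and a common compact support.\<close>

lemma norm_integral_haar_le:
  fixes f :: "'g \<Rightarrow> 'b::{banach, second_countable_topology}"
  assumes u: "u \<in> units G" and "f \<in> borel_measurable (\<nu> u)" and K: "compact K"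
    and "\<And>t. rng G t = u \<Longrightarrow> norm (f t) \<le> C"
    and "\<And>t. rng G t = u \<Longrightarrow> t \<notin> K \<Longrightarrow> f t = 0"
  shows "norm (\<integral>t. f t \<partial>\<nu> u) \<le> C * measure (\<nu> u) (K \<inter> fibre G u)"
proof -
  have "norm (\<integral>t. f t \<partial>\<nu> u) \<le> (\<integral>t. norm (f t) \<partial>\<nu> u)" by (rule integral_norm_bound)
  also have "\<dots> \<le> (\<integral>t. C * indicat_real (K \<inter> fibre G u) t \<partial>\<nu> u)"
  proof (rule integral_mono)
    show "integrable (\<nu> u) (\<lambda>t. norm (f t))"
      using integrable_haar[OF assms] by simp
    show "integrable (\<nu> u) (\<lambda>t. C * indicat_real (K \<inter> fibre G u) t)"
      using integrable_indicator_haar[OF u K] by simp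
  qed (use assms(4,5) u in \<open>auto simp: space_haar indicator_def\<close>)
  also have "\<dots> = C * measure (\<nu> u) (K \<inter> fibre G u)"
    using sets_compact_Int_fibre[OF u K] sets.sets_into_space by (simp add: space_haar u)
  finally show ?thesis .
qed

lemma measurable_Cc: "u \<in> units G \<Longrightarrow> f \<in> Cc \<Longrightarrow> f \<in> borel_measurable (\<nu> u)"
  by (intro measurable_haar borel_measurable_continuous_onI) (auto simp: Cc_def)

lemma integrable_Cc:
  assumes "u \<in> units G" "f \<in> Cc"
  shows "integrable (\<nu> u) f"
proof -
  obtain K where "continuous_on UNIV f" and "compact K" "\<And>x. x \<notin> K \<Longrightarrow> f x = 0"
    by (rule CcE[OF assms(2)]) blast
  moreover obtain C where "0 \<le> C" "\<And>x. cmod (f x) \<le> C"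
    by (rule Cc_bounded[OF assms(2)]) blast
  ultimately show ?thesis
    using integrable_haar[OF assms(1) measurable_Cc[OF assms], of K C] by blast
qed

text \<open>Prepares Fubini in \<open>L2n_conv_le\<close>. The compact closures of a countable base,
  cut with the fibre, have finite measure and cover it.\<close>

lemma sigma_finite_haar:
  assumes u: "u \<in> units G"
  shows "sigma_finite_measure (\<nu> u)"
proof
  obtain B :: "nat \<Rightarrow> 'g set" where B: "\<And>j. compact (closure (B j))"
    "\<And>K W. compact K \<Longrightarrow> open W \<Longrightarrow> K \<subseteq> W \<Longrightarrow> \<exists>j. K \<subseteq> B j \<and> B j \<subseteq> W"
    by (rule relatively_compact_base[OF locally_compact]) blast
  show "\<exists>A. countable A \<and> A \<subseteq> sets (\<nu> u) \<and> \<Union> A = space (\<nu> u) \<and> (\<forall>a\<in>A. emeasure (\<nu> u) a \<noteq> \<infinity>)"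
  proof (intro exI conjI ballI)
    let ?A = "range (\<lambda>j. closure (B j) \<inter> fibre G u)"
    show "countable ?A" by simp
    show "?A \<subseteq> sets (\<nu> u)" using sets_compact_Int_fibre[OF u B(1)] by blast
    show "\<Union>?A = space (\<nu> u)"
    proof
      show "space (\<nu> u) \<subseteq> \<Union>?A"
      proof
        fix x assume "x \<in> space (\<nu> u)"
        moreover obtain j where "x \<in> B j" using B(2)[of "{x}" UNIV] by auto
        ultimately show "x \<in> \<Union>?A" using closure_subset u by (auto simp: space_haar)
      qed
    qed (simp add: space_haar u)
    fix a assume "a \<in> ?A"
    then show "emeasure (\<nu> u) a \<noteq> \<infinity>"
      using emeasure_compact_Int_fibre[OF u B(1)] by (auto simp: less_top)
  qed
qed

text \<open>A unit whose fibre meets the support lies in the compact image of the support under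
  \<open>rng G\<close>, where continuity gives a bound. Over every other unit the integrand
  vanishes.\<close>

lemma bounded_haar_integral:
  assumes f: "f \<in> Cc"
  obtains C where "0 \<le> C" "\<And>u. u \<in> units G \<Longrightarrow> cmod (\<integral>t. f t \<partial>\<nu> u) \<le> C"
proof -
  obtain K where "continuous_on UNIV f" and K: "compact K" "\<And>x. x \<notin> K \<Longrightarrow> f x = 0" by (rule CcE[OF f]) blast
  have "compact (rng G ` K)"
    using K(1) continuous_rng by (intro compact_continuous_image) (auto intro: continuous_on_subset)
  then have "bounded ((\<lambda>u. \<integral>t. f t \<partial>\<nu> u) ` rng G ` K)"
    by (rule compact_imp_bounded[OF compact_continuous_image[OF continuous_on_subset[OF continuous_integral[OF f]]], rotated])
      auto
  then obtain C where C: "\<forall>z\<in>(\<lambda>u. \<integral>t. f t \<partial>\<nu> u) ` rng G ` K. cmod z \<le> C"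
    unfolding bounded_iff by blast
  have "cmod (\<integral>t. f t \<partial>\<nu> u) \<le> max 0 C" if u: "u \<in> units G" for u
  proof (cases "u \<in> rng G ` K")
    case True
    then show ?thesis using C by (auto intro: max.coboundedI2)
  next
    case False
    then have "(\<integral>t. f t \<partial>\<nu> u) = (\<integral>t. 0 \<partial>\<nu> u)"
      using K(2) u by (intro Bochner_Integration.integral_cong) (auto simp: space_haar)
    then show ?thesis by simp
  qed
  then show thesis by (intro that[of "max 0 C"]) auto
qed

lemma bounded_haar_integral_norm:
  assumes f: "f \<in> Cc" and "0 < n"
  obtains C where "0 \<le> C" "\<And>u. u \<in> units G \<Longrightarrow> (\<integral>t. cmod (f t) ^ n \<partial>\<nu> u) \<le> C"
proof -
  obtain C where "0 \<le> C" "\<And>u. u \<in> units G \<Longrightarrow> cmod (\<integral>t. complex_of_real (cmod (f t) ^ n) \<partial>\<nu> u) \<le> C"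
    by (rule bounded_haar_integral[OF Cc_norm_power[OF assms]]) blast
  then show thesis
    by (intro that[of C]) (auto simp: integral_complex_of_real simp del: of_real_power intro: order_trans[OF abs_ge_self])
qed

text \<open>Indicators are not continuous in general, so the continuity axiom reaches them through a
  bump function that dominates the indicator of \<open>K\<close>.\<close>

lemma bounded_measure_compact:
  assumes K: "compact K"
  obtains C where "0 \<le> C" "\<And>u. u \<in> units G \<Longrightarrow> measure (\<nu> u) (K \<inter> fibre G u) \<le> C"
proof -
  obtain h :: "'g \<Rightarrow> real" where h: "continuous_on UNIV h" "\<And>x. 0 \<le> h x" "\<And>x. h x \<le> 1"
      "\<And>x. x \<in> K \<Longrightarrow> h x = 1" "{x. h x \<noteq> 0} \<subseteq> UNIV" "compact (closure {x. h x \<noteq> 0})"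
    by (rule bump_function[OF locally_compact K open_UNIV subset_UNIV]) blast
  have hc: "(\<lambda>x. complex_of_real (h x)) \<in> Cc"
    using h closure_subset[of "{x. h x \<noteq> 0}"]
    by (intro CcI[of _ "closure {x. h x \<noteq> 0}"] continuous_intros) auto
  obtain C where C: "0 \<le> C" "\<And>u. u \<in> units G \<Longrightarrow> cmod (\<integral>t. complex_of_real (h t) \<partial>\<nu> u) \<le> C"
    by (rule bounded_haar_integral[OF hc]) blast
  show thesis
  proof (rule that[OF C(1)])
    fix u assume u: "u \<in> units G"
    have "measure (\<nu> u) (K \<inter> fibre G u) = (\<integral>t. indicat_real (K \<inter> fibre G u) t \<partial>\<nu> u)"
      using sets_compact_Int_fibre[OF u K] by simp
    also have "\<dots> \<le> (\<integral>t. h t \<partial>\<nu> u)"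
    proof (rule integral_mono[OF integrable_indicator_haar[OF u K]])
      show "integrable (\<nu> u) h"
        using integrable_Cc[OF u hc] by (simp add: complex_of_real_integrable_eq)
    qed (use h(2,4) in \<open>auto simp: indicator_def\<close>)
    also have "\<dots> \<le> C"
      using C(2)[OF u] by (simp add: integral_complex_of_real)
    finally show "measure (\<nu> u) (K \<inter> fibre G u) \<le> C" .
  qed
qed

lemma Cc_L2_fun:
  assumes "u \<in> units G" "f \<in> Cc"
  shows "f \<in> L2_fun (\<nu> u)"
  using measurable_Cc[OF assms] integrable_Cc[OF assms(1) Cc_norm_power[OF assms(2), of 2]]
  by (simp add: L2_fun_def complex_of_real_integrable_eq del: of_real_power)

lemma bounded_L2n:
  assumes f: "f \<in> Cc"
  obtains C where "0 \<le> C" "\<And>u. u \<in> units G \<Longrightarrow> L2n (\<nu> u) f \<le> C"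
proof -
  obtain C where "0 \<le> C" "\<And>u. u \<in> units G \<Longrightarrow> (\<integral>t. cmod (f t) ^ 2 \<partial>\<nu> u) \<le> C"
    using bounded_haar_integral_norm[OF f, of 2] by auto
  then show thesis by (intro that[of "sqrt C"]) (auto simp: L2n_def)
qed

section \<open>Convolution\<close>

lemma conv_nonzero:
  assumes "conv G \<nu> F f x \<noteq> 0"
  obtains t where "rng G t = rng G x" "F t \<noteq> 0" "f (gmult G (ginv G t) x) \<noteq> 0"
proof -
  have "\<exists>t. rng G t = rng G x \<and> F t * f (gmult G (ginv G t) x) \<noteq> 0"
  proof (rule ccontr)
    assume "\<not> ?thesis"
    then have "conv G \<nu> F f x = (\<integral>t. 0 \<partial>\<nu> (rng G x))"
      unfolding conv_def by (intro Bochner_Integration.integral_cong) (auto simp: space_haar)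
    then show False using assms by simp
  qed
  then show thesis using that by auto
qed

text \<open>The first hypothesis confines to \<open>K\<close> just the arrows that contribute to the
  integral at \<open>x\<close>. This suits the approximate identity, whose full supports may grow
  without bound.\<close>

lemma conv_supported_in_product:
  assumes "\<And>t. F t \<noteq> 0 \<Longrightarrow> rng G t = rng G x \<Longrightarrow> f (gmult G (ginv G t) x) \<noteq> 0 \<Longrightarrow> t \<in> K"
    and "\<And>x. x \<notin> L \<Longrightarrow> f x = 0"
    and "conv G \<nu> F f x \<noteq> 0"
  shows "x \<in> {gmult G x y | x y. x \<in> K \<and> y \<in> L \<and> src G x = rng G y}"
proof -
  obtain t where t: "rng G t = rng G x" "F t \<noteq> 0" "f (gmult G (ginv G t) x) \<noteq> 0"
    using conv_nonzero[OF assms(3)] .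
  then have "t \<in> K" "gmult G (ginv G t) x \<in> L" using assms by auto
  moreover have "x = gmult G t (gmult G (ginv G t) x)" "src G t = rng G (gmult G (ginv G t) x)"
    using t by (simp_all add: inv_mult_mult rng_mult_eq)
  ultimately show ?thesis by blast
qed

lemma measurable_conv_integrand:
  assumes "F \<in> Cc" "f \<in> Cc"
  shows "(\<lambda>t. F t * f (gmult G (ginv G t) x)) \<in> borel_measurable (\<nu> (rng G x))"
proof (rule measurable_haar_fibre)
  show "continuous_on (fibre G (rng G x)) (\<lambda>t. F t * f (gmult G (ginv G t) x))"
    using assms unfolding Cc_def
    by (intro continuous_on_mult continuous_on_compose2[of UNIV f, OF _ continuous_inv_mult_fibre])
      (auto intro: continuous_on_subset)
qed simp

lemma integrable_conv_integrand:
  assumes "F \<in> Cc" "f \<in> Cc"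
  shows "integrable (\<nu> (rng G x)) (\<lambda>t. F t * f (gmult G (ginv G t) x))"
proof -
  obtain K where "continuous_on UNIV F" and "compact K" "\<And>x. x \<notin> K \<Longrightarrow> F x = 0" by (rule CcE[OF assms(1)]) blast
  moreover obtain C where "0 \<le> C" "\<And>x. cmod (F x) \<le> C" by (rule Cc_bounded[OF assms(1)]) blast
  moreover obtain D where "0 \<le> D" "\<And>x. cmod (f x) \<le> D" by (rule Cc_bounded[OF assms(2)]) blast
  ultimately show ?thesis
    by (intro integrable_haar[of _ _ K "C * D"] measurable_conv_integrand assms)
      (auto simp: norm_mult intro: mult_mono)
qed

lemma continuous_conv:
  assumes F: "F \<in> Cc" and f: "f \<in> Cc"
  shows "continuous_on UNIV (conv G \<nu> F f)"
proof -
  obtain K where K: "continuous_on UNIV F" "compact K" "\<And>x. x \<notin> K \<Longrightarrow> F x = 0"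
    by (rule CcE[OF F]) blast
  obtain M where M: "0 \<le> M" "\<And>x. cmod (F x) \<le> M" by (rule Cc_bounded[OF F]) blast
  obtain C where C: "0 \<le> C" "\<And>u. u \<in> units G \<Longrightarrow> measure (\<nu> u) (K \<inter> fibre G u) \<le> C"
    by (rule bounded_measure_compact[OF K(2)]) blast
  have contf: "continuous_on UNIV f" using f by (simp add: Cc_def)
  have "isCont (conv G \<nu> F f) x0" for x0
  proof -
    have "continuous_on (K \<inter> fibre G (rng G x0)) (\<lambda>t. f (gmult G (ginv G t) x0))"
      by (rule continuous_on_compose2[OF contf continuous_on_subset[OF continuous_inv_mult_fibre]]) auto
    then obtain h where h: "continuous_on UNIV h"
        "\<And>t. t \<in> K \<inter> fibre G (rng G x0) \<Longrightarrow> h t = f (gmult G (ginv G t) x0)"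
      using Tietze_compact_complex[OF locally_compact compact_Int_fibre[OF K(2)]] by blast
    define g where "g t = F t * h t" for t
    have gc: "g \<in> Cc" unfolding g_def using F h(1) by (rule Cc_mult)
    define I where "I x = (\<integral>t. g t \<partial>\<nu> (rng G x))" for x
    have contI: "continuous_on UNIV I"
      unfolding I_def by (rule continuous_on_compose2[OF continuous_integral[OF gc] continuous_rng]) auto
    have I0: "I x0 = conv G \<nu> F f x0"
      unfolding I_def conv_def
    proof (rule Bochner_Integration.integral_cong[OF refl])
      fix t assume "t \<in> space (\<nu> (rng G x0))"
      then show "g t = F t * f (gmult G (ginv G t) x0)"
        using h(2)[of t] K(3)[of t] by (cases "t \<in> K") (auto simp: g_def space_haar)
    qed
    show ?thesis
      unfolding continuous_at
    proof (rule tendstoI)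
      fix e :: real assume "0 < e"
      \<comment> \<open>Chosen so that an error \<open>\<delta>\<close> in the second factor costs
        less than \<open>e / 2\<close> after integration; the summand 1 keeps the denominator
        positive when \<open>M * C\<close> is 0.\<close>
      define \<delta> where "\<delta> = e / (2 * (M * C + 1))"
      have MC: "0 < M * C + 1" using M(1) C(1) by (simp add: add_nonneg_pos)
      then have \<delta>: "0 < \<delta>" "M * \<delta> * C < e / 2"
        using \<open>0 < e\<close> M(1) C(1) by (auto simp: \<delta>_def field_simps)
      define R where "R = {p. rng G (fst p) = rng G (snd p)}"
      \<comment> \<open>Here \<open>x\<close> is the first coordinate, since the tube must be open
        around \<open>x0\<close> while \<open>t\<close> runs through \<open>K\<close>.\<close>
      define B where "B = {p \<in> R. \<delta> \<le> cmod (f (gmult G (ginv G (snd p)) (fst p)) - h (snd p))}"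
      have closedR: "closed R"
        unfolding R_def
        by (auto intro!: closed_Collect_eq continuous_on_compose2[OF continuous_rng] continuous_intros)
      have "continuous_on R (\<lambda>p. gmult G (ginv G (fst (snd p, fst p))) (snd (snd p, fst p)))"
        by (rule continuous_on_compose2[OF continuous_inv_mult, of R "\<lambda>p. (snd p, fst p)"])
          (auto simp: R_def intro!: continuous_intros)
      then have "continuous_on R (\<lambda>p. f (gmult G (ginv G (snd p)) (fst p)) - h (snd p))"
        by (intro continuous_on_diff continuous_on_compose2[OF contf] continuous_on_compose2[OF h(1)] continuous_intros) auto
      then have "closed B" unfolding B_def by (rule closed_norm_ge_on[OF closedR])
      then have "open {x. \<forall>t\<in>K. (x, t) \<notin> B}" by (rule open_tube[OF K(2)])
      moreover have "x0 \<in> {x. \<forall>t\<in>K. (x, t) \<notin> B}"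
        using h(2) \<delta>(1) by (auto simp: B_def R_def)
      ultimately have ev1: "eventually (\<lambda>x. \<forall>t\<in>K. (x, t) \<notin> B) (at x0)"
        unfolding eventually_at_topological by blast
      have "(I \<longlongrightarrow> I x0) (at x0)"
        using contI by (simp add: continuous_on_def)
      then have ev2: "eventually (\<lambda>x. dist (I x) (I x0) < e / 2) (at x0)"
        using \<open>0 < e\<close> by (intro tendstoD) auto
      show "eventually (\<lambda>x. dist (conv G \<nu> F f x) (conv G \<nu> F f x0) < e) (at x0)"
        using ev1 ev2
      proof eventually_elim
        case (elim x)
        have "conv G \<nu> F f x - I x = (\<integral>t. F t * f (gmult G (ginv G t) x) - g t \<partial>\<nu> (rng G x))"
          unfolding conv_def I_def
          by (rule Bochner_Integration.integral_diff[symmetric])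
            (auto intro: integrable_conv_integrand F f integrable_Cc gc)
        also have "cmod \<dots> \<le> M * \<delta> * measure (\<nu> (rng G x)) (K \<inter> fibre G (rng G x))"
        proof (rule norm_integral_haar_le)
          show "(\<lambda>t. F t * f (gmult G (ginv G t) x) - g t) \<in> borel_measurable (\<nu> (rng G x))"
            by (intro borel_measurable_diff measurable_conv_integrand measurable_Cc F f gc) simp
          fix t assume t: "rng G t = rng G x"
          show "F t * f (gmult G (ginv G t) x) - g t = 0" if "t \<notin> K"
            using K(3)[OF that] by (simp add: g_def)
          show "cmod (F t * f (gmult G (ginv G t) x) - g t) \<le> M * \<delta>"
          proof (cases "t \<in> K")
            case True
            then have "cmod (f (gmult G (ginv G t) x) - h t) \<le> \<delta>"
              using elim(1) t by (auto simp: B_def R_def)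
            then show ?thesis
              using M by (simp add: g_def norm_mult mult_mono flip: right_diff_distrib)
          next
            case False
            then show ?thesis using K(3) M(1) \<delta>(1) by (simp add: g_def)
          qed
        qed (use K(2) in auto)
        also have "\<dots> \<le> M * \<delta> * C"
          using C(2)[of "rng G x"] M(1) \<delta>(1) by (intro mult_left_mono) auto
        finally have "dist (conv G \<nu> F f x) (I x) < e / 2"
          using \<delta>(2) by (simp add: dist_norm)
        then show ?case
          using elim(2) I0 dist_triangle[of "conv G \<nu> F f x" "conv G \<nu> F f x0" "I x"] by simp
      qed
    qed
  qed
  then show ?thesis by (simp add: continuous_at_imp_continuous_on)
qed

lemma Cc_conv:
  assumes F: "F \<in> Cc" and f: "f \<in> Cc"
  shows "conv G \<nu> F f \<in> Cc"
proof -
  obtain K where "continuous_on UNIV F" and K: "compact K" "\<And>x. x \<notin> K \<Longrightarrow> F x = 0" by (rule CcE[OF F]) blast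
  obtain L where "continuous_on UNIV f" and L: "compact L" "\<And>x. x \<notin> L \<Longrightarrow> f x = 0" by (rule CcE[OF f]) blast
  show ?thesis
    using conv_supported_in_product[of F _ f K L] K(2) L(2)
    by (intro CcI[OF continuous_conv[OF F f] compact_mult[OF K(1) L(1)]]) blast
qed

text \<open>Left invariance is used for the arrow \<open>ginv G t\<close>, whose source is
  \<open>rng G t\<close> and whose range is \<open>src G t\<close>.\<close>

lemma left_invariant_norm:
  assumes f: "f \<in> Cc"
  shows "(\<integral>x. (cmod (f (gmult G (ginv G t) x)))\<^sup>2 \<partial>\<nu> (rng G t)) = (L2n (\<nu> (src G t)) f)\<^sup>2"
proof -
  have "(\<integral>x. complex_of_real ((cmod (f (gmult G (ginv G t) x)))\<^sup>2) \<partial>\<nu> (rng G t))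
      = (\<integral>x. complex_of_real ((cmod (f x))\<^sup>2) \<partial>\<nu> (src G t))"
    using left_invariant[OF Cc_norm_power[OF f, of 2], of "ginv G t"] by simp
  then show ?thesis by (simp add: L2n_square integral_complex_of_real del: of_real_power)
qed

text \<open>The kernel is continuous on the closed set of pairs with equal range, and extended by 0
  it is Borel on the product space. Second countability identifies the Borel sets of the product
  with the product of the Borel algebras, and on pairs from a single fibre the extension changes
  nothing.\<close>

lemma measurable_square_kernel:
  assumes u: "u \<in> units G" and F: "F \<in> Cc" and f: "f \<in> Cc"
  shows "(\<lambda>(t, x). ennreal (cmod (F t) * (cmod (f (gmult G (ginv G t) x)))\<^sup>2))
    \<in> borel_measurable (\<nu> u \<Otimes>\<^sub>M \<nu> u)"
proof -
  define R where "R = {(t, x). rng G t = rng G x}"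
  define \<psi> where "\<psi> p = (if p \<in> R then cmod (F (fst p)) * (cmod (f (gmult G (ginv G (fst p)) (snd p))))\<^sup>2 else 0)" for p
  have contF: "continuous_on UNIV F" and contf: "continuous_on UNIV f"
    using F f by (auto simp: Cc_def)
  have "continuous_on R (\<lambda>p. cmod (F (fst p)) * (cmod (f (gmult G (ginv G (fst p)) (snd p))))\<^sup>2)"
    unfolding R_def
    by (intro continuous_on_mult continuous_on_norm continuous_on_power continuous_on_compose2[OF contF]
        continuous_on_compose2[OF contf] continuous_inv_mult continuous_on_fst continuous_on_id) auto
  then have "\<psi> \<in> borel_measurable borel"
    unfolding \<psi>_def using closed_same_rng
    by (intro borel_measurable_continuous_on_if) (auto simp: R_def)
  then have \<psi>: "\<psi> \<in> borel_measurable (borel \<Otimes>\<^sub>M borel)"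
    by (simp add: borel_prod)
  have id: "(\<lambda>x. x) \<in> measurable (\<nu> u) borel"
    by (rule measurable_haar[OF u]) simp
  have "(\<lambda>p. (fst p, snd p)) \<in> measurable (\<nu> u \<Otimes>\<^sub>M \<nu> u) (borel \<Otimes>\<^sub>M borel)"
    by (intro measurable_Pair measurable_compose[OF measurable_fst id] measurable_compose[OF measurable_snd id])
  from measurable_compose[OF this \<psi>]
  have "(\<lambda>p. ennreal (\<psi> (fst p, snd p))) \<in> borel_measurable (\<nu> u \<Otimes>\<^sub>M \<nu> u)"
    by (rule measurable_compose) simp
  then show ?thesis
    by (rule measurable_cong[THEN iffD1, rotated])
      (auto simp: space_pair_measure space_haar u \<psi>_def R_def)
qed

text \<open>
  Cauchy--Schwarz with respect to the weight \<open>cmod \<circ> F\<close> bounds \<open>(cmod (conv G \<nu> F f x))\<^sup>2\<close>; Fubini and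
  left invariance then turn the integral over \<open>x\<close> into the fibre norms of \<open>f\<close>.
\<close>

lemma L2n_conv_le:
  assumes u: "u \<in> units G" and F: "F \<in> Cc" and f: "f \<in> Cc"
    and C: "(\<integral>t. cmod (F t) \<partial>\<nu> u) \<le> C"
    and D: "\<And>v. v \<in> units G \<Longrightarrow> L2n (\<nu> v) f \<le> D"
  shows "L2n (\<nu> u) (conv G \<nu> F f) \<le> C * D"
proof -
  let ?k = "\<lambda>t x. f (gmult G (ginv G t) x)"
  have pair: "pair_sigma_finite (\<nu> u) (\<nu> u)"
    using sigma_finite_haar[OF u] by (intro pair_sigma_finite.intro)
  have F_meas: "F \<in> borel_measurable (\<nu> u)" by (rule measurable_Cc[OF u F])
  have "0 \<le> (\<integral>t. cmod (F t) \<partial>\<nu> u)" by simp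
  with C have C0: "0 \<le> C" by linarith
  have D0: "0 \<le> D" using D[OF u] L2n_nonneg[of "\<nu> u" f] by linarith
  have intF: "(\<integral>\<^sup>+t. ennreal (cmod (F t)) \<partial>\<nu> u) \<le> ennreal C"
    using nn_integral_eq_integral[of "\<nu> u" "\<lambda>t. cmod (F t)"] integrable_Cc[OF u F] C
    by (simp add: ennreal_leI)
  have pointwise: "ennreal ((cmod (conv G \<nu> F f x))\<^sup>2)
      \<le> ennreal C * (\<integral>\<^sup>+t. ennreal (cmod (F t) * (cmod (?k t x))\<^sup>2) \<partial>\<nu> u)" if x: "rng G x = u" for x
  proof -
    have k_meas: "(\<lambda>t. ?k t x) \<in> borel_measurable (\<nu> u)"
    proof (rule measurable_haar_fibre[OF u])
      have contf: "continuous_on UNIV f" using f by (simp add: Cc_def)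
      show "continuous_on (fibre G u) (\<lambda>t. ?k t x)"
        using continuous_on_compose2[OF contf continuous_inv_mult_fibre[of x]] x by simp
    qed
    have [measurable]: "F \<in> borel_measurable (\<nu> u)" "(\<lambda>t. ?k t x) \<in> borel_measurable (\<nu> u)"
      by fact+
    have int: "integrable (\<nu> u) (\<lambda>t. cmod (F t * ?k t x))"
      using integrable_norm[OF integrable_conv_integrand[OF F f, of x]] x by simp
    have "cmod (conv G \<nu> F f x) \<le> (\<integral>t. cmod (F t * ?k t x) \<partial>\<nu> u)"
      unfolding conv_def x by (rule integral_norm_bound)
    then have "ennreal ((cmod (conv G \<nu> F f x))\<^sup>2) \<le> (ennreal (\<integral>t. cmod (F t * ?k t x) \<partial>\<nu> u))\<^sup>2"
      by (simp add: ennreal_power ennreal_leI power_mono)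
    \<comment> \<open>Splitting \<open>cmod (F t)\<close> into two square roots makes one factor of
      Cauchy-Schwarz the fibre mass of \<open>F\<close>.\<close>
    also have "ennreal (\<integral>t. cmod (F t * ?k t x) \<partial>\<nu> u)
        = (\<integral>\<^sup>+t. ennreal (sqrt (cmod (F t))) * ennreal (sqrt (cmod (F t)) * cmod (?k t x)) \<partial>\<nu> u)"
      by (subst nn_integral_eq_integral[symmetric, OF int])
        (auto intro!: nn_integral_cong simp: norm_mult simp flip: ennreal_mult)
    also have "\<dots>\<^sup>2 \<le> (\<integral>\<^sup>+t. ennreal (sqrt (cmod (F t))) ^ 2 \<partial>\<nu> u)
        * (\<integral>\<^sup>+t. ennreal (sqrt (cmod (F t)) * cmod (?k t x)) ^ 2 \<partial>\<nu> u)"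
      by (rule Cauchy_Schwarz_nn_integral) measurable
    also have "\<dots> = (\<integral>\<^sup>+t. ennreal (cmod (F t)) \<partial>\<nu> u) * (\<integral>\<^sup>+t. ennreal (cmod (F t) * (cmod (?k t x))\<^sup>2) \<partial>\<nu> u)"
      by (simp add: ennreal_power power_mult_distrib)
    also have "\<dots> \<le> ennreal C * (\<integral>\<^sup>+t. ennreal (cmod (F t) * (cmod (?k t x))\<^sup>2) \<partial>\<nu> u)"
      by (rule mult_right_mono[OF intF]) simp
    finally show ?thesis .
  qed
  have inner: "(\<integral>\<^sup>+x. ennreal (cmod (F t) * (cmod (?k t x))\<^sup>2) \<partial>\<nu> u) \<le> ennreal (D\<^sup>2) * ennreal (cmod (F t))"
    if t: "rng G t = u" for t
  proof -
    have contk: "continuous_on (fibre G u) (?k t)"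
    proof -
      have "continuous_on (fibre G u) (\<lambda>x. gmult G (ginv G (fst (t, x))) (snd (t, x)))"
        by (rule continuous_on_compose2[OF continuous_inv_mult]) (auto intro!: continuous_intros simp: t)
      then show ?thesis
        using continuous_on_compose2[of UNIV f "fibre G u"] f by (simp add: Cc_def)
    qed
    have meas: "(\<lambda>x. ?k t x) \<in> borel_measurable (\<nu> u)"
      by (rule measurable_haar_fibre[OF u contk])
    have int: "integrable (\<nu> u) (\<lambda>x. (cmod (?k t x))\<^sup>2)"
    proof -
      obtain L where "continuous_on UNIV f" and L: "compact L" "\<And>x. x \<notin> L \<Longrightarrow> f x = 0"
        by (rule CcE[OF f]) blast
      obtain N where N: "0 \<le> N" "\<And>x. cmod (f x) \<le> N" by (rule Cc_bounded[OF f]) blast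
      \<comment> \<open>The translate by \<open>t\<close> of the support \<open>L\<close>, outside
        which the translated function vanishes.\<close>
      let ?K = "{gmult G x y | x y. x \<in> {t} \<and> y \<in> L \<and> src G x = rng G y}"
      have "integrable (\<nu> u) (\<lambda>x. complex_of_real ((cmod (?k t x))\<^sup>2))"
      proof (rule integrable_haar[OF u])
        show "compact ?K" by (rule compact_mult[OF _ L(1)]) simp
        show "(\<lambda>x. complex_of_real ((cmod (?k t x))\<^sup>2)) \<in> borel_measurable (\<nu> u)"
          using meas by measurable
        fix x assume x: "rng G x = u"
        show "cmod (complex_of_real ((cmod (?k t x))\<^sup>2)) \<le> N\<^sup>2"
          using N power_mono[OF N(2)] by (simp add: norm_power del: of_real_power)
        assume "x \<notin> ?K"
        then have "gmult G (ginv G t) x \<notin> L"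
          using x t inv_mult_mult[of t x] rng_mult_eq[of "ginv G t" x] by force
        then show "complex_of_real ((cmod (?k t x))\<^sup>2) = 0" using L(2) by simp
      qed
      then show ?thesis by (simp only: complex_of_real_integrable_eq)
    qed
    have "(\<integral>\<^sup>+x. ennreal ((cmod (?k t x))\<^sup>2) \<partial>\<nu> u) = ennreal ((L2n (\<nu> (src G t)) f)\<^sup>2)"
      using nn_integral_eq_integral[OF int] left_invariant_norm[OF f, of t] t by simp
    \<comment> \<open>Translation has moved the norm to the fibre over \<open>src G t\<close>, which
      varies with \<open>t\<close>; this is why \<open>D\<close> bounds the norms over all units and
      not just over \<open>u\<close>.\<close>
    also have "\<dots> \<le> ennreal (D\<^sup>2)"
      using D[of "src G t"] by (intro ennreal_leI power_mono) auto
    finally have "ennreal (cmod (F t)) * (\<integral>\<^sup>+x. ennreal ((cmod (?k t x))\<^sup>2) \<partial>\<nu> u)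
        \<le> ennreal (cmod (F t)) * ennreal (D\<^sup>2)"
      by (rule mult_left_mono) simp
    then show ?thesis
      using meas by (simp add: ennreal_mult nn_integral_cmult mult.commute)
  qed
  have "ennreal ((L2n (\<nu> u) (conv G \<nu> F f))\<^sup>2) = (\<integral>\<^sup>+x. ennreal ((cmod (conv G \<nu> F f x))\<^sup>2) \<partial>\<nu> u)"
    using nn_integral_eq_integral[OF L2_fun_integrable[OF Cc_L2_fun[OF u Cc_conv[OF F f]]]]
    by (simp add: L2n_square)
  also have "\<dots> \<le> (\<integral>\<^sup>+x. ennreal C * (\<integral>\<^sup>+t. ennreal (cmod (F t) * (cmod (?k t x))\<^sup>2) \<partial>\<nu> u) \<partial>\<nu> u)"
    by (rule nn_integral_mono) (simp add: pointwise space_haar u)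
  also have "\<dots> = ennreal C * (\<integral>\<^sup>+x. (\<integral>\<^sup>+t. ennreal (cmod (F t) * (cmod (?k t x))\<^sup>2) \<partial>\<nu> u) \<partial>\<nu> u)"
    by (rule nn_integral_cmult)
      (rule sigma_finite_measure.borel_measurable_nn_integral[OF sigma_finite_haar[OF u]
         measurable_pair_swap[OF measurable_square_kernel[OF u F f], simplified]])
  also have "\<dots> = ennreal C * (\<integral>\<^sup>+t. (\<integral>\<^sup>+x. ennreal (cmod (F t) * (cmod (?k t x))\<^sup>2) \<partial>\<nu> u) \<partial>\<nu> u)"
    by (subst pair_sigma_finite.Fubini'[OF pair measurable_square_kernel[OF u F f]]) simp
  also have "\<dots> \<le> ennreal C * (\<integral>\<^sup>+t. ennreal (D\<^sup>2) * ennreal (cmod (F t)) \<partial>\<nu> u)"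
    by (intro mult_left_mono nn_integral_mono) (simp_all add: inner space_haar u)
  also have "\<dots> = ennreal C * (ennreal (D\<^sup>2) * (\<integral>\<^sup>+t. ennreal (cmod (F t)) \<partial>\<nu> u))"
    using F_meas by (subst nn_integral_cmult) auto
  \<comment> \<open>\<open>C\<close> enters for the second time: once as the mass split off by
    Cauchy-Schwarz, and now from integrating \<open>cmod (F t)\<close>.\<close>
  also have "\<dots> \<le> ennreal C * (ennreal (D\<^sup>2) * ennreal C)"
    by (intro mult_left_mono intF) auto
  also have "\<dots> = ennreal ((C * D)\<^sup>2)"
    using C0 by (simp add: power2_eq_square ac_simps flip: ennreal_mult)
  finally have "(L2n (\<nu> u) (conv G \<nu> F f))\<^sup>2 \<le> (C * D)\<^sup>2"
    by (simp add: ennreal_le_iff)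
  then show ?thesis using C0 D0 by (intro power2_le_imp_le[OF _ mult_nonneg_nonneg])
qed

section \<open>The space \<open>E\<^sup>2\<close> as the uniform closure of \<open>Cc\<close>\<close>

lemma section_in_space: "\<xi> \<in> sections G \<nu> \<Longrightarrow> u \<in> units G \<Longrightarrow> \<xi> u \<in> L2_space (\<nu> u)"
  by (auto simp: sections_def)

lemma section_of_apply: "u \<in> units G \<Longrightarrow> section_of G \<nu> f u = L2_class (\<nu> u) f"
  by (simp add: section_of_def)

lemma section_of_in_sections: "f \<in> Cc \<Longrightarrow> section_of G \<nu> f \<in> sections G \<nu>"
  by (simp add: section_of_def sections_def L2_class_in_space Cc_L2_fun)

lemma L2_class_Cc: "f \<in> Cc \<Longrightarrow> u \<in> units G \<Longrightarrow> L2_class (\<nu> u) f \<in> L2_space (\<nu> u)"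
  by (simp add: L2_class_in_space Cc_L2_fun)

lemma section_add_apply:
  "u \<in> units G \<Longrightarrow> section_add G \<nu> \<xi> \<eta> u = L2_add (\<nu> u) (\<xi> u) (\<eta> u)"
  by (simp add: section_add_def)

lemma section_scale_apply: "u \<in> units G \<Longrightarrow> section_scale G \<nu> c \<xi> u = L2_scale (\<nu> u) c (\<xi> u)"
  by (simp add: section_scale_def)

lemma section_add_in_sections:
  "\<xi> \<in> sections G \<nu> \<Longrightarrow> \<eta> \<in> sections G \<nu> \<Longrightarrow> section_add G \<nu> \<xi> \<eta> \<in> sections G \<nu>"
  by (auto simp: sections_def section_add_def intro!: L2_add_in_space)

lemma section_scale_in_sections: "\<xi> \<in> sections G \<nu> \<Longrightarrow> section_scale G \<nu> c \<xi> \<in> sections G \<nu>"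
  by (auto simp: sections_def section_scale_def intro!: L2_scale_in_space)

lemma L2_norm_section_diff:
  "u \<in> units G \<Longrightarrow> L2_norm (\<nu> u) (section_diff G \<nu> \<xi> \<eta> u) = L2_dist (\<nu> u) (\<xi> u) (\<eta> u)"
  by (simp add: section_diff_def section_add_def section_scale_def L2_dist_def)

lemma sections_eqI:
  assumes "\<xi> \<in> sections G \<nu>" "\<eta> \<in> sections G \<nu>" "\<And>u. u \<in> units G \<Longrightarrow> \<xi> u = \<eta> u"
  shows "\<xi> = \<eta>"
  using assms unfolding sections_def by (rule PiE_ext)

lemma E2_in_sections: "\<xi> \<in> E2 G \<nu> \<Longrightarrow> \<xi> \<in> sections G \<nu>"
  by (simp add: E2_def continuous_section_def)

lemma E2_in_space: "\<xi> \<in> E2 G \<nu> \<Longrightarrow> u \<in> units G \<Longrightarrow> \<xi> u \<in> L2_space (\<nu> u)"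
  by (intro section_in_space E2_in_sections)

text \<open>A uniform approximant works with \<open>UNIV\<close> as the neighbourhood of every unit.
  Its fibre norm vanishes off the compact image of its support under \<open>rng G\<close>, which
  gives vanishing at infinity. With \<open>E2_approx\<close> this characterizes \<open>E2\<close> as
  a uniform closure.\<close>

lemma E2I:
  assumes \<xi>: "\<xi> \<in> sections G \<nu>"
    and approx: "\<And>\<epsilon>. 0 < \<epsilon> \<Longrightarrow> \<exists>f\<in>Cc. \<forall>u\<in>units G. L2_dist (\<nu> u) (\<xi> u) (L2_class (\<nu> u) f) \<le> \<epsilon>"
  shows "\<xi> \<in> E2 G \<nu>"
  unfolding E2_def continuous_section_def vanishes_at_infinity_def
proof (intro CollectI conjI ballI allI impI)
  show "\<xi> \<in> sections G \<nu>" by fact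
next
  fix v and \<epsilon> :: real assume "v \<in> units G" "0 < \<epsilon>"
  obtain f where f: "f \<in> Cc" "\<And>u. u \<in> units G \<Longrightarrow> L2_dist (\<nu> u) (\<xi> u) (L2_class (\<nu> u) f) \<le> \<epsilon> / 2"
    using approx[of "\<epsilon> / 2"] \<open>0 < \<epsilon>\<close> by auto
  have "L2_norm (\<nu> u) (section_diff G \<nu> \<xi> (section_of G \<nu> f) u) < \<epsilon>" if "u \<in> units G" for u
    using f(2)[OF that] \<open>0 < \<epsilon>\<close> by (simp add: L2_norm_section_diff section_of_apply that)
  then show "\<exists>f\<in>Cc. \<exists>U. open U \<and> v \<in> U \<and>
      (\<forall>u\<in>U \<inter> units G. L2_norm (\<nu> u) (section_diff G \<nu> \<xi> (section_of G \<nu> f) u) < \<epsilon>)"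
    by (intro bexI[OF _ f(1)] exI[of _ UNIV]) auto
next
  fix \<epsilon> :: real assume "0 < \<epsilon>"
  obtain f where f: "f \<in> Cc" "\<And>u. u \<in> units G \<Longrightarrow> L2_dist (\<nu> u) (\<xi> u) (L2_class (\<nu> u) f) \<le> \<epsilon> / 2"
    using approx[of "\<epsilon> / 2"] \<open>0 < \<epsilon>\<close> by auto
  obtain K where "continuous_on UNIV f" and K: "compact K" "\<And>x. x \<notin> K \<Longrightarrow> f x = 0"
    by (rule CcE[OF f(1)]) blast
  show "\<exists>K. compact K \<and> K \<subseteq> units G \<and> (\<forall>u\<in>units G - K. L2_norm (\<nu> u) (\<xi> u) < \<epsilon>)"
  proof (intro exI conjI ballI)
    show "compact (rng G ` K)"
      by (rule compact_continuous_image[OF continuous_on_subset[OF continuous_rng] K(1)]) simp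
    show "rng G ` K \<subseteq> units G" by auto
    fix u assume u: "u \<in> units G - rng G ` K"
    have "L2n (\<nu> u) f = sqrt (\<integral>x. 0 \<partial>\<nu> u)"
      unfolding L2n_def using u K(2)
      by (intro arg_cong[of _ _ sqrt] Bochner_Integration.integral_cong) (auto simp: space_haar)
    then have "L2_norm (\<nu> u) (L2_class (\<nu> u) f) = 0"
      using u f(1) by (simp add: L2_norm_L2_class Cc_L2_fun)
    then show "L2_norm (\<nu> u) (\<xi> u) < \<epsilon>"
      using L2_norm_le_dist[OF section_in_space[OF \<xi>, of u] L2_class_Cc[OF f(1), of u]] u f(2)[of u] \<open>0 < \<epsilon>\<close>
      by simp
  qed
qed

text \<open>
  The local approximants are glued with a partition of unity \<open>\<psi> i / max (1/2) (\<Sum>\<psi>)\<close>, which need not sum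
  to \<open>1\<close> off \<open>K\<close>: there the section itself is small.
\<close>

lemma E2_approx:
  assumes \<xi>: "\<xi> \<in> E2 G \<nu>" and "0 < \<epsilon>"
  obtains f where "f \<in> Cc" "\<And>u. u \<in> units G \<Longrightarrow> L2_dist (\<nu> u) (\<xi> u) (L2_class (\<nu> u) f) \<le> \<epsilon>"
proof -
  obtain K where K: "compact K" "K \<subseteq> units G" "\<And>u. u \<in> units G - K \<Longrightarrow> L2_norm (\<nu> u) (\<xi> u) < \<epsilon>"
    using \<xi> \<open>0 < \<epsilon>\<close> unfolding E2_def vanishes_at_infinity_def by auto
  have "\<exists>f U. f \<in> Cc \<and> open U \<and> v \<in> U \<and>
      (\<forall>u\<in>U \<inter> units G. L2_norm (\<nu> u) (section_diff G \<nu> \<xi> (section_of G \<nu> f) u) < \<epsilon>)" if "v \<in> K" for v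
    using \<xi> \<open>0 < \<epsilon>\<close> that K(2) unfolding E2_def continuous_section_def by blast
  then obtain f U where fU: "\<And>v. v \<in> K \<Longrightarrow> f v \<in> Cc \<and> open (U v) \<and> v \<in> U v \<and>
      (\<forall>u\<in>U v \<inter> units G. L2_norm (\<nu> u) (section_diff G \<nu> \<xi> (section_of G \<nu> (f v)) u) < \<epsilon>)"
    by metis
  have "\<exists>\<psi> :: 'g \<Rightarrow> real. continuous_on UNIV \<psi> \<and> (\<forall>x. 0 \<le> \<psi> x) \<and> \<psi> v = 1 \<and> {x. \<psi> x \<noteq> 0} \<subseteq> U v"
    if "v \<in> K" for v
  proof -
    have "compact {v}" "open (U v)" "{v} \<subseteq> U v" using fU[OF that] by auto
    then obtain h :: "'g \<Rightarrow> real" where "continuous_on UNIV h" "\<And>x. 0 \<le> h x" "\<And>x. h x \<le> 1"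
        "\<And>x. x \<in> {v} \<Longrightarrow> h x = 1" "{x. h x \<noteq> 0} \<subseteq> U v" "compact (closure {x. h x \<noteq> 0})"
      by (rule bump_function[OF locally_compact]) blast
    then show ?thesis by (intro exI[of _ h]) auto
  qed
  then obtain \<psi> :: "'g \<Rightarrow> 'g \<Rightarrow> real" where \<psi>: "\<And>v. v \<in> K \<Longrightarrow> continuous_on UNIV (\<psi> v) \<and>
      (\<forall>x. 0 \<le> \<psi> v x) \<and> \<psi> v v = 1 \<and> {x. \<psi> v x \<noteq> 0} \<subseteq> U v"
    by metis
  have "open {x. 1/2 < \<psi> v x}" if "v \<in> K" for v
    using \<psi>[OF that] by (intro open_Collect_less) auto
  moreover have "K \<subseteq> (\<Union>v\<in>K. {x. 1/2 < \<psi> v x})"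
  proof
    fix v assume "v \<in> K"
    then show "v \<in> (\<Union>v\<in>K. {x. 1/2 < \<psi> v x})" using \<psi>[of v] by (intro UN_I[of v]) auto
  qed
  ultimately obtain I where I: "I \<subseteq> K" "finite I" "K \<subseteq> (\<Union>v\<in>I. {x. 1/2 < \<psi> v x})"
    by (rule compactE_image[OF K(1)]) blast
  have \<psi>0: "0 \<le> \<psi> i x" if "i \<in> I" for i x using \<psi> I(1) that by blast
  \<comment> \<open>Over \<open>K\<close> some \<open>\<psi> i\<close> exceeds 1/2, so the maximum
    there is the sum itself. Elsewhere it keeps the denominator positive and the quotients summing
    to at most 1.\<close>
  define S where "S u = max (1/2) (\<Sum>i\<in>I. \<psi> i u)" for u
  define c where "c i u = \<psi> i u / S u" for i u
  have S_pos: "0 < S u" for u by (simp add: S_def less_max_iff_disj)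
  have c0: "0 \<le> c i u" if "i \<in> I" for i u
    using \<psi>0[OF that] S_pos[of u] by (simp add: c_def)
  have c_sum: "(\<Sum>i\<in>I. c i u) = (\<Sum>i\<in>I. \<psi> i u) / S u" for u
    by (simp add: c_def sum_divide_distrib)
  have c_le: "(\<Sum>i\<in>I. c i u) \<le> 1" for u
    unfolding c_sum using S_pos[of u] by (simp add: S_def)
  have c_eq: "(\<Sum>i\<in>I. c i u) = 1" if uK: "u \<in> K" for u
  proof -
    obtain i where i: "i \<in> I" "1/2 < \<psi> i u" using I(3) uK by blast
    then have "\<psi> i u \<le> (\<Sum>i\<in>I. \<psi> i u)" using \<psi>0 I(2) by (intro member_le_sum) auto
    then have "S u = (\<Sum>i\<in>I. \<psi> i u)" using i(2) by (simp add: S_def)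
    then show ?thesis using S_pos[of u] by (simp add: c_sum)
  qed
  have c_cont: "continuous_on UNIV (c i)" if "i \<in> I" for i
  proof -
    have "continuous_on UNIV (\<psi> i)" if "i \<in> I" for i using \<psi> I(1) that by blast
    moreover have "S u \<noteq> 0" for u using S_pos[of u] by simp
    ultimately show ?thesis
      unfolding c_def using that by (intro continuous_on_divide) (auto simp: S_def intro!: continuous_intros)
  qed
  \<comment> \<open>Pulling the coefficients back along \<open>rng G\<close> makes them constant on
    every fibre.\<close>
  define g where "g x = (\<Sum>i\<in>I. f i x * complex_of_real (c i (rng G x)))" for x
  show thesis
  proof
    have "(\<lambda>x. f i x * complex_of_real (c i (rng G x))) \<in> Cc" if "i \<in> I" for i
      using fU I(1) that
      by (intro Cc_mult continuous_on_of_real continuous_on_compose2[OF c_cont[OF that] continuous_rng]) auto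
    then show "g \<in> Cc" unfolding g_def by (rule Cc_sum)
    fix u assume u: "u \<in> units G"
    obtain h where h: "h \<in> L2_fun (\<nu> u)" "\<xi> u = L2_class (\<nu> u) h"
      by (rule L2_spaceE[OF E2_in_space[OF \<xi> u]])
    have fL2: "f i \<in> L2_fun (\<nu> u)" if "i \<in> I" for i
      using fU I(1) that u by (intro Cc_L2_fun) auto
    have near: "L2n (\<nu> u) (\<lambda>x. h x - f i x) \<le> \<epsilon>" if i: "i \<in> I" "c i u \<noteq> 0" for i
    proof -
      have "\<psi> i u \<noteq> 0" using i(2) by (auto simp: c_def)
      then have "u \<in> U i" using \<psi>[of i] i(1) I(1) by auto
      then have "L2_norm (\<nu> u) (section_diff G \<nu> \<xi> (section_of G \<nu> (f i)) u) < \<epsilon>"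
        using fU i(1) I(1) u by blast
      then show ?thesis
        using u fL2[OF i(1)] h by (simp add: L2_norm_section_diff section_of_apply L2_dist_class)
    qed
    let ?s = "\<Sum>i\<in>I. c i u"
    \<comment> \<open>The defect of the coefficients from sum 1 is charged to \<open>h\<close>
      itself: it is 0 over \<open>K\<close>, and off \<open>K\<close> the norm of \<open>h\<close>
      is at most \<open>\<epsilon>\<close>. The two error terms therefore add up to exactly
      \<open>\<epsilon>\<close>.\<close>
    let ?d = "\<lambda>x. complex_of_real (1 - ?s) * h x + (\<Sum>i\<in>I. complex_of_real (c i u) * (h x - f i x))"
    have "L2_dist (\<nu> u) (\<xi> u) (L2_class (\<nu> u) g) = L2n (\<nu> u) (\<lambda>x. h x - g x)"
      using h Cc_L2_fun[OF u \<open>g \<in> Cc\<close>] by (simp add: L2_dist_class)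
    also have "\<dots> = L2n (\<nu> u) ?d"
      unfolding L2n_def
    proof (intro arg_cong[of _ _ sqrt] Bochner_Integration.integral_cong refl arg_cong[of _ _ "\<lambda>z. (cmod z)\<^sup>2"])
      fix x assume "x \<in> space (\<nu> u)"
      then show "h x - g x = ?d x"
        using u by (simp add: g_def space_haar right_diff_distrib left_diff_distrib sum_subtractf
            mult.commute flip: sum_distrib_left)
    qed
    also have "\<dots> \<le> L2n (\<nu> u) (\<lambda>x. complex_of_real (1 - ?s) * h x)
        + L2n (\<nu> u) (\<lambda>x. \<Sum>i\<in>I. complex_of_real (c i u) * (h x - f i x))"
      using h fL2 I(2) by (intro L2n_triangle L2_fun_scale L2_sum(1) L2_fun_diff)
    also have "\<dots> \<le> (1 - ?s) * \<epsilon> + (\<Sum>i\<in>I. c i u * \<epsilon>)"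
    proof (rule add_mono)
      have "L2n (\<nu> u) (\<lambda>x. complex_of_real (1 - ?s) * h x) = (1 - ?s) * L2n (\<nu> u) h"
        using c_le[of u] by (simp add: L2n_scale norm_of_real del: of_real_diff of_real_sum)
      also have "\<dots> \<le> (1 - ?s) * \<epsilon>"
      proof (cases "u \<in> K")
        case False
        then have "L2n (\<nu> u) h \<le> \<epsilon>" using K(3)[of u] u h by (simp add: L2_norm_L2_class)
        then show ?thesis using c_le[of u] by (intro mult_left_mono) auto
      qed (simp add: c_eq)
      finally show "L2n (\<nu> u) (\<lambda>x. complex_of_real (1 - ?s) * h x) \<le> (1 - ?s) * \<epsilon>" .
      have "L2n (\<nu> u) (\<lambda>x. \<Sum>i\<in>I. complex_of_real (c i u) * (h x - f i x))
          \<le> (\<Sum>i\<in>I. cmod (complex_of_real (c i u)) * L2n (\<nu> u) (\<lambda>x. h x - f i x))"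
        using h fL2 I(2) by (intro L2_sum(2) L2_fun_diff)
      also have "\<dots> \<le> (\<Sum>i\<in>I. c i u * \<epsilon>)"
      proof (rule sum_mono)
        fix i assume "i \<in> I"
        then show "cmod (complex_of_real (c i u)) * L2n (\<nu> u) (\<lambda>x. h x - f i x) \<le> c i u * \<epsilon>"
          using near[of i] c0[of i u] by (cases "c i u = 0") (auto intro: mult_left_mono)
      qed
      finally show "L2n (\<nu> u) (\<lambda>x. \<Sum>i\<in>I. complex_of_real (c i u) * (h x - f i x)) \<le> (\<Sum>i\<in>I. c i u * \<epsilon>)" .
    qed
    also have "\<dots> = \<epsilon>" by (simp add: left_diff_distrib flip: sum_distrib_right)
    finally show "L2_dist (\<nu> u) (\<xi> u) (L2_class (\<nu> u) g) \<le> \<epsilon>" .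
  qed
qed

lemma section_of_in_E2: "f \<in> Cc \<Longrightarrow> section_of G \<nu> f \<in> E2 G \<nu>"
  by (rule E2I[OF section_of_in_sections]) (auto intro!: bexI[of _ f] simp: section_of_apply L2_dist_self L2_class_Cc)

lemma section_add_in_E2:
  assumes "\<xi> \<in> E2 G \<nu>" "\<eta> \<in> E2 G \<nu>"
  shows "section_add G \<nu> \<xi> \<eta> \<in> E2 G \<nu>"
proof (rule E2I[OF section_add_in_sections[OF E2_in_sections[OF assms(1)] E2_in_sections[OF assms(2)]]])
  fix \<epsilon> :: real assume "0 < \<epsilon>"
  then have "0 < \<epsilon> / 2" by simp
  obtain f where f: "f \<in> Cc" "\<And>u. u \<in> units G \<Longrightarrow> L2_dist (\<nu> u) (\<xi> u) (L2_class (\<nu> u) f) \<le> \<epsilon> / 2"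
    by (rule E2_approx[OF assms(1) \<open>0 < \<epsilon> / 2\<close>]) blast
  obtain g where g: "g \<in> Cc" "\<And>u. u \<in> units G \<Longrightarrow> L2_dist (\<nu> u) (\<eta> u) (L2_class (\<nu> u) g) \<le> \<epsilon> / 2"
    by (rule E2_approx[OF assms(2) \<open>0 < \<epsilon> / 2\<close>]) blast
  show "\<exists>f\<in>Cc. \<forall>u\<in>units G. L2_dist (\<nu> u) (section_add G \<nu> \<xi> \<eta> u) (L2_class (\<nu> u) f) \<le> \<epsilon>"
  proof (intro bexI ballI)
    show "(\<lambda>x. f x + g x) \<in> Cc" by (rule Cc_add[OF f(1) g(1)])
    fix u assume u: "u \<in> units G"
    have "L2_dist (\<nu> u) (section_add G \<nu> \<xi> \<eta> u) (L2_class (\<nu> u) (\<lambda>x. f x + g x))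
        \<le> L2_dist (\<nu> u) (\<xi> u) (L2_class (\<nu> u) f) + L2_dist (\<nu> u) (\<eta> u) (L2_class (\<nu> u) g)"
      using L2_dist_add[OF E2_in_space[OF assms(1) u] L2_class_Cc[OF f(1) u] E2_in_space[OF assms(2) u] L2_class_Cc[OF g(1) u]]
      by (simp add: u section_add_apply L2_add_class Cc_L2_fun f(1) g(1))
    then show "L2_dist (\<nu> u) (section_add G \<nu> \<xi> \<eta> u) (L2_class (\<nu> u) (\<lambda>x. f x + g x)) \<le> \<epsilon>"
      using f(2)[OF u] g(2)[OF u] by simp
  qed
qed

lemma section_scale_in_E2:
  assumes "\<xi> \<in> E2 G \<nu>"
  shows "section_scale G \<nu> c \<xi> \<in> E2 G \<nu>"
proof (rule E2I[OF section_scale_in_sections[OF E2_in_sections[OF assms]]])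
  fix \<epsilon> :: real assume "0 < \<epsilon>"
  have c: "0 < cmod c + 1" by (simp add: add_nonneg_pos)
  with \<open>0 < \<epsilon>\<close> have \<delta>: "0 < \<epsilon> / (cmod c + 1)" by simp
  obtain f where f: "f \<in> Cc" "\<And>u. u \<in> units G \<Longrightarrow> L2_dist (\<nu> u) (\<xi> u) (L2_class (\<nu> u) f) \<le> \<epsilon> / (cmod c + 1)"
    by (rule E2_approx[OF assms \<delta>]) blast
  show "\<exists>f\<in>Cc. \<forall>u\<in>units G. L2_dist (\<nu> u) (section_scale G \<nu> c \<xi> u) (L2_class (\<nu> u) f) \<le> \<epsilon>"
  proof (intro bexI ballI)
    show "(\<lambda>x. c * f x) \<in> Cc" by (rule Cc_scale[OF f(1)])
    fix u assume u: "u \<in> units G"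
    have "L2_dist (\<nu> u) (section_scale G \<nu> c \<xi> u) (L2_class (\<nu> u) (\<lambda>x. c * f x))
        = cmod c * L2_dist (\<nu> u) (\<xi> u) (L2_class (\<nu> u) f)"
      using L2_dist_scale[OF E2_in_space[OF assms u] L2_class_Cc[OF f(1) u], of c]
      by (simp add: u section_scale_apply L2_scale_class Cc_L2_fun f(1))
    also have "\<dots> \<le> (cmod c + 1) * (\<epsilon> / (cmod c + 1))"
      using f(2)[OF u] L2_dist_nonneg[OF E2_in_space[OF assms u] L2_class_Cc[OF f(1) u]]
      by (intro mult_mono) auto
    also have "\<dots> = \<epsilon>" using c by simp
    finally show "L2_dist (\<nu> u) (section_scale G \<nu> c \<xi> u) (L2_class (\<nu> u) (\<lambda>x. c * f x)) \<le> \<epsilon>" .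
  qed
qed

lemma section_diff_in_E2: "\<xi> \<in> E2 G \<nu> \<Longrightarrow> \<eta> \<in> E2 G \<nu> \<Longrightarrow> section_diff G \<nu> \<xi> \<eta> \<in> E2 G \<nu>"
  by (simp add: section_diff_def section_add_in_E2 section_scale_in_E2)

text \<open>\<open>section_norm\<close> is a supremum of reals and bounds its members only once this
  is known. An approximant in \<open>Cc\<close> has bounded fibre norms and is off by at most
  1.\<close>

lemma bdd_above_section_norm:
  assumes \<xi>: "\<xi> \<in> E2 G \<nu>"
  shows "bdd_above ((\<lambda>u. L2_norm (\<nu> u) (\<xi> u)) ` units G)"
proof -
  obtain f where f: "f \<in> Cc" "\<And>u. u \<in> units G \<Longrightarrow> L2_dist (\<nu> u) (\<xi> u) (L2_class (\<nu> u) f) \<le> 1"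
    by (rule E2_approx[OF \<xi> zero_less_one]) blast
  obtain C where C: "0 \<le> C" "\<And>u. u \<in> units G \<Longrightarrow> L2n (\<nu> u) f \<le> C"
    by (rule bounded_L2n[OF f(1)]) blast
  have "L2_norm (\<nu> u) (\<xi> u) \<le> C + 1" if u: "u \<in> units G" for u
    using L2_norm_le_dist[OF E2_in_space[OF \<xi> u] L2_class_Cc[OF f(1) u]] f(2)[OF u] C(2)[OF u]
    by (simp add: L2_norm_L2_class Cc_L2_fun[OF u f(1)])
  then show ?thesis by (intro bdd_aboveI2)
qed

lemma L2_norm_le_section_norm:
  "\<xi> \<in> E2 G \<nu> \<Longrightarrow> u \<in> units G \<Longrightarrow> L2_norm (\<nu> u) (\<xi> u) \<le> section_norm G \<nu> \<xi>"
  unfolding section_norm_def by (rule cSUP_upper[OF _ bdd_above_section_norm])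

lemma section_norm_le:
  "(\<And>u. u \<in> units G \<Longrightarrow> L2_norm (\<nu> u) (\<xi> u) \<le> C) \<Longrightarrow> section_norm G \<nu> \<xi> \<le> C"
  unfolding section_norm_def by (rule cSUP_least[OF units_nonempty])

lemma section_norm_nonneg: "\<xi> \<in> E2 G \<nu> \<Longrightarrow> 0 \<le> section_norm G \<nu> \<xi>"
  \<comment> \<open>\<open>rng G undefined\<close> serves as an arbitrary unit.\<close>
  using L2_norm_le_section_norm[OF _ rng_in_units[of undefined]] L2_norm_nonneg[OF E2_in_space[OF _ rng_in_units[of undefined]]]
  by (meson order_trans)

section \<open>Bounded operators\<close>

text \<open>Phrased with fibrewise distances and a bound \<open>d\<close>, the form that
  \<open>E2_approx\<close> supplies. It comes from the operator bound at the difference of the two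
  sections.\<close>

lemma bounded_operators_Lipschitz:
  assumes T: "T \<in> bounded_operators G \<nu>"
  obtains C where "0 \<le> C"
    "\<And>\<xi> \<eta> d u. \<xi> \<in> E2 G \<nu> \<Longrightarrow> \<eta> \<in> E2 G \<nu> \<Longrightarrow> (\<And>u. u \<in> units G \<Longrightarrow> L2_dist (\<nu> u) (\<xi> u) (\<eta> u) \<le> d) \<Longrightarrow>
      u \<in> units G \<Longrightarrow> L2_dist (\<nu> u) (T \<xi> u) (T \<eta> u) \<le> C * d"
proof -
  have T_E2: "T \<xi> \<in> E2 G \<nu>" if "\<xi> \<in> E2 G \<nu>" for \<xi>
    using T that by (auto simp: bounded_operators_def)
  have T_add: "T (section_add G \<nu> \<xi> \<eta>) = section_add G \<nu> (T \<xi>) (T \<eta>)" if "\<xi> \<in> E2 G \<nu>" "\<eta> \<in> E2 G \<nu>" for \<xi> \<eta>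
    using T that by (simp add: bounded_operators_def)
  obtain C where C: "\<And>\<xi>. \<xi> \<in> E2 G \<nu> \<Longrightarrow> section_norm G \<nu> (T \<xi>) \<le> C * section_norm G \<nu> \<xi>"
    using T unfolding bounded_operators_def by blast
  show thesis
  proof
    \<comment> \<open>The constant in \<open>bounded_operators\<close> carries no sign, while
      multiplying it onto a bound needs it nonnegative.\<close>
    show "0 \<le> max 0 C" by simp
    fix \<xi> \<eta> d u
    assume \<xi>: "\<xi> \<in> E2 G \<nu>" and \<eta>: "\<eta> \<in> E2 G \<nu>" and u: "u \<in> units G"
      and d: "\<And>u. u \<in> units G \<Longrightarrow> L2_dist (\<nu> u) (\<xi> u) (\<eta> u) \<le> d"
    define \<zeta> where "\<zeta> = section_diff G \<nu> \<xi> \<eta>"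
    have \<zeta>: "\<zeta> \<in> E2 G \<nu>" unfolding \<zeta>_def by (rule section_diff_in_E2[OF \<xi> \<eta>])
    have "section_add G \<nu> \<eta> \<zeta> = \<xi>"
    proof (rule sections_eqI)
      show "section_add G \<nu> \<eta> \<zeta> v = \<xi> v" if "v \<in> units G" for v
        using that L2_add_diff_cancel[OF E2_in_space[OF \<xi> that] E2_in_space[OF \<eta> that]]
        by (simp add: \<zeta>_def section_diff_def section_add_apply section_scale_apply)
    qed (use \<xi> \<eta> \<zeta> in \<open>auto intro: E2_in_sections section_add_in_E2\<close>)
    then have T\<xi>: "T \<xi> u = L2_add (\<nu> u) (T \<eta> u) (T \<zeta> u)"
      using T_add[OF \<eta> \<zeta>] u by (simp add: section_add_apply)
    have sp: "T \<eta> u \<in> L2_space (\<nu> u)" "T \<zeta> u \<in> L2_space (\<nu> u)"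
      using T_E2[OF \<eta>] T_E2[OF \<zeta>] u by (auto intro: E2_in_space)
    have "section_norm G \<nu> \<zeta> \<le> d"
      using d by (intro section_norm_le) (simp add: \<zeta>_def L2_norm_section_diff)
    obtain a b where ab: "a \<in> L2_fun (\<nu> u)" "b \<in> L2_fun (\<nu> u)"
        "T \<eta> u = L2_class (\<nu> u) a" "T \<zeta> u = L2_class (\<nu> u) b"
      by (rule L2_spaceE[OF sp(1)], rule L2_spaceE[OF sp(2)]) blast
    have "L2_dist (\<nu> u) (T \<xi> u) (T \<eta> u) = L2_norm (\<nu> u) (T \<zeta> u)"
      unfolding T\<xi> using ab by (simp add: L2_add_class L2_dist_class L2_norm_L2_class L2_fun_add)
    also have "\<dots> \<le> C * section_norm G \<nu> \<zeta>"
      using L2_norm_le_section_norm[OF T_E2[OF \<zeta>] u] C[OF \<zeta>] by linarith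
    also have "\<dots> \<le> max 0 C * section_norm G \<nu> \<zeta>"
      using section_norm_nonneg[OF \<zeta>] by (intro mult_right_mono) auto
    also have "\<dots> \<le> max 0 C * d"
      using \<open>section_norm G \<nu> \<zeta> \<le> d\<close> by (intro mult_left_mono) auto
    finally show "L2_dist (\<nu> u) (T \<xi> u) (T \<eta> u) \<le> max 0 C * d" .
  qed
qed

text \<open>Both operators are Lipschitz and the sections from \<open>Cc\<close> are uniformly
  dense. This is the uniqueness half of the definite description
  \<open>left_conv_op\<close>.\<close>

lemma bounded_operators_eqI:
  assumes T: "T \<in> bounded_operators G \<nu>" and S: "S \<in> bounded_operators G \<nu>"
    and eq: "\<And>f. f \<in> Cc \<Longrightarrow> T (section_of G \<nu> f) = S (section_of G \<nu> f)"
  shows "T = S"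
proof -
  obtain C where C: "0 \<le> C"
    "\<And>\<xi> \<eta> d u. \<xi> \<in> E2 G \<nu> \<Longrightarrow> \<eta> \<in> E2 G \<nu> \<Longrightarrow> (\<And>u. u \<in> units G \<Longrightarrow> L2_dist (\<nu> u) (\<xi> u) (\<eta> u) \<le> d) \<Longrightarrow>
      u \<in> units G \<Longrightarrow> L2_dist (\<nu> u) (T \<xi> u) (T \<eta> u) \<le> C * d"
    by (rule bounded_operators_Lipschitz[OF T]) blast
  obtain D where D: "0 \<le> D"
    "\<And>\<xi> \<eta> d u. \<xi> \<in> E2 G \<nu> \<Longrightarrow> \<eta> \<in> E2 G \<nu> \<Longrightarrow> (\<And>u. u \<in> units G \<Longrightarrow> L2_dist (\<nu> u) (\<xi> u) (\<eta> u) \<le> d) \<Longrightarrow>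
      u \<in> units G \<Longrightarrow> L2_dist (\<nu> u) (S \<xi> u) (S \<eta> u) \<le> D * d"
    by (rule bounded_operators_Lipschitz[OF S]) blast
  have TE: "T \<in> E2 G \<nu> \<rightarrow>\<^sub>E E2 G \<nu>" and SE: "S \<in> E2 G \<nu> \<rightarrow>\<^sub>E E2 G \<nu>"
    using T S by (auto simp: bounded_operators_def)
  have "T \<xi> = S \<xi>" if \<xi>: "\<xi> \<in> E2 G \<nu>" for \<xi>
  proof (rule sections_eqI)
    show "T \<xi> \<in> sections G \<nu>" "S \<xi> \<in> sections G \<nu>" using TE SE \<xi> by (auto intro: E2_in_sections)
    fix u assume u: "u \<in> units G"
    have sp: "T \<eta> u \<in> L2_space (\<nu> u)" "S \<eta> u \<in> L2_space (\<nu> u)" if "\<eta> \<in> E2 G \<nu>" for \<eta>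
      using TE SE that u by (auto intro: E2_in_space)
    show "T \<xi> u = S \<xi> u"
    proof (rule L2_dist_eq_0I[OF sp[OF \<xi>]])
      fix \<epsilon> :: real assume "0 < \<epsilon>"
      have CD: "0 < C + D + 1" using C(1) D(1) by simp
      with \<open>0 < \<epsilon>\<close> have \<delta>: "0 < \<epsilon> / (C + D + 1)" by simp
      obtain f where f: "f \<in> Cc" "\<And>u. u \<in> units G \<Longrightarrow> L2_dist (\<nu> u) (\<xi> u) (L2_class (\<nu> u) f) \<le> \<epsilon> / (C + D + 1)"
        by (rule E2_approx[OF \<xi> \<delta>]) blast
      let ?\<eta> = "section_of G \<nu> f"
      have \<eta>: "?\<eta> \<in> E2 G \<nu>" by (rule section_of_in_E2[OF f(1)])
      have near: "L2_dist (\<nu> v) (\<xi> v) (?\<eta> v) \<le> \<epsilon> / (C + D + 1)" if "v \<in> units G" for v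
        using f(2)[OF that] by (simp add: section_of_apply that)
      have "L2_dist (\<nu> u) (T \<xi> u) (S \<xi> u) \<le> L2_dist (\<nu> u) (T \<xi> u) (T ?\<eta> u) + L2_dist (\<nu> u) (T ?\<eta> u) (S \<xi> u)"
        by (rule L2_dist_triangle[OF sp(1)[OF \<xi>] sp(1)[OF \<eta>] sp(2)[OF \<xi>]])
      also have "\<dots> = L2_dist (\<nu> u) (T \<xi> u) (T ?\<eta> u) + L2_dist (\<nu> u) (S \<xi> u) (S ?\<eta> u)"
        using L2_dist_commute[OF sp(2)[OF \<xi>] sp(2)[OF \<eta>]] eq[OF f(1)] by simp
      also have "\<dots> \<le> C * (\<epsilon> / (C + D + 1)) + D * (\<epsilon> / (C + D + 1))"
        using C(2)[OF \<xi> \<eta> near u] D(2)[OF \<xi> \<eta> near u] by (rule add_mono)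
      also have "\<dots> = (C + D) * \<epsilon> / (C + D + 1)" by (simp add: distrib_right add_divide_distrib)
      also have "\<dots> \<le> \<epsilon>" using CD \<open>0 < \<epsilon>\<close> by (simp add: field_simps)
      finally show "L2_dist (\<nu> u) (T \<xi> u) (S \<xi> u) \<le> \<epsilon>" .
    qed
  qed
  then show ?thesis by (rule PiE_ext[OF TE SE])
qed

section \<open>Extension of convolution from \<open>Cc\<close> to \<open>E2\<close>\<close>

lemma conv_add:
  assumes "F \<in> Cc" "f \<in> Cc" "g \<in> Cc"
  shows "conv G \<nu> F (\<lambda>x. f x + g x) = (\<lambda>x. conv G \<nu> F f x + conv G \<nu> F g x)"
  using assms by (auto simp: conv_def distrib_left integrable_conv_integrand)

lemma conv_scale: "conv G \<nu> F (\<lambda>x. c * f x) = (\<lambda>x. c * conv G \<nu> F f x)"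
  by (simp add: fun_eq_iff conv_def mult.left_commute)

lemma conv_diff:
  assumes "F \<in> Cc" "f \<in> Cc" "g \<in> Cc"
  shows "conv G \<nu> F (\<lambda>x. f x - g x) = (\<lambda>x. conv G \<nu> F f x - conv G \<nu> F g x)"
  using assms by (auto simp: conv_def right_diff_distrib integrable_conv_integrand)

lemma L2_dist_conv_le:
  assumes F: "F \<in> Cc" and C: "\<And>u. u \<in> units G \<Longrightarrow> (\<integral>t. cmod (F t) \<partial>\<nu> u) \<le> C"
    and f: "f \<in> Cc" and g: "g \<in> Cc"
    and d: "\<And>u. u \<in> units G \<Longrightarrow> L2_dist (\<nu> u) (L2_class (\<nu> u) f) (L2_class (\<nu> u) g) \<le> d"
    and u: "u \<in> units G"
  shows "L2_dist (\<nu> u) (L2_class (\<nu> u) (conv G \<nu> F f)) (L2_class (\<nu> u) (conv G \<nu> F g)) \<le> C * d"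
proof -
  have "L2n (\<nu> u) (conv G \<nu> F (\<lambda>x. f x - g x)) \<le> C * d"
  proof (rule L2n_conv_le[OF u F Cc_diff[OF f g] C[OF u]])
    show "L2n (\<nu> v) (\<lambda>x. f x - g x) \<le> d" if "v \<in> units G" for v
      using d[OF that] by (simp add: L2_dist_class Cc_L2_fun that f g)
  qed
  then show ?thesis
    using u f g F by (simp add: conv_diff L2_dist_class Cc_L2_fun Cc_conv)
qed

text \<open>
  The value at \<open>\<xi>\<close> is a fibrewise limit of \<open>F * f\<^sub>k\<close>; it depends on \<open>\<xi>\<close> over all units, since
  \<open>F * f\<close> on \<open>fibre G u\<close> involves \<open>f\<close> on the fibres over \<open>src G t\<close>.
\<close>

lemma conv_limit:
  assumes F: "F \<in> Cc" and C: "\<And>u. u \<in> units G \<Longrightarrow> (\<integral>t. cmod (F t) \<partial>\<nu> u) \<le> C"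
    and \<xi>: "\<xi> \<in> E2 G \<nu>"
  obtains \<eta> where "\<eta> \<in> E2 G \<nu>"
    "\<And>f d u. f \<in> Cc \<Longrightarrow> (\<And>u. u \<in> units G \<Longrightarrow> L2_dist (\<nu> u) (\<xi> u) (L2_class (\<nu> u) f) \<le> d) \<Longrightarrow>
      u \<in> units G \<Longrightarrow> L2_dist (\<nu> u) (\<eta> u) (L2_class (\<nu> u) (conv G \<nu> F f)) \<le> C * d"
proof -
  have "0 \<le> (\<integral>t. cmod (F t) \<partial>\<nu> (rng G undefined))" by simp
  then have C0: "0 \<le> C" using C[OF rng_in_units[of undefined]] by linarith
  \<comment> \<open>Consecutive approximants differ by at most \<open>2 * \<delta> k\<close>, and
    after convolution by at most \<open>(1/4) ^ k\<close>, the rate of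
    \<open>L2_space_complete\<close>. The summand 1 allows for \<open>C = 0\<close>.\<close>
  define \<delta> where "\<delta> k = (1/4) ^ k / (2 * (C + 1))" for k :: nat
  have \<delta>: "0 < \<delta> k" for k using C0 by (simp add: \<delta>_def)
  have C\<delta>: "C * (2 * \<delta> k) \<le> (1/4) ^ k" for k
  proof -
    have "C * (2 * \<delta> k) = C / (C + 1) * (1/4) ^ k" using C0 by (simp add: \<delta>_def divide_simps)
    also have "\<dots> \<le> 1 * (1/4) ^ k" using C0 by (intro mult_right_mono) auto
    finally show ?thesis by simp
  qed
  have "\<exists>f\<in>Cc. \<forall>u\<in>units G. L2_dist (\<nu> u) (\<xi> u) (L2_class (\<nu> u) f) \<le> \<delta> k" for k
    by (rule E2_approx[OF \<xi> \<delta>[of k]]) blast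
  then obtain f where f: "\<And>k. f k \<in> Cc"
      "\<And>k u. u \<in> units G \<Longrightarrow> L2_dist (\<nu> u) (\<xi> u) (L2_class (\<nu> u) (f k)) \<le> \<delta> k"
    by metis
  note Ff = Cc_conv[OF F f(1)]
  have cls: "L2_class (\<nu> u) (f k) \<in> L2_space (\<nu> u)" "L2_class (\<nu> u) (conv G \<nu> F (f k)) \<in> L2_space (\<nu> u)"
    if "u \<in> units G" for u k
    using that by (auto intro: L2_class_Cc f(1) Ff)
  have step: "L2_dist (\<nu> u) (L2_class (\<nu> u) (conv G \<nu> F (f (Suc k)))) (L2_class (\<nu> u) (conv G \<nu> F (f k))) \<le> (1/4) ^ k"
    if u: "u \<in> units G" for u k
  proof -
    have near: "L2_dist (\<nu> v) (L2_class (\<nu> v) (f (Suc k))) (L2_class (\<nu> v) (f k)) \<le> 2 * \<delta> k" if v: "v \<in> units G" for v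
    proof -
      have "\<delta> (Suc k) \<le> \<delta> k"
        unfolding \<delta>_def using C0 by (intro divide_right_mono power_decreasing) auto
      moreover have "L2_dist (\<nu> v) (L2_class (\<nu> v) (f (Suc k))) (\<xi> v) \<le> \<delta> (Suc k)"
        using f(2)[OF v, of "Suc k"] L2_dist_commute[OF E2_in_space[OF \<xi> v] cls(1)[OF v]] by simp
      ultimately show ?thesis
        using L2_dist_triangle[OF cls(1)[OF v] E2_in_space[OF \<xi> v] cls(1)[OF v], of "Suc k" k] f(2)[OF v, of k]
        by simp
    qed
    have "L2_dist (\<nu> u) (L2_class (\<nu> u) (conv G \<nu> F (f (Suc k)))) (L2_class (\<nu> u) (conv G \<nu> F (f k))) \<le> C * (2 * \<delta> k)"
      by (rule L2_dist_conv_le[OF F C f(1) f(1) near u])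
    then show ?thesis using C\<delta>[of k] by linarith
  qed
  \<comment> \<open>The limit is taken at each unit on its own; the common rate makes the resulting
    section a uniform limit of sections from \<open>Cc\<close>.\<close>
  have "\<exists>A\<in>L2_space (\<nu> u). \<forall>k. L2_dist (\<nu> u) (L2_class (\<nu> u) (conv G \<nu> F (f k))) A \<le> 2 * (1/4) ^ k"
    if u: "u \<in> units G" for u
    by (rule L2_space_complete[of "\<lambda>k. L2_class (\<nu> u) (conv G \<nu> F (f k))" "\<nu> u"])
      (use cls(2)[OF u] step[OF u] in blast)+
  then obtain A where A: "\<And>u. u \<in> units G \<Longrightarrow> A u \<in> L2_space (\<nu> u)"
      "\<And>u k. u \<in> units G \<Longrightarrow> L2_dist (\<nu> u) (L2_class (\<nu> u) (conv G \<nu> F (f k))) (A u) \<le> 2 * (1/4) ^ k"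
    by metis
  define \<eta> where "\<eta> = (\<lambda>u\<in>units G. A u)"
  have \<eta>_sections: "\<eta> \<in> sections G \<nu>" using A(1) by (auto simp: \<eta>_def sections_def)
  have near: "L2_dist (\<nu> u) (\<eta> u) (L2_class (\<nu> u) (conv G \<nu> F (f k))) \<le> 2 * (1/4) ^ k" if "u \<in> units G" for u k
    using A(2)[OF that] L2_dist_commute[OF A(1)[OF that] cls(2)[OF that]] that by (simp add: \<eta>_def)
  have small: "\<exists>k. (1/4 :: real) ^ k < \<epsilon>" if "0 < \<epsilon>" for \<epsilon>
    using real_arch_pow_inv[OF that, of "1/4"] by simp
  show thesis
  proof
    show "\<eta> \<in> E2 G \<nu>"
    proof (rule E2I[OF \<eta>_sections])
      fix \<epsilon> :: real assume "0 < \<epsilon>"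
      then obtain k where k: "(1/4) ^ k < \<epsilon> / 2" using small[of "\<epsilon> / 2"] by auto
      show "\<exists>g\<in>Cc. \<forall>u\<in>units G. L2_dist (\<nu> u) (\<eta> u) (L2_class (\<nu> u) g) \<le> \<epsilon>"
      proof (intro bexI[OF _ Ff[of k]] ballI)
        show "L2_dist (\<nu> u) (\<eta> u) (L2_class (\<nu> u) (conv G \<nu> F (f k))) \<le> \<epsilon>" if "u \<in> units G" for u
          using near[OF that, of k] k by linarith
      qed
    qed
    fix g d u
    assume g: "g \<in> Cc" and d: "\<And>u. u \<in> units G \<Longrightarrow> L2_dist (\<nu> u) (\<xi> u) (L2_class (\<nu> u) g) \<le> d"
      and u: "u \<in> units G"
    show "L2_dist (\<nu> u) (\<eta> u) (L2_class (\<nu> u) (conv G \<nu> F g)) \<le> C * d"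
    proof (rule field_le_epsilon)
      fix \<epsilon> :: real assume "0 < \<epsilon>"
      \<comment> \<open>Of the three error terms \<open>(1/4) ^ k\<close>, two come from
        \<open>near\<close> and one from \<open>C * \<delta> k\<close>.\<close>
      then obtain k where k: "(1/4) ^ k < \<epsilon> / 3" using small[of "\<epsilon> / 3"] by auto
      have fg: "L2_dist (\<nu> v) (L2_class (\<nu> v) (f k)) (L2_class (\<nu> v) g) \<le> \<delta> k + d" if v: "v \<in> units G" for v
        using L2_dist_triangle[OF cls(1)[OF v] E2_in_space[OF \<xi> v] L2_class_Cc[OF g v], of k] f(2)[OF v, of k] d[OF v]
          L2_dist_commute[OF E2_in_space[OF \<xi> v] cls(1)[OF v], of k] by simp
      have "L2_dist (\<nu> u) (L2_class (\<nu> u) (conv G \<nu> F (f k))) (L2_class (\<nu> u) (conv G \<nu> F g)) \<le> C * (\<delta> k + d)"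
        by (rule L2_dist_conv_le[OF F C f(1) g fg u])
      moreover have "C * \<delta> k \<le> (1/4) ^ k" using C\<delta>[of k] mult_nonneg_nonneg[OF C0 less_imp_le[OF \<delta>[of k]]] by linarith
      ultimately show "L2_dist (\<nu> u) (\<eta> u) (L2_class (\<nu> u) (conv G \<nu> F g)) \<le> C * d + \<epsilon>"
        using L2_dist_triangle[OF section_in_space[OF \<eta>_sections u] cls(2)[OF u] L2_class_Cc[OF Cc_conv[OF F g] u], of k]
          near[OF u, of k] k by (simp add: distrib_left)
    qed
  qed
qed

text \<open>The values come from \<open>conv_limit\<close> by choice, hence without any linearity.
  They are nevertheless determined by their distance estimate, and linearity follows from that. The
  estimate is handed on because the final convergence argument uses it.\<close>

lemma conv_operator:
  assumes F: "F \<in> Cc" and C: "\<And>u. u \<in> units G \<Longrightarrow> (\<integral>t. cmod (F t) \<partial>\<nu> u) \<le> C"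
  obtains T where "T \<in> bounded_operators G \<nu>"
    "\<And>f. f \<in> Cc \<Longrightarrow> T (section_of G \<nu> f) = section_of G \<nu> (conv G \<nu> F f)"
    "\<And>\<xi> f d u. \<xi> \<in> E2 G \<nu> \<Longrightarrow> f \<in> Cc \<Longrightarrow> (\<And>u. u \<in> units G \<Longrightarrow> L2_dist (\<nu> u) (\<xi> u) (L2_class (\<nu> u) f) \<le> d) \<Longrightarrow>
      u \<in> units G \<Longrightarrow> L2_dist (\<nu> u) (T \<xi> u) (L2_class (\<nu> u) (conv G \<nu> F f)) \<le> C * d"
proof -
  have "0 \<le> (\<integral>t. cmod (F t) \<partial>\<nu> (rng G undefined))" by simp
  then have C0: "0 \<le> C" using C[OF rng_in_units[of undefined]] by linarith
  have "\<exists>\<eta>\<in>E2 G \<nu>. \<forall>f\<in>Cc. \<forall>d. (\<forall>u\<in>units G. L2_dist (\<nu> u) (\<xi> u) (L2_class (\<nu> u) f) \<le> d) \<longrightarrow>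
      (\<forall>u\<in>units G. L2_dist (\<nu> u) (\<eta> u) (L2_class (\<nu> u) (conv G \<nu> F f)) \<le> C * d)" if "\<xi> \<in> E2 G \<nu>" for \<xi>
    by (rule conv_limit[OF F C that]) blast+
  then obtain T0 where T0: "\<And>\<xi>. \<xi> \<in> E2 G \<nu> \<Longrightarrow> T0 \<xi> \<in> E2 G \<nu>"
    "\<And>\<xi> f d u. \<xi> \<in> E2 G \<nu> \<Longrightarrow> f \<in> Cc \<Longrightarrow> (\<forall>u\<in>units G. L2_dist (\<nu> u) (\<xi> u) (L2_class (\<nu> u) f) \<le> d) \<Longrightarrow>
      u \<in> units G \<Longrightarrow> L2_dist (\<nu> u) (T0 \<xi> u) (L2_class (\<nu> u) (conv G \<nu> F f)) \<le> C * d"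
    by metis
  define T where "T = (\<lambda>\<xi>\<in>E2 G \<nu>. T0 \<xi>)"
  have T_E2: "T \<xi> \<in> E2 G \<nu>" if "\<xi> \<in> E2 G \<nu>" for \<xi> using T0(1) that by (simp add: T_def)
  have T: "L2_dist (\<nu> u) (T \<xi> u) (L2_class (\<nu> u) (conv G \<nu> F f)) \<le> C * d"
    if "\<xi> \<in> E2 G \<nu>" "f \<in> Cc" "\<And>u. u \<in> units G \<Longrightarrow> L2_dist (\<nu> u) (\<xi> u) (L2_class (\<nu> u) f) \<le> d" "u \<in> units G"
    for \<xi> f d u
    using T0(2)[OF that(1,2) _ that(4)] that(1,3) by (simp add: T_def)
  \<comment> \<open>A section \<open>\<eta>\<close> that is near \<open>F * f\<close> for some
    \<open>f\<close> near \<open>\<xi>\<close>, at every scale, must be \<open>T \<xi>\<close>. The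
    factor \<open>D\<close> leaves room for the constants that sums and multiples introduce.\<close>
  have T_unique: "T \<xi> = \<eta>" if \<xi>: "\<xi> \<in> E2 G \<nu>" and \<eta>: "\<eta> \<in> sections G \<nu>"
    and D: "0 \<le> D" "\<And>\<delta>. 0 < \<delta> \<Longrightarrow> \<exists>f\<in>Cc. \<forall>u\<in>units G. L2_dist (\<nu> u) (\<xi> u) (L2_class (\<nu> u) f) \<le> D * \<delta> \<and>
      L2_dist (\<nu> u) (\<eta> u) (L2_class (\<nu> u) (conv G \<nu> F f)) \<le> D * \<delta>" for \<xi> \<eta> D
  proof (rule sections_eqI[OF E2_in_sections[OF T_E2[OF \<xi>]] \<eta>])
    fix u assume u: "u \<in> units G"
    have sp: "T \<xi> u \<in> L2_space (\<nu> u)" "\<eta> u \<in> L2_space (\<nu> u)"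
      using E2_in_space[OF T_E2[OF \<xi>] u] section_in_space[OF \<eta> u] .
    show "T \<xi> u = \<eta> u"
    proof (rule L2_dist_eq_0I[OF sp])
      fix \<epsilon> :: real assume "0 < \<epsilon>"
      have pos: "0 < (C + 1) * D + 1" using C0 D(1) by (simp add: add_nonneg_pos)
      define \<delta> where "\<delta> = \<epsilon> / ((C + 1) * D + 1)"
      have "0 < \<delta>" using pos \<open>0 < \<epsilon>\<close> by (simp add: \<delta>_def)
      then obtain f where f: "f \<in> Cc" "\<forall>u\<in>units G. L2_dist (\<nu> u) (\<xi> u) (L2_class (\<nu> u) f) \<le> D * \<delta> \<and>
          L2_dist (\<nu> u) (\<eta> u) (L2_class (\<nu> u) (conv G \<nu> F f)) \<le> D * \<delta>"
        using D(2) by blast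
      have spF: "L2_class (\<nu> u) (conv G \<nu> F f) \<in> L2_space (\<nu> u)" by (rule L2_class_Cc[OF Cc_conv[OF F f(1)] u])
      have "L2_dist (\<nu> u) (T \<xi> u) (\<eta> u) \<le> C * (D * \<delta>) + D * \<delta>"
        using L2_dist_triangle[OF sp(1) spF sp(2)] L2_dist_commute[OF sp(2) spF] T[OF \<xi> f(1) _ u, of "D * \<delta>"] f(2) u
        by fastforce
      also have "\<dots> = (C + 1) * D * \<delta>" by (simp add: algebra_simps)
      also have "\<dots> \<le> ((C + 1) * D + 1) * \<delta>" using \<open>0 < \<delta>\<close> by (simp add: distrib_right)
      also have "\<dots> = \<epsilon>" using pos by (simp add: \<delta>_def)
      finally show "L2_dist (\<nu> u) (T \<xi> u) (\<eta> u) \<le> \<epsilon>" .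
    qed
  qed
  have T_add: "T (section_add G \<nu> \<xi> \<eta>) = section_add G \<nu> (T \<xi>) (T \<eta>)"
    if \<xi>: "\<xi> \<in> E2 G \<nu>" and \<eta>: "\<eta> \<in> E2 G \<nu>" for \<xi> \<eta>
  proof (rule T_unique[OF section_add_in_E2[OF \<xi> \<eta>]])
    show "section_add G \<nu> (T \<xi>) (T \<eta>) \<in> sections G \<nu>"
      by (intro section_add_in_sections E2_in_sections T_E2 \<xi> \<eta>)
    \<comment> \<open>Large enough for both estimates: \<open>2 * \<delta>\<close> before
      convolution and \<open>2 * C * \<delta>\<close> after it.\<close>
    show "0 \<le> 2 * (C + 1)" using C0 by simp
    fix \<delta> :: real assume "0 < \<delta>"
    obtain f where f: "f \<in> Cc" "\<And>u. u \<in> units G \<Longrightarrow> L2_dist (\<nu> u) (\<xi> u) (L2_class (\<nu> u) f) \<le> \<delta>"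
      by (rule E2_approx[OF \<xi> \<open>0 < \<delta>\<close>]) blast
    obtain g where g: "g \<in> Cc" "\<And>u. u \<in> units G \<Longrightarrow> L2_dist (\<nu> u) (\<eta> u) (L2_class (\<nu> u) g) \<le> \<delta>"
      by (rule E2_approx[OF \<eta> \<open>0 < \<delta>\<close>]) blast
    show "\<exists>f\<in>Cc. \<forall>u\<in>units G. L2_dist (\<nu> u) (section_add G \<nu> \<xi> \<eta> u) (L2_class (\<nu> u) f) \<le> 2 * (C + 1) * \<delta> \<and>
        L2_dist (\<nu> u) (section_add G \<nu> (T \<xi>) (T \<eta>) u) (L2_class (\<nu> u) (conv G \<nu> F f)) \<le> 2 * (C + 1) * \<delta>"
    proof (intro bexI[OF _ Cc_add[OF f(1) g(1)]] ballI conjI)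
      fix u assume u: "u \<in> units G"
      have "L2_dist (\<nu> u) (section_add G \<nu> \<xi> \<eta> u) (L2_class (\<nu> u) (\<lambda>x. f x + g x)) \<le> \<delta> + \<delta>"
        using L2_dist_add[OF E2_in_space[OF \<xi> u] L2_class_Cc[OF f(1) u] E2_in_space[OF \<eta> u] L2_class_Cc[OF g(1) u]]
          f(2)[OF u] g(2)[OF u]
        by (simp add: u section_add_apply L2_add_class Cc_L2_fun f(1) g(1))
      also have "\<dots> \<le> 2 * (C + 1) * \<delta>" using C0 \<open>0 < \<delta>\<close> by (simp add: distrib_right)
      finally show "L2_dist (\<nu> u) (section_add G \<nu> \<xi> \<eta> u) (L2_class (\<nu> u) (\<lambda>x. f x + g x)) \<le> 2 * (C + 1) * \<delta>" .
      have "L2_dist (\<nu> u) (section_add G \<nu> (T \<xi>) (T \<eta>) u) (L2_class (\<nu> u) (conv G \<nu> F (\<lambda>x. f x + g x))) \<le> C * \<delta> + C * \<delta>"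
        using L2_dist_add[OF E2_in_space[OF T_E2[OF \<xi>] u] L2_class_Cc[OF Cc_conv[OF F f(1)] u]
            E2_in_space[OF T_E2[OF \<eta>] u] L2_class_Cc[OF Cc_conv[OF F g(1)] u]]
          T[OF \<xi> f u] T[OF \<eta> g u]
        by (simp add: u section_add_apply L2_add_class Cc_L2_fun Cc_conv conv_add F f(1) g(1))
      also have "\<dots> \<le> 2 * (C + 1) * \<delta>" using \<open>0 < \<delta>\<close> by (simp add: distrib_right)
      finally show "L2_dist (\<nu> u) (section_add G \<nu> (T \<xi>) (T \<eta>) u) (L2_class (\<nu> u) (conv G \<nu> F (\<lambda>x. f x + g x))) \<le> 2 * (C + 1) * \<delta>" .
    qed
  qed
  have T_scale: "T (section_scale G \<nu> c \<xi>) = section_scale G \<nu> c (T \<xi>)" if \<xi>: "\<xi> \<in> E2 G \<nu>" for c \<xi>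
  proof (rule T_unique[OF section_scale_in_E2[OF \<xi>]])
    show "section_scale G \<nu> c (T \<xi>) \<in> sections G \<nu>"
      by (intro section_scale_in_sections E2_in_sections T_E2 \<xi>)
    show "0 \<le> cmod c * (C + 1)" using C0 by simp
    fix \<delta> :: real assume "0 < \<delta>"
    obtain f where f: "f \<in> Cc" "\<And>u. u \<in> units G \<Longrightarrow> L2_dist (\<nu> u) (\<xi> u) (L2_class (\<nu> u) f) \<le> \<delta>"
      by (rule E2_approx[OF \<xi> \<open>0 < \<delta>\<close>]) blast
    show "\<exists>f\<in>Cc. \<forall>u\<in>units G. L2_dist (\<nu> u) (section_scale G \<nu> c \<xi> u) (L2_class (\<nu> u) f) \<le> cmod c * (C + 1) * \<delta> \<and>
        L2_dist (\<nu> u) (section_scale G \<nu> c (T \<xi>) u) (L2_class (\<nu> u) (conv G \<nu> F f)) \<le> cmod c * (C + 1) * \<delta>"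
    proof (intro bexI[OF _ Cc_scale[OF f(1), of c]] ballI conjI)
      fix u assume u: "u \<in> units G"
      have "L2_dist (\<nu> u) (section_scale G \<nu> c \<xi> u) (L2_class (\<nu> u) (\<lambda>x. c * f x))
          = cmod c * L2_dist (\<nu> u) (\<xi> u) (L2_class (\<nu> u) f)"
        using L2_dist_scale[OF E2_in_space[OF \<xi> u] L2_class_Cc[OF f(1) u], of c]
        by (simp add: u section_scale_apply L2_scale_class Cc_L2_fun f(1))
      also have "\<dots> \<le> cmod c * ((C + 1) * \<delta>)"
      proof (rule mult_left_mono)
        have "\<delta> \<le> (C + 1) * \<delta>" using C0 \<open>0 < \<delta>\<close> by (simp add: distrib_right)
        then show "L2_dist (\<nu> u) (\<xi> u) (L2_class (\<nu> u) f) \<le> (C + 1) * \<delta>" using f(2)[OF u] by linarith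
      qed simp
      finally show "L2_dist (\<nu> u) (section_scale G \<nu> c \<xi> u) (L2_class (\<nu> u) (\<lambda>x. c * f x)) \<le> cmod c * (C + 1) * \<delta>"
        by (simp add: mult.assoc)
      have "L2_dist (\<nu> u) (section_scale G \<nu> c (T \<xi>) u) (L2_class (\<nu> u) (conv G \<nu> F (\<lambda>x. c * f x)))
          = cmod c * L2_dist (\<nu> u) (T \<xi> u) (L2_class (\<nu> u) (conv G \<nu> F f))"
        using L2_dist_scale[OF E2_in_space[OF T_E2[OF \<xi>] u] L2_class_Cc[OF Cc_conv[OF F f(1)] u], of c]
        by (simp add: u section_scale_apply L2_scale_class Cc_L2_fun Cc_conv F f(1) conv_scale)
      also have "\<dots> \<le> cmod c * ((C + 1) * \<delta>)"
      proof (rule mult_left_mono)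
        have "C * \<delta> \<le> (C + 1) * \<delta>" using \<open>0 < \<delta>\<close> by (simp add: distrib_right)
        then show "L2_dist (\<nu> u) (T \<xi> u) (L2_class (\<nu> u) (conv G \<nu> F f)) \<le> (C + 1) * \<delta>"
          using T[OF \<xi> f u] by linarith
      qed simp
      finally show "L2_dist (\<nu> u) (section_scale G \<nu> c (T \<xi>) u) (L2_class (\<nu> u) (conv G \<nu> F (\<lambda>x. c * f x))) \<le> cmod c * (C + 1) * \<delta>"
        by (simp add: mult.assoc)
    qed
  qed
  have T_bound: "section_norm G \<nu> (T \<xi>) \<le> C * section_norm G \<nu> \<xi>" if \<xi>: "\<xi> \<in> E2 G \<nu>" for \<xi>
  proof (rule section_norm_le)
    fix u assume u: "u \<in> units G"
    have zero: "L2_norm (\<nu> v) (L2_class (\<nu> v) (\<lambda>x. 0)) = 0" for v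
      by (simp add: L2_norm_L2_class L2n_def)
    have dist_zero: "L2_dist (\<nu> v) (\<xi> v) (L2_class (\<nu> v) (\<lambda>x. 0)) \<le> section_norm G \<nu> \<xi>" if "v \<in> units G" for v
      using L2_dist_le_norms[OF E2_in_space[OF \<xi> that] L2_class_Cc[OF Cc_zero that]]
        L2_norm_le_section_norm[OF \<xi> that] zero by simp
    \<comment> \<open>The norm bound is the distance estimate for the approximant 0, with the norm
      of \<open>\<xi>\<close> as \<open>d\<close>.\<close>
    have "L2_dist (\<nu> u) (T \<xi> u) (L2_class (\<nu> u) (conv G \<nu> F (\<lambda>x. 0))) \<le> C * section_norm G \<nu> \<xi>"
      by (rule T[OF \<xi> Cc_zero dist_zero u])
    moreover have "conv G \<nu> F (\<lambda>x. 0) = (\<lambda>x. 0)" by (simp add: fun_eq_iff conv_def)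
    ultimately show "L2_norm (\<nu> u) (T \<xi> u) \<le> C * section_norm G \<nu> \<xi>"
      using L2_norm_le_dist[OF E2_in_space[OF T_E2[OF \<xi>] u] L2_class_Cc[OF Cc_zero u]] zero by simp
  qed
  show thesis
  proof
    have "T \<in> E2 G \<nu> \<rightarrow>\<^sub>E E2 G \<nu>" using T_E2 by (simp add: T_def)
    then show "T \<in> bounded_operators G \<nu>"
      unfolding bounded_operators_def using T_add T_scale T_bound by blast
    show "T (section_of G \<nu> f) = section_of G \<nu> (conv G \<nu> F f)" if f: "f \<in> Cc" for f
      \<comment> \<open>\<open>D\<close> is 0 here, since \<open>f\<close> represents its own
        section exactly.\<close>
      by (rule T_unique[OF section_of_in_E2[OF f] section_of_in_sections[OF Cc_conv[OF F f]], of 0])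
        (auto intro!: bexI[OF _ f] simp: section_of_apply L2_dist_self L2_class_Cc f Cc_conv F)
  qed (rule T)
qed

text \<open>The description denotes because \<open>conv_operator\<close> gives existence and density
  of \<open>Cc\<close> gives uniqueness; the distance estimate then carries over from the
  constructed operator.\<close>

lemma left_conv_op:
  assumes F: "F \<in> Cc" and C: "\<And>u. u \<in> units G \<Longrightarrow> (\<integral>t. cmod (F t) \<partial>\<nu> u) \<le> C"
  shows "left_conv_op G \<nu> F \<in> bounded_operators G \<nu>"
    and "\<And>\<xi> f d u. \<xi> \<in> E2 G \<nu> \<Longrightarrow> f \<in> Cc \<Longrightarrow> (\<And>u. u \<in> units G \<Longrightarrow> L2_dist (\<nu> u) (\<xi> u) (L2_class (\<nu> u) f) \<le> d) \<Longrightarrow>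
      u \<in> units G \<Longrightarrow> L2_dist (\<nu> u) (left_conv_op G \<nu> F \<xi> u) (L2_class (\<nu> u) (conv G \<nu> F f)) \<le> C * d"
proof -
  obtain T where T: "T \<in> bounded_operators G \<nu>"
    "\<And>f. f \<in> Cc \<Longrightarrow> T (section_of G \<nu> f) = section_of G \<nu> (conv G \<nu> F f)"
    and T_dist: "\<And>\<xi> f d u. \<xi> \<in> E2 G \<nu> \<Longrightarrow> f \<in> Cc \<Longrightarrow> (\<And>u. u \<in> units G \<Longrightarrow> L2_dist (\<nu> u) (\<xi> u) (L2_class (\<nu> u) f) \<le> d) \<Longrightarrow>
      u \<in> units G \<Longrightarrow> L2_dist (\<nu> u) (T \<xi> u) (L2_class (\<nu> u) (conv G \<nu> F f)) \<le> C * d"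
    by (rule conv_operator[OF F C]) blast+
  have "left_conv_op G \<nu> F = T"
    unfolding left_conv_op_def
  proof (rule the_equality)
    show "T \<in> bounded_operators G \<nu> \<and> (\<forall>f\<in>Cc. T (section_of G \<nu> f) = section_of G \<nu> (conv G \<nu> F f))"
      using T by blast
    fix S assume "S \<in> bounded_operators G \<nu> \<and> (\<forall>f\<in>Cc. S (section_of G \<nu> f) = section_of G \<nu> (conv G \<nu> F f))"
    then show "S = T" using T by (intro bounded_operators_eqI) auto
  qed
  then show "left_conv_op G \<nu> F \<in> bounded_operators G \<nu>"
    and "\<And>\<xi> f d u. \<xi> \<in> E2 G \<nu> \<Longrightarrow> f \<in> Cc \<Longrightarrow> (\<And>u. u \<in> units G \<Longrightarrow> L2_dist (\<nu> u) (\<xi> u) (L2_class (\<nu> u) f) \<le> d) \<Longrightarrow>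
      u \<in> units G \<Longrightarrow> L2_dist (\<nu> u) (left_conv_op G \<nu> F \<xi> u) (L2_class (\<nu> u) (conv G \<nu> F f)) \<le> C * d"
    using T(1) T_dist by simp_all
qed

section \<open>The approximate identity\<close>

text \<open>Away from \<open>K\<close> the mass \<open>H\<close> of the bump may vanish, so dividing
  by it is not possible on the whole space. The floor \<open>\<delta>\<close> keeps the quotient
  continuous without changing the divisor over \<open>K\<close>.\<close>

lemma normalized_bump:
  assumes K: "compact K" "K \<subseteq> units G" and V: "open V" "K \<subseteq> V"
  obtains F :: "'g \<Rightarrow> real" where "(\<lambda>x. complex_of_real (F x)) \<in> Cc" "\<And>x. 0 \<le> F x"
    "{x. F x \<noteq> 0} \<subseteq> V" "\<And>u. u \<in> units G \<Longrightarrow> (\<integral>t. F t \<partial>\<nu> u) \<le> 1"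
    "\<And>u. u \<in> K \<Longrightarrow> (\<integral>t. F t \<partial>\<nu> u) = 1"
proof -
  obtain h :: "'g \<Rightarrow> real" where h: "continuous_on UNIV h" "\<And>x. 0 \<le> h x" "\<And>x. h x \<le> 1"
      "\<And>x. x \<in> K \<Longrightarrow> h x = 1" "{x. h x \<noteq> 0} \<subseteq> V" "compact (closure {x. h x \<noteq> 0})"
    by (rule bump_function[OF locally_compact K(1) V]) blast
  have hc: "(\<lambda>x. complex_of_real (h x)) \<in> Cc"
    using h(1,6) closure_subset[of "{x. h x \<noteq> 0}"]
    by (intro CcI[of _ "closure {x. h x \<noteq> 0}"] continuous_intros) auto
  have int: "integrable (\<nu> u) h" if "u \<in> units G" for u
    using integrable_Cc[OF that hc] by (simp add: complex_of_real_integrable_eq)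
  define H where "H u = (\<integral>t. h t \<partial>\<nu> u)" for u
  have "H = (\<lambda>u. Re (\<integral>t. complex_of_real (h t) \<partial>\<nu> u))"
    by (simp add: H_def fun_eq_iff integral_complex_of_real)
  then have contH: "continuous_on (units G) H"
    using continuous_on_Re[OF continuous_integral[OF hc]] by simp
  have H0: "0 \<le> H u" for u by (simp add: H_def h(2))
  \<comment> \<open>A unit lies in its own fibre and \<open>h\<close> is 1 there, so full support
    makes the open set where \<open>h\<close> is positive count.\<close>
  have H_pos: "0 < H u" if u: "u \<in> K" for u
  proof (rule ccontr)
    have uG: "u \<in> units G" using u K(2) by blast
    assume "\<not> 0 < H u"
    with H0[of u] have "H u = 0" by simp
    have op: "open {t. 0 < h t}" using h(1) by (intro open_Collect_less) auto
    have "fibre G u \<inter> {t. 0 < h t} \<in> sets (\<nu> u)"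
      unfolding sets_haar[OF uG] sets_restrict_space by (rule imageI) (rule borel_open[OF op])
    then have meas: "{t. 0 < h t} \<inter> fibre G u \<in> sets (\<nu> u)" by (simp add: Int_commute)
    have "AE t in \<nu> u. h t = 0"
      using integral_nonneg_eq_0_iff_AE[OF int[OF uG]] h(2) \<open>H u = 0\<close> by (simp add: H_def)
    then have "AE t in \<nu> u. t \<notin> {t. 0 < h t} \<inter> fibre G u"
      by eventually_elim simp
    moreover have "0 < emeasure (\<nu> u) ({t. 0 < h t} \<inter> fibre G u)"
    proof (rule full_support[OF uG op])
      have "u \<in> {t. 0 < h t} \<inter> fibre G u" using h(4)[OF u] rng_unit[OF uG] by simp
      then show "{t. 0 < h t} \<inter> fibre G u \<noteq> {}" by blast
    qed
    moreover have "{t \<in> space (\<nu> u). \<not> t \<notin> {t. 0 < h t} \<inter> fibre G u} = {t. 0 < h t} \<inter> fibre G u"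
      using sets.sets_into_space[OF meas] by blast
    ultimately show False using AE_iff_measurable[OF meas, of "\<lambda>t. t \<notin> {t. 0 < h t} \<inter> fibre G u"] by simp
  qed
  obtain \<delta> where \<delta>: "0 < \<delta>" "\<And>u. u \<in> K \<Longrightarrow> \<delta> \<le> H u"
  proof (cases "K = {}")
    case True
    then show ?thesis using that[of 1] by simp
  next
    case False
    then obtain u where "u \<in> K" "\<forall>v\<in>K. H u \<le> H v"
      using continuous_attains_inf[OF K(1) False continuous_on_subset[OF contH K(2)]] by blast
    then show ?thesis using that[of "H u"] H_pos by blast
  qed
  define F where "F x = h x / max \<delta> (H (rng G x))" for x
  have max_pos: "0 < max \<delta> (H u)" for u using \<delta>(1) by simp
  have integral_F: "(\<integral>t. F t \<partial>\<nu> u) = H u / max \<delta> (H u)" if "u \<in> units G" for u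
  proof -
    have "(\<integral>t. F t \<partial>\<nu> u) = (\<integral>t. h t / max \<delta> (H u) \<partial>\<nu> u)"
      using that by (intro Bochner_Integration.integral_cong) (auto simp: F_def space_haar)
    then show ?thesis by (simp add: H_def)
  qed
  show thesis
  proof
    have "continuous_on UNIV (\<lambda>x. H (rng G x))"
      by (rule continuous_on_compose2[OF contH continuous_rng]) auto
    then have "continuous_on UNIV (\<lambda>x. complex_of_real (inverse (max \<delta> (H (rng G x)))))"
      using max_pos by (intro continuous_intros ballI) (auto simp: less_le)
    from Cc_mult[OF hc this] show "(\<lambda>x. complex_of_real (F x)) \<in> Cc"
      by (simp add: F_def divide_inverse)
    show "0 \<le> F x" for x using h(2) max_pos[of "rng G x"] by (simp add: F_def)
    show "{x. F x \<noteq> 0} \<subseteq> V" using h(5) by (auto simp: F_def)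
    show "(\<integral>t. F t \<partial>\<nu> u) \<le> 1" if "u \<in> units G" for u
      unfolding integral_F[OF that] using max_pos[of u] by simp
    show "(\<integral>t. F t \<partial>\<nu> u) = 1" if "u \<in> K" for u
      using integral_F[of u] \<delta> that K(2) H_pos[OF that] by (auto simp: max_absorb2)
  qed
qed

text \<open>There are countably many conditions \<open>V1 j m\<close>, and \<open>V n\<close>
  imposes those with both indices up to \<open>n\<close>, so each holds from some point on.
  \<open>M\<close> precedes \<open>W\<close> in the quantifiers because it must serve every epsilon.
  Range and source both occur since \<open>f x\<close> lives over \<open>rng G t\<close> and
  \<open>f (gmult G (ginv G t) x)\<close> over \<open>src G t\<close>.\<close>

lemma shrinking_unit_nbhds:
  obtains V K :: "nat \<Rightarrow> 'g set" where "\<And>n. open (V n)" "\<And>n. units G \<subseteq> V n"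
    "\<And>n. compact (K n)" "\<And>n. K n \<subseteq> units G"
    "\<And>L. compact L \<Longrightarrow> L \<subseteq> units G \<Longrightarrow> \<exists>N. \<forall>n\<ge>N. L \<subseteq> K n"
    "\<And>L. compact L \<Longrightarrow> L \<subseteq> units G \<Longrightarrow> \<exists>M. compact M \<and> (\<forall>W. open W \<and> units G \<subseteq> W \<longrightarrow>
      (\<exists>N. \<forall>n\<ge>N. \<forall>t\<in>V n. rng G t \<in> L \<or> src G t \<in> L \<longrightarrow> t \<in> W \<inter> M))"
proof -
  obtain B :: "nat \<Rightarrow> 'g set" where B: "\<And>j. open (B j)" "\<And>j. compact (closure (B j))"
    "\<And>K W. compact K \<Longrightarrow> open W \<Longrightarrow> K \<subseteq> W \<Longrightarrow> \<exists>j. K \<subseteq> B j \<and> B j \<subseteq> W"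
    by (rule relatively_compact_base[OF locally_compact]) blast
  define C where "C m = closure (B m) \<inter> units G" for m
  have C: "compact (C m)" "C m \<subseteq> units G" for m
    using compact_Int_closed[OF B(2) closed_units] by (auto simp: C_def)
  \<comment> \<open>Arrows with range or source in \<open>C m\<close> are forced into
    \<open>B j\<close>. Units survive: one in \<open>C m\<close> belongs to \<open>B j\<close>, and
    any other has range and source outside \<open>C m\<close>.\<close>
  define V1 where "V1 j m = (if C m \<subseteq> B j then - (rng G -` C m \<union> src G -` C m) \<union> B j else UNIV)" for j m
  define V where "V n = (\<Inter>j\<le>n. \<Inter>m\<le>n. V1 j m)" for n
  define K where "K n = (\<Union>m\<le>n. C m)" for n
  have open_V1: "open (V1 j m)" for j m
  proof -
    have "closed (rng G -` C m)" "closed (src G -` C m)"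
      by (intro closed_vimage continuous_rng continuous_src compact_imp_closed C(1))+
    then show ?thesis using B(1) by (auto simp: V1_def intro!: open_Un open_Compl)
  qed
  have units_V1: "units G \<subseteq> V1 j m" for j m
    by (auto simp: V1_def rng_unit src_unit)
  have C_cover: "\<exists>m. L \<subseteq> C m" if L: "compact L" "L \<subseteq> units G" for L
  proof -
    obtain m where "L \<subseteq> B m" using B(3)[OF L(1) open_UNIV] by blast
    then show ?thesis using L(2) closure_subset[of "B m"] by (intro exI[of _ m]) (auto simp: C_def)
  qed
  show thesis
  proof (rule that[of V K])
    show "open (V n)" for n unfolding V_def by (intro open_INT ballI open_V1) auto
    show "units G \<subseteq> V n" for n using units_V1 by (auto simp: V_def)
    show "compact (K n)" for n unfolding K_def using C(1) by (intro compact_UN) auto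
    show "K n \<subseteq> units G" for n using C(2) by (auto simp: K_def)
    fix L :: "'g set" assume L: "compact L" "L \<subseteq> units G"
    obtain m where m: "L \<subseteq> C m" using C_cover[OF L] by blast
    have "L \<subseteq> K n" if "m \<le> n" for n using m that by (auto simp: K_def)
    then show "\<exists>N. \<forall>n\<ge>N. L \<subseteq> K n" by blast
    \<comment> \<open>\<open>closure (B i)\<close> becomes the compact set \<open>M\<close>; it is
      fixed before \<open>W\<close>, and \<open>j\<close> is later chosen with \<open>B j\<close>
      inside both.\<close>
    obtain i where i: "C m \<subseteq> B i" using B(3)[OF C(1) open_UNIV] by blast
    have "\<exists>N. \<forall>n\<ge>N. \<forall>t\<in>V n. rng G t \<in> L \<or> src G t \<in> L \<longrightarrow> t \<in> W \<inter> closure (B i)"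
      if W: "open W" "units G \<subseteq> W" for W
    proof -
      have "C m \<subseteq> W \<inter> B i" using i C(2)[of m] W(2) by blast
      then obtain j where j: "C m \<subseteq> B j" "B j \<subseteq> W \<inter> B i"
        using B(3)[OF C(1)[of m], of "W \<inter> B i"] W(1) B(1) by auto
      have "t \<in> W \<inter> closure (B i)" if n: "max j m \<le> n" and t: "t \<in> V n" "rng G t \<in> L \<or> src G t \<in> L" for n t
      proof -
        have "t \<in> V1 j m" using n t(1) by (auto simp: V_def)
        then have "t \<in> B j" using j(1) t(2) m by (auto simp: V1_def)
        then show ?thesis using j(2) closure_subset[of "B i"] by blast
      qed
      then show ?thesis by blast
    qed
    then show "\<exists>M. compact M \<and> (\<forall>W. open W \<and> units G \<subseteq> W \<longrightarrow>
        (\<exists>N. \<forall>n\<ge>N. \<forall>t\<in>V n. rng G t \<in> L \<or> src G t \<in> L \<longrightarrow> t \<in> W \<inter> M))"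
      by (intro exI[of _ "closure (B i)"] conjI B(2) allI impI) (elim conjE)
  qed
qed

text \<open>The difference is an average, with weight \<open>F\<close>, of
  \<open>f (gmult G (ginv G t) x) - f x\<close>. Closeness is asked just for arrows where this can
  be nonzero, since those are the arrows that \<open>shrinking_unit_nbhds\<close> controls.\<close>

lemma conv_minus_le:
  assumes F: "(\<lambda>x. complex_of_real (F x)) \<in> Cc" "\<And>x. 0 \<le> F x" "(\<integral>t. F t \<partial>\<nu> (rng G x)) \<le> 1"
    and f: "f \<in> Cc" and "0 \<le> \<epsilon>"
    and unit_mass: "f x \<noteq> 0 \<Longrightarrow> (\<integral>t. F t \<partial>\<nu> (rng G x)) = 1"
    and close: "\<And>t. rng G t = rng G x \<Longrightarrow> F t \<noteq> 0 \<Longrightarrow> f x \<noteq> 0 \<or> f (gmult G (ginv G t) x) \<noteq> 0 \<Longrightarrow>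
      cmod (f (gmult G (ginv G t) x) - f x) \<le> \<epsilon>"
  shows "cmod (conv G \<nu> (\<lambda>x. complex_of_real (F x)) f x - f x) \<le> \<epsilon>"
proof -
  let ?F = "\<lambda>x. complex_of_real (F x)" and ?u = "rng G x"
  have intF: "integrable (\<nu> ?u) F"
    using integrable_Cc[OF rng_in_units F(1)] by (simp add: complex_of_real_integrable_eq)
  \<comment> \<open>Where \<open>f x\<close> is nonzero the mass is 1; where it vanishes both sides
    are 0.\<close>
  have "f x = (\<integral>t. ?F t * f x \<partial>\<nu> ?u)"
    using unit_mass by (cases "f x = 0") (auto simp: integral_complex_of_real)
  then have "conv G \<nu> ?F f x - f x = (\<integral>t. ?F t * f (gmult G (ginv G t) x) \<partial>\<nu> ?u) - (\<integral>t. ?F t * f x \<partial>\<nu> ?u)"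
    by (simp add: conv_def)
  also have "\<dots> = (\<integral>t. ?F t * (f (gmult G (ginv G t) x) - f x) \<partial>\<nu> ?u)"
    using integrable_conv_integrand[OF F(1) f, of x] integrable_Cc[OF rng_in_units F(1)]
    by (simp add: right_diff_distrib)
  also have "cmod \<dots> \<le> (\<integral>t. cmod (?F t * (f (gmult G (ginv G t) x) - f x)) \<partial>\<nu> ?u)"
    by (rule integral_norm_bound)
  also have "\<dots> \<le> (\<integral>t. \<epsilon> * F t \<partial>\<nu> ?u)"
  proof (rule integral_mono)
    show "integrable (\<nu> ?u) (\<lambda>t. cmod (?F t * (f (gmult G (ginv G t) x) - f x)))"
      using integrable_conv_integrand[OF F(1) f, of x] integrable_Cc[OF rng_in_units F(1)]
      by (intro integrable_norm) (simp add: right_diff_distrib)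
    show "integrable (\<nu> ?u) (\<lambda>t. \<epsilon> * F t)" using intF by simp
    fix t assume "t \<in> space (\<nu> ?u)"
    then have t: "rng G t = ?u" by (simp add: space_haar)
    have "cmod (f (gmult G (ginv G t) x) - f x) \<le> \<epsilon>" if "F t \<noteq> 0"
      using close[OF t that] \<open>0 \<le> \<epsilon>\<close> by (cases "f x = 0 \<and> f (gmult G (ginv G t) x) = 0") auto
    then show "cmod (?F t * (f (gmult G (ginv G t) x) - f x)) \<le> \<epsilon> * F t"
      using F(2)[of t] by (cases "F t = 0") (auto simp: norm_mult mult.commute intro: mult_left_mono)
  qed
  also have "\<dots> \<le> \<epsilon>" using F(3) \<open>0 \<le> \<epsilon>\<close> mult_left_mono[of _ 1 \<epsilon>] by simp
  finally show ?thesis .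
qed

text \<open>\<open>P\<close> is quantified before \<open>\<epsilon>\<close>: the measures of its
  fibre slices are bounded once and for all, so uniform smallness becomes smallness of the fibre
  integrals.\<close>

lemma approximate_identity:
  obtains F :: "nat \<Rightarrow> 'g \<Rightarrow> complex" where "\<And>n. F n \<in> Cc" "\<And>n x. F n x \<in> \<real>\<^sub>\<ge>\<^sub>0"
    "\<And>n u. u \<in> units G \<Longrightarrow> (\<integral>t. cmod (F n t) \<partial>\<nu> u) \<le> 1"
    "\<And>f. f \<in> Cc \<Longrightarrow> \<exists>P. compact P \<and> (\<forall>\<epsilon>>0. \<exists>N. \<forall>n\<ge>N.
      (\<forall>x. cmod (conv G \<nu> (F n) f x - f x) \<le> \<epsilon>) \<and> (\<forall>x. x \<notin> P \<longrightarrow> conv G \<nu> (F n) f x - f x = 0))"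
proof -
  obtain V K :: "nat \<Rightarrow> 'g set" where V: "\<And>n. open (V n)" "\<And>n. units G \<subseteq> V n"
    and K: "\<And>n. compact (K n)" "\<And>n. K n \<subseteq> units G"
    and K_cover: "\<And>L. compact L \<Longrightarrow> L \<subseteq> units G \<Longrightarrow> \<exists>N. \<forall>n\<ge>N. L \<subseteq> K n"
    and V_shrink: "\<And>L. compact L \<Longrightarrow> L \<subseteq> units G \<Longrightarrow> \<exists>M. compact M \<and> (\<forall>W. open W \<and> units G \<subseteq> W \<longrightarrow>
      (\<exists>N. \<forall>n\<ge>N. \<forall>t\<in>V n. rng G t \<in> L \<or> src G t \<in> L \<longrightarrow> t \<in> W \<inter> M))"
    by (rule shrinking_unit_nbhds) blast
  have "\<exists>F :: 'g \<Rightarrow> real. (\<lambda>x. complex_of_real (F x)) \<in> Cc \<and> (\<forall>x. 0 \<le> F x) \<and>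
    {x. F x \<noteq> 0} \<subseteq> V n \<and> (\<forall>u\<in>units G. (\<integral>t. F t \<partial>\<nu> u) \<le> 1) \<and> (\<forall>u\<in>K n. (\<integral>t. F t \<partial>\<nu> u) = 1)" for n
    by (rule normalized_bump[OF K V(1) subset_trans[OF K(2) V(2)], of n n]) blast
  then obtain F :: "nat \<Rightarrow> 'g \<Rightarrow> real" where F: "\<And>n. (\<lambda>x. complex_of_real (F n x)) \<in> Cc" "\<And>n x. 0 \<le> F n x"
    "\<And>n. {x. F n x \<noteq> 0} \<subseteq> V n" "\<And>n u. u \<in> units G \<Longrightarrow> (\<integral>t. F n t \<partial>\<nu> u) \<le> 1"
    "\<And>n u. u \<in> K n \<Longrightarrow> (\<integral>t. F n t \<partial>\<nu> u) = 1"
    by metis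
  let ?F = "\<lambda>n x. complex_of_real (F n x)"
  show thesis
  proof (rule that[of ?F])
    show "?F n \<in> Cc" for n by (rule F(1))
    show "?F n x \<in> \<real>\<^sub>\<ge>\<^sub>0" for n x using F(2) by simp
    show "(\<integral>t. cmod (?F n t) \<partial>\<nu> u) \<le> 1" if "u \<in> units G" for n u
      using F(4)[OF that, of n] F(2) by simp
    fix f :: "'g \<Rightarrow> complex" assume f: "f \<in> Cc"
    obtain S where "continuous_on UNIV f" and S: "compact S" "\<And>x. x \<notin> S \<Longrightarrow> f x = 0"
      by (rule CcE[OF f]) blast
    define L where "L = rng G ` S"
    have L: "compact L" "L \<subseteq> units G"
      using compact_continuous_image[OF continuous_on_subset[OF continuous_rng] S(1)] by (auto simp: L_def)
    have in_L: "rng G y \<in> L" if "f y \<noteq> 0" for y using S(2) that by (auto simp: L_def)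
    from V_shrink[OF L] obtain M where M: "compact M" "\<forall>W. open W \<and> units G \<subseteq> W \<longrightarrow>
        (\<exists>N. \<forall>n\<ge>N. \<forall>t\<in>V n. rng G t \<in> L \<or> src G t \<in> L \<longrightarrow> t \<in> W \<inter> M)"
      by (elim exE conjE)
    \<comment> \<open>\<open>S\<close> carries \<open>f\<close>, and the products of
      \<open>M\<close> with \<open>S\<close> eventually carry \<open>F n * f\<close>.\<close>
    define P where "P = S \<union> {gmult G x y | x y. x \<in> M \<and> y \<in> S \<and> src G x = rng G y}"
    have "compact P" unfolding P_def by (intro compact_Un compact_mult S(1) M(1))
    moreover have "\<exists>N. \<forall>n\<ge>N. (\<forall>x. cmod (conv G \<nu> (?F n) f x - f x) \<le> \<epsilon>) \<and>
        (\<forall>x. x \<notin> P \<longrightarrow> conv G \<nu> (?F n) f x - f x = 0)" if "0 < \<epsilon>" for \<epsilon>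
    proof -
      obtain W where W: "open W" "units G \<subseteq> W"
          "\<And>t x. t \<in> W \<Longrightarrow> rng G t = rng G x \<Longrightarrow> cmod (f (gmult G (ginv G t) x) - f x) < \<epsilon>"
        by (rule nearly_invariant_nbhd[OF f \<open>0 < \<epsilon>\<close>]) blast
      obtain N1 where N1: "\<And>n t. N1 \<le> n \<Longrightarrow> t \<in> V n \<Longrightarrow> rng G t \<in> L \<or> src G t \<in> L \<Longrightarrow> t \<in> W \<inter> M"
        using spec[OF M(2), of W] W(1,2) by blast
      obtain N2 where N2: "\<And>n. N2 \<le> n \<Longrightarrow> L \<subseteq> K n" using K_cover[OF L] by blast
      have near_units: "t \<in> W \<inter> M"
        if "max N1 N2 \<le> n" "rng G t = rng G x" "F n t \<noteq> 0" "f x \<noteq> 0 \<or> f (gmult G (ginv G t) x) \<noteq> 0" for n t x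
      proof -
        have "t \<in> V n" using F(3) that(3) by blast
        \<comment> \<open>A nonzero \<open>f x\<close> puts \<open>rng G x\<close>, which is
          \<open>rng G t\<close>, into \<open>L\<close>; a nonzero value at the translate puts its
          range \<open>src G t\<close> there.\<close>
        moreover have "rng G t \<in> L \<or> src G t \<in> L"
          using that(2,4) in_L[of x] in_L[of "gmult G (ginv G t) x"] rng_mult_eq[of "ginv G t" x] by auto
        ultimately show ?thesis using N1[of n t] that(1) by simp
      qed
      have "cmod (conv G \<nu> (?F n) f x - f x) \<le> \<epsilon>" if n: "max N1 N2 \<le> n" for n x
      proof (rule conv_minus_le[OF F(1,2) F(4)[OF rng_in_units] f less_imp_le[OF \<open>0 < \<epsilon>\<close>]])
        show "(\<integral>t. F n t \<partial>\<nu> (rng G x)) = 1" if "f x \<noteq> 0"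
          using N2[of n] in_L[OF that] n by (intro F(5)) auto
        fix t assume "rng G t = rng G x" "F n t \<noteq> 0" "f x \<noteq> 0 \<or> f (gmult G (ginv G t) x) \<noteq> 0"
        then show "cmod (f (gmult G (ginv G t) x) - f x) \<le> \<epsilon>"
          using near_units[OF n] W(3)[of t x] by (simp add: less_imp_le)
      qed
      moreover have "conv G \<nu> (?F n) f x - f x = 0" if n: "max N1 N2 \<le> n" and x: "x \<notin> P" for n x
      proof -
        have "f x = 0" using S(2) x by (auto simp: P_def)
        moreover have "conv G \<nu> (?F n) f x = 0"
        proof (rule ccontr)
          assume "conv G \<nu> (?F n) f x \<noteq> 0"
          then have "x \<in> {gmult G x y | x y. x \<in> M \<and> y \<in> S \<and> src G x = rng G y}"
            using near_units[OF n] S(2) by (intro conv_supported_in_product[of "?F n" x f M S]) auto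
          then show False using x by (simp add: P_def)
        qed
        ultimately show ?thesis by simp
      qed
      ultimately show ?thesis by blast
    qed
    ultimately show "\<exists>P. compact P \<and> (\<forall>\<epsilon>>0. \<exists>N. \<forall>n\<ge>N.
        (\<forall>x. cmod (conv G \<nu> (?F n) f x - f x) \<le> \<epsilon>) \<and> (\<forall>x. x \<notin> P \<longrightarrow> conv G \<nu> (?F n) f x - f x = 0))"
      by blast
  qed
qed

section \<open>Convergence in the strong operator topology and in the convolution algebra\<close>

lemma id_op_bounded: "id_op G \<nu> \<in> bounded_operators G \<nu>"
proof -
  have "\<exists>C. \<forall>\<xi>\<in>E2 G \<nu>. section_norm G \<nu> (id_op G \<nu> \<xi>) \<le> C * section_norm G \<nu> \<xi>"
    by (rule exI[of _ 1]) (simp add: id_op_def)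
  then show ?thesis
    by (simp add: bounded_operators_def section_add_in_E2 section_scale_in_E2)
      (simp add: id_op_def section_add_in_E2 section_scale_in_E2)
qed

text \<open>The subbasic sets are balls around arbitrary operators \<open>S\<close>, so membership
  of \<open>id_op G \<nu>\<close> must first be converted into a smaller ball around it at the
  section \<open>\<xi>\<close>.\<close>

lemma limitin_strong_operator_topology:
  assumes T: "\<And>n. T n \<in> bounded_operators G \<nu>"
    and lim: "\<And>\<xi> \<epsilon>. \<xi> \<in> E2 G \<nu> \<Longrightarrow> 0 < \<epsilon> \<Longrightarrow>
      eventually (\<lambda>n. \<forall>u\<in>units G. L2_dist (\<nu> u) (T n \<xi> u) (\<xi> u) \<le> \<epsilon>) sequentially"
  shows "limitin (strong_operator_topology_E2 G \<nu>) T (id_op G \<nu>) sequentially"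
  unfolding strong_operator_topology_E2_def
proof (rule limitin_topology_generated_by)
  define nbhd where "nbhd S \<xi> \<epsilon> = {T \<in> bounded_operators G \<nu>. section_norm G \<nu> (section_diff G \<nu> (T \<xi>) (S \<xi>)) < \<epsilon>}"
    for S \<xi> and \<epsilon> :: real
  let ?\<S> = "{nbhd S \<xi> \<epsilon> | S \<xi> \<epsilon>. S \<in> bounded_operators G \<nu> \<and> \<xi> \<in> E2 G \<nu> \<and> \<epsilon> > 0}"
  have bounded_E2: "S \<xi> \<in> E2 G \<nu>" if "S \<in> bounded_operators G \<nu>" "\<xi> \<in> E2 G \<nu>" for S \<xi>
    using that by (auto simp: bounded_operators_def)
  \<comment> \<open>The ball around \<open>id_op G \<nu>\<close> at the zero section shows that the
    limit lies in the topspace.\<close>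
  let ?z = "section_of G \<nu> (\<lambda>x. 0)"
  have z: "?z \<in> E2 G \<nu>" by (rule section_of_in_E2[OF Cc_zero])
  have "section_norm G \<nu> (section_diff G \<nu> (id_op G \<nu> ?z) (id_op G \<nu> ?z)) \<le> 0"
    using z by (intro section_norm_le) (simp add: id_op_def L2_norm_section_diff L2_dist_self E2_in_space)
  then have "id_op G \<nu> \<in> nbhd (id_op G \<nu>) ?z 1" using id_op_bounded by (simp add: nbhd_def)
  moreover have "nbhd (id_op G \<nu>) ?z 1 \<in> ?\<S>" using id_op_bounded z zero_less_one by blast
  ultimately have "id_op G \<nu> \<in> \<Union>?\<S>" by blast
  then show "id_op G \<nu> \<in> \<Union>{{T \<in> bounded_operators G \<nu>. section_norm G \<nu> (section_diff G \<nu> (T \<xi>) (S \<xi>)) < \<epsilon>} | S \<xi> \<epsilon>.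
      S \<in> bounded_operators G \<nu> \<and> \<xi> \<in> E2 G \<nu> \<and> \<epsilon> > 0}"
    unfolding nbhd_def .
  fix U assume "U \<in> {{T \<in> bounded_operators G \<nu>. section_norm G \<nu> (section_diff G \<nu> (T \<xi>) (S \<xi>)) < \<epsilon>} | S \<xi> \<epsilon>.
      S \<in> bounded_operators G \<nu> \<and> \<xi> \<in> E2 G \<nu> \<and> \<epsilon> > 0}"
  then obtain S \<xi> \<epsilon> where U: "U = nbhd S \<xi> \<epsilon>" and S: "S \<in> bounded_operators G \<nu>" and \<xi>: "\<xi> \<in> E2 G \<nu>"
    unfolding nbhd_def by blast
  assume "id_op G \<nu> \<in> U"
  then have less: "section_norm G \<nu> (section_diff G \<nu> \<xi> (S \<xi>)) < \<epsilon>"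
    using \<xi> by (simp add: U nbhd_def id_op_def)
  \<comment> \<open>Half of the gap between the radius and the distance, so that the final
    inequality stays strict.\<close>
  define \<eta> where "\<eta> = (\<epsilon> - section_norm G \<nu> (section_diff G \<nu> \<xi> (S \<xi>))) / 2"
  have "0 < \<eta>" using less by (simp add: \<eta>_def)
  have S\<xi>: "S \<xi> \<in> E2 G \<nu>" by (rule bounded_E2[OF S \<xi>])
  show "eventually (\<lambda>n. T n \<in> U) sequentially"
    using lim[OF \<xi> \<open>0 < \<eta>\<close>]
  proof eventually_elim
    case (elim n)
    have "section_norm G \<nu> (section_diff G \<nu> (T n \<xi>) (S \<xi>)) \<le> \<eta> + section_norm G \<nu> (section_diff G \<nu> \<xi> (S \<xi>))"
    proof (rule section_norm_le)
      fix u assume u: "u \<in> units G"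
      show "L2_norm (\<nu> u) (section_diff G \<nu> (T n \<xi>) (S \<xi>) u) \<le> \<eta> + section_norm G \<nu> (section_diff G \<nu> \<xi> (S \<xi>))"
        using L2_dist_triangle[OF E2_in_space[OF bounded_E2[OF T \<xi>] u] E2_in_space[OF \<xi> u] E2_in_space[OF S\<xi> u], of n]
          elim u L2_norm_le_section_norm[OF section_diff_in_E2[OF \<xi> S\<xi>] u]
        by (fastforce simp: L2_norm_section_diff)
    qed
    also have "\<dots> < \<epsilon>" using less by (simp add: \<eta>_def field_simps)
    finally show ?case using T by (simp add: U nbhd_def)
  qed
qed

text \<open>Off \<open>P\<close> the difference vanishes, and the fibre slices of \<open>P\<close>
  have uniformly bounded measure; a uniform bound thus passes to both integrals at all
  units.\<close>

lemma approximate_identity_conv: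
  assumes F: "\<And>n. F n \<in> Cc" and f: "f \<in> Cc"
    and approx: "\<exists>P. compact P \<and> (\<forall>\<epsilon>>0. \<exists>N. \<forall>n\<ge>N.
      (\<forall>x. cmod (conv G \<nu> (F n) f x - f x) \<le> \<epsilon>) \<and> (\<forall>x. x \<notin> P \<longrightarrow> conv G \<nu> (F n) f x - f x = 0))"
    and "0 < \<epsilon>"
  shows "eventually (\<lambda>n. \<forall>u\<in>units G. (\<integral>x. cmod (conv G \<nu> (F n) f x - f x) \<partial>\<nu> u) \<le> \<epsilon>) sequentially"
    and "eventually (\<lambda>n. \<forall>u\<in>units G. L2n (\<nu> u) (\<lambda>x. conv G \<nu> (F n) f x - f x) \<le> \<epsilon>) sequentially"
proof -
  let ?d = "\<lambda>n x. conv G \<nu> (F n) f x - f x"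
  obtain P where P: "compact P" "\<And>\<epsilon>. 0 < \<epsilon> \<Longrightarrow> \<exists>N. \<forall>n\<ge>N. (\<forall>x. cmod (?d n x) \<le> \<epsilon>) \<and> (\<forall>x. x \<notin> P \<longrightarrow> ?d n x = 0)"
    using approx by blast
  obtain C where C: "0 \<le> C" "\<And>u. u \<in> units G \<Longrightarrow> measure (\<nu> u) (P \<inter> fibre G u) \<le> C"
    by (rule bounded_measure_compact[OF P(1)]) blast
  have dCc: "?d n \<in> Cc" for n by (intro Cc_diff Cc_conv F f)
  have bound: "\<bar>\<integral>x. cmod (?d n x) ^ k \<partial>\<nu> u\<bar> \<le> \<delta> ^ k * C"
    if u: "u \<in> units G" and k: "0 < k" and \<delta>: "0 \<le> \<delta>" and d: "\<And>x. cmod (?d n x) \<le> \<delta>" "\<And>x. x \<notin> P \<Longrightarrow> ?d n x = 0" for n u k \<delta>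
  proof -
    have "norm (\<integral>x. cmod (?d n x) ^ k \<partial>\<nu> u) \<le> \<delta> ^ k * measure (\<nu> u) (P \<inter> fibre G u)"
    proof (rule norm_integral_haar_le[OF u _ P(1)])
      show "(\<lambda>x. cmod (?d n x) ^ k) \<in> borel_measurable (\<nu> u)"
        using measurable_Cc[OF u dCc] by measurable
    qed (use d k in \<open>auto intro: power_mono\<close>)
    also have "\<dots> \<le> \<delta> ^ k * C" using C(2)[OF u] \<delta> by (intro mult_left_mono) auto
    finally show ?thesis by simp
  qed
  have C1: "0 < C + 1" using C(1) by simp
  have "eventually (\<lambda>n. \<forall>u\<in>units G. (\<integral>x. cmod (?d n x) \<partial>\<nu> u) \<le> \<epsilon> \<and> L2n (\<nu> u) (?d n) \<le> \<epsilon>) sequentially"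
  proof -
    \<comment> \<open>One \<open>\<delta>\<close> serves both norms: \<open>\<delta> * C\<close> is
      at most \<open>\<epsilon>\<close>, and \<open>\<delta>\<^sup>2 * C\<close> at most
      \<open>\<epsilon>\<^sup>2\<close>, as \<open>C\<close> is at most
      \<open>(C + 1)\<^sup>2\<close>.\<close>
    define \<delta> where "\<delta> = \<epsilon> / (C + 1)"
    have \<delta>: "0 < \<delta>" "\<delta> * (C + 1) = \<epsilon>" using \<open>0 < \<epsilon>\<close> C1 by (simp_all add: \<delta>_def)
    obtain N where N: "\<And>n x. N \<le> n \<Longrightarrow> cmod (?d n x) \<le> \<delta>" "\<And>n x. N \<le> n \<Longrightarrow> x \<notin> P \<Longrightarrow> ?d n x = 0"
      using P(2)[OF \<delta>(1)] by blast
    have "(\<integral>x. cmod (?d n x) \<partial>\<nu> u) \<le> \<epsilon> \<and> L2n (\<nu> u) (?d n) \<le> \<epsilon>" if n: "N \<le> n" and u: "u \<in> units G" for n u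
    proof
      have "(\<integral>x. cmod (?d n x) \<partial>\<nu> u) \<le> \<delta> * C"
        using bound[OF u zero_less_one less_imp_le[OF \<delta>(1)] N[OF n]] by simp
      also have "\<dots> \<le> \<epsilon>" using \<delta> by (simp add: distrib_left)
      finally show "(\<integral>x. cmod (?d n x) \<partial>\<nu> u) \<le> \<epsilon>" .
      have "(L2n (\<nu> u) (?d n))\<^sup>2 \<le> \<delta>\<^sup>2 * C"
        unfolding L2n_square using bound[OF u pos2 less_imp_le[OF \<delta>(1)] N[OF n]] by simp
      also have "\<dots> \<le> \<delta>\<^sup>2 * (C + 1)\<^sup>2"
        using C(1) by (intro mult_left_mono) (auto simp: power2_eq_square algebra_simps)
      also have "\<dots> = \<epsilon>\<^sup>2" by (simp flip: \<delta>(2) add: power_mult_distrib)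
      finally show "L2n (\<nu> u) (?d n) \<le> \<epsilon>" using \<open>0 < \<epsilon>\<close> by (rule power2_le_imp_le[OF _ less_imp_le])
    qed
    then show ?thesis unfolding eventually_sequentially by blast
  qed
  then show "eventually (\<lambda>n. \<forall>u\<in>units G. (\<integral>x. cmod (?d n x) \<partial>\<nu> u) \<le> \<epsilon>) sequentially"
    and "eventually (\<lambda>n. \<forall>u\<in>units G. L2n (\<nu> u) (?d n) \<le> \<epsilon>) sequentially"
    by (auto elim: eventually_mono)
qed

lemma E2_representatives:
  assumes \<xi>: "\<xi> \<in> E2 G \<nu>" and \<eta>: "\<eta> \<in> E2 G \<nu>" and u: "u \<in> units G"
  obtains f g where "f \<in> L2_fun (\<nu> u)" "\<xi> u = L2_class (\<nu> u) f"
    "g \<in> L2_fun (\<nu> u)" "\<eta> u = L2_class (\<nu> u) g"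
proof -
  have "\<exists>f. f \<in> L2_fun (\<nu> u) \<and> \<xi> u = L2_class (\<nu> u) f"
    using L2_spaceE[OF E2_in_space[OF \<xi> u]] by blast
  moreover have "\<exists>g. g \<in> L2_fun (\<nu> u) \<and> \<eta> u = L2_class (\<nu> u) g"
    using L2_spaceE[OF E2_in_space[OF \<eta> u]] by blast
  ultimately show thesis using that by (elim exE conjE)
qed

lemma approximate_identity_strong:
  "\<exists>F :: nat \<Rightarrow> 'g \<Rightarrow> complex.
    bounded_left_approximate_identity G \<nu> F \<and>
    (\<forall>n x. F n x \<in> \<real>\<^sub>\<ge>\<^sub>0) \<and>
    limitin (strong_operator_topology_E2 G \<nu>) (\<lambda>n. left_conv_op G \<nu> (F n)) (id_op G \<nu>) sequentially"
proof -
  obtain F :: "nat \<Rightarrow> 'g \<Rightarrow> complex" where F: "\<And>n. F n \<in> Cc" "\<And>n x. F n x \<in> \<real>\<^sub>\<ge>\<^sub>0"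
    and mass: "\<And>n u. u \<in> units G \<Longrightarrow> (\<integral>t. cmod (F n t) \<partial>\<nu> u) \<le> 1"
    and approx: "\<And>f. f \<in> Cc \<Longrightarrow> \<exists>P. compact P \<and> (\<forall>\<epsilon>>0. \<exists>N. \<forall>n\<ge>N.
      (\<forall>x. cmod (conv G \<nu> (F n) f x - f x) \<le> \<epsilon>) \<and> (\<forall>x. x \<notin> P \<longrightarrow> conv G \<nu> (F n) f x - f x = 0))"
    by (rule approximate_identity) blast
  note ev = approximate_identity_conv[where F = F, OF F(1) _ approx]
  have "(\<lambda>n. norm_Ir G \<nu> (\<lambda>x. conv G \<nu> (F n) f x - f x)) \<longlonglongrightarrow> 0" if f: "f \<in> Cc" for f
  proof (rule tendstoI)
    fix \<epsilon> :: real assume "0 < \<epsilon>"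
    then have "0 < \<epsilon> / 2" by simp
    show "eventually (\<lambda>n. dist (norm_Ir G \<nu> (\<lambda>x. conv G \<nu> (F n) f x - f x)) 0 < \<epsilon>) sequentially"
      using ev(1)[OF f f \<open>0 < \<epsilon> / 2\<close>]
    proof eventually_elim
      case (elim n)
      let ?I = "\<lambda>u. \<integral>x. cmod (conv G \<nu> (F n) f x - f x) \<partial>\<nu> u"
      have "norm_Ir G \<nu> (\<lambda>x. conv G \<nu> (F n) f x - f x) \<le> \<epsilon> / 2"
        unfolding norm_Ir_def using elim by (intro cSUP_least units_nonempty) auto
      \<comment> \<open>Convergence to 0 also needs a lower bound on the supremum; any single unit
        provides it.\<close>
      moreover have "?I (rng G undefined) \<le> norm_Ir G \<nu> (\<lambda>x. conv G \<nu> (F n) f x - f x)"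
        unfolding norm_Ir_def using elim by (intro cSUP_upper bdd_aboveI2[where M = "\<epsilon> / 2"]) auto
      moreover have "0 \<le> ?I (rng G undefined)" by simp
      ultimately have "\<bar>norm_Ir G \<nu> (\<lambda>x. conv G \<nu> (F n) f x - f x)\<bar> \<le> \<epsilon> / 2" by linarith
      then show ?case using \<open>0 < \<epsilon>\<close> by simp
    qed
  qed
  moreover have "norm_Ir G \<nu> (F n) \<le> 1" for n
    unfolding norm_Ir_def by (intro cSUP_least units_nonempty mass)
  ultimately have "bounded_left_approximate_identity G \<nu> F"
    unfolding bounded_left_approximate_identity_def using F(1) by blast
  moreover have "limitin (strong_operator_topology_E2 G \<nu>) (\<lambda>n. left_conv_op G \<nu> (F n)) (id_op G \<nu>) sequentially"
  proof (rule limitin_strong_operator_topology)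
    show L: "left_conv_op G \<nu> (F n) \<in> bounded_operators G \<nu>" for n
      by (rule left_conv_op(1)[OF F(1) mass])
    fix \<xi> and \<epsilon> :: real assume \<xi>: "\<xi> \<in> E2 G \<nu>" and "0 < \<epsilon>"
    \<comment> \<open>One third each for the operator value at \<open>\<xi>\<close> against
      \<open>F n * f\<close>, for \<open>F n * f\<close> against \<open>f\<close>, and for
      \<open>f\<close> against \<open>\<xi>\<close>. The first is no larger than the last because
      every \<open>F n\<close> has fibre mass at most 1.\<close>
    then have "0 < \<epsilon> / 3" by simp
    obtain f where f: "f \<in> Cc" "\<And>u. u \<in> units G \<Longrightarrow> L2_dist (\<nu> u) (\<xi> u) (L2_class (\<nu> u) f) \<le> \<epsilon> / 3"
      by (rule E2_approx[OF \<xi> \<open>0 < \<epsilon> / 3\<close>]) blast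
    show "eventually (\<lambda>n. \<forall>u\<in>units G. L2_dist (\<nu> u) (left_conv_op G \<nu> (F n) \<xi> u) (\<xi> u) \<le> \<epsilon>) sequentially"
      using ev(2)[OF f(1) f(1) \<open>0 < \<epsilon> / 3\<close>]
    proof eventually_elim
      case (elim n)
      show ?case
      proof
        fix u assume u: "u \<in> units G"
        let ?Ff = "conv G \<nu> (F n) f" and ?L = "left_conv_op G \<nu> (F n)"
        have L_E2: "?L \<xi> \<in> E2 G \<nu>" using L[of n] \<xi> by (auto simp: bounded_operators_def)
        obtain a b where a: "a \<in> L2_fun (\<nu> u)" "?L \<xi> u = L2_class (\<nu> u) a"
          and b: "b \<in> L2_fun (\<nu> u)" "\<xi> u = L2_class (\<nu> u) b"
          by (rule E2_representatives[OF L_E2 \<xi> u])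
        have f_L2: "f \<in> L2_fun (\<nu> u)" "?Ff \<in> L2_fun (\<nu> u)"
          by (intro Cc_L2_fun Cc_conv u f(1) F(1))+
        have "L2_dist (\<nu> u) (?L \<xi> u) (L2_class (\<nu> u) ?Ff) \<le> 1 * (\<epsilon> / 3)"
          by (rule left_conv_op(2)[OF F(1) mass \<xi> f u])
        then have "L2n (\<nu> u) (\<lambda>x. a x - ?Ff x) \<le> \<epsilon> / 3"
          by (simp add: a L2_dist_class f_L2)
        moreover have "L2n (\<nu> u) (\<lambda>x. ?Ff x - f x) \<le> \<epsilon> / 3"
          using elim u by blast
        moreover have "L2n (\<nu> u) (\<lambda>x. f x - b x) \<le> \<epsilon> / 3"
          using f(2)[OF u] by (simp add: b L2_dist_class f_L2 L2n_def norm_minus_commute)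
        ultimately have "L2n (\<nu> u) (\<lambda>x. a x - b x) \<le> \<epsilon>"
          using L2n_triangle[OF L2_fun_diff[OF a(1) f_L2(2)] L2_fun_diff[OF f_L2(2,1)]]
            L2n_triangle[OF L2_fun_diff[OF a(1) f_L2(1)] L2_fun_diff[OF f_L2(1) b(1)]]
          by simp
        then show "L2_dist (\<nu> u) (?L \<xi> u) (\<xi> u) \<le> \<epsilon>"
          by (simp add: a b L2_dist_class)
      qed
    qed
  qed
  ultimately show ?thesis using F(2) by blast
qed

end

theorem proposition11:
  fixes G :: "'g::{t2_space, second_countable_topology} groupoid"
    and \<nu> :: "'g \<Rightarrow> 'g measure"
  assumes "left_haar_system G \<nu>"
  shows "\<exists>F :: nat \<Rightarrow> 'g \<Rightarrow> complex.
    bounded_left_approximate_identity G \<nu> F \<and>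
    (\<forall>n x. F n x \<in> \<real>\<^sub>\<ge>\<^sub>0) \<and>
    limitin (strong_operator_topology_E2 G \<nu>) (\<lambda>n. left_conv_op G \<nu> (F n)) (id_op G \<nu>) sequentially"
  using assms by (rule left_haar_system.approximate_identity_strong)

end
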